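(* Let $K$ be a commutative ring with unit and let $(\mathfrak q,\mathfrak p,\eta)$ be a crossed module of Leibniz algebras over $K$. Then the category of representations of $(\mathfrak q,\mathfrak p,\eta)$ is isomorphic to the category of left modules over its universal enveloping crossed module of algebras $\mathrm{XUL}(\mathfrak q,\mathfrak p,\eta)$.
   Context: All algebras are over $K$; the category of associative algebras is that of (non-unital) associative algebras. A (right) Leibniz algebra is a $K$-module $\mathfrak p$ with a bilinear bracket satisfying $[[x,y],z]=[x,[y,z]]+[[x,z],y]$. An action of a Leibniz algebra $\mathfrak p$ on a Leibniz algebra $\mathfrak q$ is a pair of bilinear maps $\mathfrak p\times\mathfrak q\to\mathfrak q$, $\mathfrak q\times\mathfrak p\to\mathfrak q$, both written $[\ ,\ ]$, such that the Leibniz identity holds whenever two of the three elements lie in $\mathfrak p$ and one in $\mathfrak q$, or one in $\mathfrak p$ and two in $\mathfrak q$. The semidirect product $\mathfrak q\rtimes\mathfrak p$ is $\mathfrak q\oplus\mathfrak p$ with $[(q_1,p_1),(q_2,p_2)]=([q_1,q_2]+[p_1,q_2]+[q_1,p_2],[p_1,p_2])$. A crossed module of Leibniz algebras $(\mathfrak q,\mathfrak p,\eta)$ is a morphism of Leibniz algebras $\eta:\mathfrak q\to\mathfrak p$ with an action of $\mathfrak p$ on $\mathfrak q$ such that $\eta([p,q])=[p,\eta(q)]$, $\eta([q,p])=[\eta(q),p]$ and $[\eta(q_1),q_2]=[q_1,q_2]=[q_1,\eta(q_2)]$. An abelian Leibniz crossed module $(N,M,\mu)$ is just a $K$-linear map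 $\mu:N\to M$ (all brackets and actions zero). **Representations.** A representation of $(\mathfrak q,\mathfrak p,\eta)$ is an abelian Leibniz crossed module $(N,M,\mu)$ together with: (i) actions of the Leibniz algebra $\mathfrak p$ on $N$ and $M$ (and hence of $\mathfrak q$ via $\eta$: $[q,m]:=[\eta(q),m]$, etc.) such that $\mu([p,n])=[p,\mu(n)]$ and $\mu([n,p])=[\mu(n),p]$; (ii) $K$-bilinear maps $\xi_1:\mathfrak q\times M\to N$ and $\xi_2:M\times\mathfrak q\to N$ such that for all $q,q'\in\mathfrak q$, $p\in\mathfrak p$, $n\in N$, $m\in M$: - $\mu\xi_2(m,q)=[m,q]$, $\ \mu\xi_1(q,m)=[q,m]$, $\ \xi_2(\mu(n),q)=[n,q]$, $\ \xi_1(q,\mu(n))=[q,n]$; - $\xi_2(m,[p,q])=\xi_2([m,p],q)-[\xi_2(m,q),p]$; - $\xi_1([p,q],m)=\xi_2([p,m],q)-[p,\xi_2(m,q)]$; - $\xi_2(m,[q,p])=[\xi_2(m,q),p]-\xi_2([m,p],q)$; - $\xi_1([q,p],m)=[\xi_1(q,m),p]-\xi_1(q,[m,p])$; - $\xi_2(m,[q,q'])=[\xi_2(m,q),q']-[\xi_2(m,q'),q]$; - $\xi_1([q,q'],m)=[\xi_1(q,m),q']-[q,\xi_2(m,q')]$; - $\xi_1(q,[p,m])=-\xi_1(q,[m,p])$, $\ [p,\xi_1(q,m)]=-[p,\xi_2(m,q)]$. A morphism $(N,M,\mu)\to(N',M',\mu')$ of representations is a pair of $K$-linear maps $f_N:N\to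 N'$, $f_M:M\to M'$ with $f_M\mu=\mu'f_N$, compatible with the left and right actions of $\mathfrak p$, and with $f_N(\xi_1(q,m))=\xi_1'(q,f_M(m))$, $f_N(\xi_2(m,q))=\xi_2'(f_M(m),q)$. **Crossed modules of algebras.** A crossed module of (associative) algebras $(B,A,\rho)$ is an algebra homomorphism $\rho:B\to A$ with an action of $A$ on $B$ (an $A$-bimodule structure on $B$ with $a(bb')=(ab)b'$, $(ba)b'=b(ab')$, $(bb')a=b(b'a)$) such that $\rho(ab)=a\rho(b)$, $\rho(ba)=\rho(b)a$, $\rho(b_1)b_2=b_1b_2=b_1\rho(b_2)$. A morphism $(\varphi,\psi):(B,A,\rho)\to(B',A',\rho')$ is a pair of algebra homomorphisms $\varphi:B\to B'$, $\psi:A\to A'$ with $\psi\rho=\rho'\varphi$, $\varphi(ba)=\varphi(b)\psi(a)$, $\varphi(ab)=\psi(a)\varphi(b)$. **Left modules.** For a $K$-linear map $\delta:V\to W$, let $\operatorname{End}(V,W,\delta)$ be the algebra of pairs $(\alpha,\beta)\in\operatorname{End}_K(V)\times\operatorname{End}_K(W)$ with $\beta\delta=\delta\alpha$. Then $(\operatorname{Hom}_K(W,V),\operatorname{End}(V,W,\delta),\Gamma)$ is a crossed module of algebras, where $\Gamma(d)=(d\delta,\delta d)$, the actions are $(\alpha,\beta)\cdot d=\alpha d$, $d\cdot(\alpha,\beta)=d\beta$, and the product on $\operatorname{Hom}_K(W,V)$ (forced by the crossed module axioms) is $dd'=d\delta d'$. A left module over $(B,A,\rho)$ is an abelian crossed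 module of algebras $(V,W,\delta)$, that is, a $K$-linear map $\delta:V\to W$ with trivial action of $W$ on $V$, together with a morphism of crossed modules of algebras $(\varphi,\psi):(B,A,\rho)\to(\operatorname{Hom}_K(W,V),\operatorname{End}(V,W,\delta),\Gamma)$. A morphism of left modules $(V,W,\delta)\to(V',W',\delta')$ is a pair of $K$-linear maps $f_V:V\to V'$, $f_W:W\to W'$ with $f_W\delta=\delta'f_V$, $(f_V,f_W)\psi(a)=\psi'(a)(f_V,f_W)$ (componentwise composition) and $f_V\varphi(b)=\varphi'(b)f_W$ for all $a\in A$, $b\in B$. **Universal enveloping objects.** For a Leibniz algebra $\mathfrak p$ let $\mathfrak p^l,\mathfrak p^r$ be two copies of $\mathfrak p$, with $x_l,x_r$ the elements corresponding to $x\in\mathfrak p$. $\mathrm{UL}(\mathfrak p)$ is the associative and unital algebra obtained as the quotient of the (associative, unital) tensor algebra $T(\mathfrak p^l\oplus\mathfrak p^r)$ by the two-sided ideal corresponding to the relations, for $x,y\in\mathfrak p$, $$[x,y]_r=x_ry_r-y_rx_r,\qquad [x,y]_l=x_ly_r-y_rx_l,\qquad (y_r+y_l)x_l=0.$$ This is functorial in $\mathfrak p$. For a Leibniz crossed module $(\mathfrak q,\mathfrak p,\eta)$ let $s,t:\mathfrak q\rtimes\mathfrak p\to\mathfrak p$, $s(q,p)=p$, $t(q,p)=\eta(q)+p$. Put $\mathcal X=\operatorname{Ker}\mathrm{UL}(s)\operatorname{Ker}\mathrm{UL}(t)+\operatorname{Ker}\mathrm{UL}(t)\operatorname{Ker}\mathrm{UL}(s)$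 and $\overline{\mathrm{UL}}(\mathfrak q\rtimes\mathfrak p)=\mathrm{UL}(\mathfrak q\rtimes\mathfrak p)/\mathcal X$, with induced maps $\overline{\mathrm{UL}}(s),\overline{\mathrm{UL}}(t)$ to $\mathrm{UL}(\mathfrak p)$; $\mathrm{UL}(\mathfrak p)$ is regarded as a subalgebra of $\overline{\mathrm{UL}}(\mathfrak q\rtimes\mathfrak p)$ via $p\mapsto(0,p)$. Define $\mathrm{XUL}(\mathfrak q,\mathfrak p,\eta)=\big(\operatorname{Ker}\overline{\mathrm{UL}}(s),\ \mathrm{UL}(\mathfrak p),\ \overline{\mathrm{UL}}(t)|_{\operatorname{Ker}\overline{\mathrm{UL}}(s)}\big)$, with $\mathrm{UL}(\mathfrak p)$ acting on $\operatorname{Ker}\overline{\mathrm{UL}}(s)$ by multiplication in $\overline{\mathrm{UL}}(\mathfrak q\rtimes\mathfrak p)$.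
   Formalization: Left modules over XUL are required to be unital (1 in UL(p) acts as the identity on V and W); without this the claim fails, e.g. for q = p = 0 over a field, where left modules would be linear maps with an idempotent endomorphism. *)

theory Defs
  imports "HOL-Algebra.Module" "HOL-Algebra.QuotRing" "HOL-Algebra.Ideal_Product"
begin

section \<open>Categories and isomorphism of categories\<close>

text \<open>\<open>Comp C X Y Z g f\<close> is the composite of \<open>f : X \<rightarrow> Y\<close> followed by \<open>g : Y \<rightarrow> Z\<close>.\<close>

record ('o, 'a) category =
  Obj :: "'o set"
  Hom :: "'o \<Rightarrow> 'o \<Rightarrow> 'a set"
  Id :: "'o \<Rightarrow> 'a"
  Comp :: "'o \<Rightarrow> 'o \<Rightarrow> 'o \<Rightarrow> 'a \<Rightarrow> 'a \<Rightarrow> 'a"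

definition is_category :: "('o, 'a) category \<Rightarrow> bool" where
  "is_category C \<longleftrightarrow>
     (\<forall>X\<in>Obj C. Id C X \<in> Hom C X X) \<and>
     (\<forall>X\<in>Obj C. \<forall>Y\<in>Obj C. \<forall>Z\<in>Obj C. \<forall>f\<in>Hom C X Y. \<forall>g\<in>Hom C Y Z.
        Comp C X Y Z g f \<in> Hom C X Z) \<and>
     (\<forall>X\<in>Obj C. \<forall>Y\<in>Obj C. \<forall>f\<in>Hom C X Y.
        Comp C X X Y f (Id C X) = f \<and> Comp C X Y Y (Id C Y) f = f) \<and>
     (\<forall>W\<in>Obj C. \<forall>X\<in>Obj C. \<forall>Y\<in>Obj C. \<forall>Z\<in>Obj C.
        \<forall>f\<in>Hom C W X. \<forall>g\<in>Hom C X Y. \<forall>h\<in>Hom C Y Z.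
          Comp C W X Z (Comp C X Y Z h g) f = Comp C W Y Z h (Comp C W X Y g f))"

definition is_functor ::
  "('o, 'a) category \<Rightarrow> ('o2, 'a2) category \<Rightarrow> ('o \<Rightarrow> 'o2) \<Rightarrow> ('o \<Rightarrow> 'o \<Rightarrow> 'a \<Rightarrow> 'a2) \<Rightarrow> bool"
where
  "is_functor C D F FA \<longleftrightarrow>
     (\<forall>X\<in>Obj C. F X \<in> Obj D) \<and>
     (\<forall>X\<in>Obj C. \<forall>Y\<in>Obj C. \<forall>f\<in>Hom C X Y. FA X Y f \<in> Hom D (F X) (F Y)) \<and>
     (\<forall>X\<in>Obj C. FA X X (Id C X) = Id D (F X)) \<and>
     (\<forall>X\<in>Obj C. \<forall>Y\<in>Obj C. \<forall>Z\<in>Obj C. \<forall>f\<in>Hom C X Y. \<forall>g\<in>Hom C Y Z.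
        FA X Z (Comp C X Y Z g f) = Comp D (F X) (F Y) (F Z) (FA Y Z g) (FA X Y f))"

definition isomorphic_categories :: "('o, 'a) category \<Rightarrow> ('o2, 'a2) category \<Rightarrow> bool" where
  "isomorphic_categories C D \<longleftrightarrow>
     is_category C \<and> is_category D \<and>
     (\<exists>F FA G GA. is_functor C D F FA \<and> is_functor D C G GA \<and>
        (\<forall>X\<in>Obj C. G (F X) = X) \<and>
        (\<forall>X\<in>Obj D. F (G X) = X) \<and>
        (\<forall>X\<in>Obj C. \<forall>Y\<in>Obj C. \<forall>f\<in>Hom C X Y. GA (F X) (F Y) (FA X Y f) = f) \<and>
        (\<forall>X\<in>Obj D. \<forall>Y\<in>Obj D. \<forall>f\<in>Hom D X Y. FA (G X) (G Y) (GA X Y f) = f))"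

section \<open>Linear and bilinear maps, algebras\<close>

text \<open>
  A \<open>K\<close>-module with a (not necessarily unital) multiplication or bracket is a record of type
  \<^typ>\<open>('k, 'a) module\<close> whose field \<^const>\<open>mult\<close> is the multiplication or the bracket.  The
  field \<^const>\<open>one\<close> is meaningful for unital algebras only and is ignored otherwise.
\<close>

definition linear_map :: "'k ring \<Rightarrow> ('k, 'v) module \<Rightarrow> ('k, 'w) module \<Rightarrow> ('v \<Rightarrow> 'w) \<Rightarrow> bool"
where
  "linear_map K V W f \<longleftrightarrow>
     f \<in> carrier V \<rightarrow> carrier W \<and>
     (\<forall>x\<in>carrier V. \<forall>y\<in>carrier V. f (x \<oplus>\<^bsub>V\<^esub> y) = f x \<oplus>\<^bsub>W\<^esub> f y) \<and>
     (\<forall>k\<in>carrier K. \<forall>x\<in>carrier V. f (k \<odot>\<^bsub>V\<^esub> x) = k \<odot>\<^bsub>W\<^esub> f x)"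

text \<open>
  Linear maps as elements of a set are made extensional, so that equality in HOL is equality of
  maps on the carrier.
\<close>

definition lin :: "'k ring \<Rightarrow> ('k, 'v) module \<Rightarrow> ('k, 'w) module \<Rightarrow> ('v \<Rightarrow> 'w) set" where
  "lin K V W = {f \<in> extensional (carrier V). linear_map K V W f}"

definition bilinear_map ::
  "'k ring \<Rightarrow> ('k, 'u) module \<Rightarrow> ('k, 'v) module \<Rightarrow> ('k, 'w) module \<Rightarrow> ('u \<Rightarrow> 'v \<Rightarrow> 'w) \<Rightarrow> bool"
where
  "bilinear_map K U V W f \<longleftrightarrow>
     (\<forall>u\<in>carrier U. linear_map K V W (\<lambda>v. f u v)) \<and>
     (\<forall>v\<in>carrier V. linear_map K U W (\<lambda>u. f u v))"

definition ext2 :: "('k, 'u) module \<Rightarrow> ('k, 'v) module \<Rightarrow> ('u \<Rightarrow> 'v \<Rightarrow> 'w) \<Rightarrow> bool" where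
  "ext2 U V f \<longleftrightarrow> (\<lambda>(u, v). f u v) \<in> extensional (carrier U \<times> carrier V)"

definition assoc_algebra :: "'k ring \<Rightarrow> ('k, 'a) module \<Rightarrow> bool" where
  "assoc_algebra K A \<longleftrightarrow>
     module K A \<and> bilinear_map K A A A (mult A) \<and>
     (\<forall>x\<in>carrier A. \<forall>y\<in>carrier A. \<forall>z\<in>carrier A.
        (x \<otimes>\<^bsub>A\<^esub> y) \<otimes>\<^bsub>A\<^esub> z = x \<otimes>\<^bsub>A\<^esub> (y \<otimes>\<^bsub>A\<^esub> z))"

text \<open>Homomorphisms for the multiplication or bracket; units need not be preserved.\<close>

definition alg_hom :: "'k ring \<Rightarrow> ('k, 'a) module \<Rightarrow> ('k, 'b) module \<Rightarrow> ('a \<Rightarrow> 'b) \<Rightarrow> bool" where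
  "alg_hom K A B f \<longleftrightarrow>
     linear_map K A B f \<and>
     (\<forall>x\<in>carrier A. \<forall>y\<in>carrier A. f (x \<otimes>\<^bsub>A\<^esub> y) = f x \<otimes>\<^bsub>B\<^esub> f y)"

text \<open>
  A \<open>K\<close>-module without further structure, in normal form: the operations of the record carry no
  information outside the carrier, and the multiplication is zero.  This makes equality of
  records coincide with equality of \<open>K\<close>-modules, as is needed for an isomorphism (rather than an
  equivalence) of categories, and the module is an abelian Leibniz algebra and an abelian
  associative algebra.
\<close>

definition abelian_module :: "'k ring \<Rightarrow> ('k, 'v) module \<Rightarrow> bool" where
  "abelian_module K M \<longleftrightarrow>
     module K M \<and>
     (\<lambda>(x, y). x \<oplus>\<^bsub>M\<^esub> y) \<in> extensional (carrier M \<times> carrier M) \<and>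
     (\<lambda>(k, x). k \<odot>\<^bsub>M\<^esub> x) \<in> extensional (carrier K \<times> carrier M) \<and>
     mult M = (\<lambda>x y. \<zero>\<^bsub>M\<^esub>) \<and> one M = undefined"

section \<open>Leibniz algebras and their crossed modules\<close>

definition leibniz_algebra :: "'k ring \<Rightarrow> ('k, 'p) module \<Rightarrow> bool" where
  "leibniz_algebra K P \<longleftrightarrow>
     module K P \<and> bilinear_map K P P P (mult P) \<and>
     (\<forall>x\<in>carrier P. \<forall>y\<in>carrier P. \<forall>z\<in>carrier P.
        (x \<otimes>\<^bsub>P\<^esub> y) \<otimes>\<^bsub>P\<^esub> z = x \<otimes>\<^bsub>P\<^esub> (y \<otimes>\<^bsub>P\<^esub> z) \<oplus>\<^bsub>P\<^esub> (x \<otimes>\<^bsub>P\<^esub> z) \<otimes>\<^bsub>P\<^esub> y)"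

text \<open>An action of \<open>P\<close> on \<open>Q\<close>, with \<open>l p q = [p, q]\<close> and \<open>r q p = [q, p]\<close>.\<close>

definition leibniz_action ::
  "'k ring \<Rightarrow> ('k, 'p) module \<Rightarrow> ('k, 'q) module \<Rightarrow> ('p \<Rightarrow> 'q \<Rightarrow> 'q) \<Rightarrow> ('q \<Rightarrow> 'p \<Rightarrow> 'q) \<Rightarrow> bool"
where
  "leibniz_action K P Q l r \<longleftrightarrow>
     bilinear_map K P Q Q l \<and> bilinear_map K Q P Q r \<and>
     (\<forall>x\<in>carrier P. \<forall>y\<in>carrier P. \<forall>q\<in>carrier Q.
        l (x \<otimes>\<^bsub>P\<^esub> y) q = l x (l y q) \<oplus>\<^bsub>Q\<^esub> r (l x q) y \<and>
        r (l x q) y = l x (r q y) \<oplus>\<^bsub>Q\<^esub> l (x \<otimes>\<^bsub>P\<^esub> y) q \<and>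
        r (r q x) y = r q (x \<otimes>\<^bsub>P\<^esub> y) \<oplus>\<^bsub>Q\<^esub> r (r q y) x) \<and>
     (\<forall>x\<in>carrier P. \<forall>q\<in>carrier Q. \<forall>q'\<in>carrier Q.
        l x q \<otimes>\<^bsub>Q\<^esub> q' = l x (q \<otimes>\<^bsub>Q\<^esub> q') \<oplus>\<^bsub>Q\<^esub> l x q' \<otimes>\<^bsub>Q\<^esub> q \<and>
        r q x \<otimes>\<^bsub>Q\<^esub> q' = q \<otimes>\<^bsub>Q\<^esub> l x q' \<oplus>\<^bsub>Q\<^esub> r (q \<otimes>\<^bsub>Q\<^esub> q') x \<and>
        r (q \<otimes>\<^bsub>Q\<^esub> q') x = q \<otimes>\<^bsub>Q\<^esub> r q' x \<oplus>\<^bsub>Q\<^esub> r q x \<otimes>\<^bsub>Q\<^esub> q')"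

text \<open>The data of a crossed module \<open>bdry : Top \<rightarrow> Base\<close>, of Leibniz or of associative algebras.\<close>

record ('k, 'b, 'a) xmod =
  Top :: "('k, 'b) module"
  Base :: "('k, 'a) module"
  bdry :: "'b \<Rightarrow> 'a"
  lact :: "'a \<Rightarrow> 'b \<Rightarrow> 'b"
  ract :: "'b \<Rightarrow> 'a \<Rightarrow> 'b"

definition leibniz_crossed_module :: "'k ring \<Rightarrow> ('k, 'q, 'p) xmod \<Rightarrow> bool" where
  "leibniz_crossed_module K X \<longleftrightarrow>
     leibniz_algebra K (Top X) \<and> leibniz_algebra K (Base X) \<and>
     alg_hom K (Top X) (Base X) (bdry X) \<and>
     leibniz_action K (Base X) (Top X) (lact X) (ract X) \<and>
     (\<forall>p\<in>carrier (Base X). \<forall>q\<in>carrier (Top X).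
        bdry X (lact X p q) = p \<otimes>\<^bsub>Base X\<^esub> bdry X q \<and>
        bdry X (ract X q p) = bdry X q \<otimes>\<^bsub>Base X\<^esub> p) \<and>
     (\<forall>q\<in>carrier (Top X). \<forall>q'\<in>carrier (Top X).
        lact X (bdry X q) q' = q \<otimes>\<^bsub>Top X\<^esub> q' \<and>
        q \<otimes>\<^bsub>Top X\<^esub> q' = ract X q (bdry X q'))"

definition semidirect :: "('k, 'q, 'p) xmod \<Rightarrow> ('k, 'q \<times> 'p) module" where
  "semidirect X = (let Q = Top X; P = Base X in
     \<lparr>carrier = carrier Q \<times> carrier P,
      mult = (\<lambda>(q1, p1) (q2, p2).
        (q1 \<otimes>\<^bsub>Q\<^esub> q2 \<oplus>\<^bsub>Q\<^esub> lact X p1 q2 \<oplus>\<^bsub>Q\<^esub> ract X q1 p2, p1 \<otimes>\<^bsub>P\<^esub> p2)),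
      one = undefined,
      zero = (\<zero>\<^bsub>Q\<^esub>, \<zero>\<^bsub>P\<^esub>),
      add = (\<lambda>(q1, p1) (q2, p2). (q1 \<oplus>\<^bsub>Q\<^esub> q2, p1 \<oplus>\<^bsub>P\<^esub> p2)),
      smult = (\<lambda>k (q, p). (k \<odot>\<^bsub>Q\<^esub> q, k \<odot>\<^bsub>P\<^esub> p))\<rparr>)"

section \<open>Representations of a Leibniz crossed module\<close>

text \<open>
  \<open>rep_lN p n = [p, n]\<close>, \<open>rep_rN n p = [n, p]\<close> and likewise on \<open>M\<close>; \<open>rep_xi1 q m = \<xi>\<^sub>1(q, m)\<close> and
  \<open>rep_xi2 m q = \<xi>\<^sub>2(m, q)\<close>.
\<close>

record ('k, 'q, 'p, 'n, 'm) rep =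
  rep_N :: "('k, 'n) module"
  rep_M :: "('k, 'm) module"
  rep_mu :: "'n \<Rightarrow> 'm"
  rep_lN :: "'p \<Rightarrow> 'n \<Rightarrow> 'n"
  rep_rN :: "'n \<Rightarrow> 'p \<Rightarrow> 'n"
  rep_lM :: "'p \<Rightarrow> 'm \<Rightarrow> 'm"
  rep_rM :: "'m \<Rightarrow> 'p \<Rightarrow> 'm"
  rep_xi1 :: "'q \<Rightarrow> 'm \<Rightarrow> 'n"
  rep_xi2 :: "'m \<Rightarrow> 'q \<Rightarrow> 'n"

definition is_rep :: "'k ring \<Rightarrow> ('k, 'q, 'p) xmod \<Rightarrow> ('k, 'q, 'p, 'n, 'm) rep \<Rightarrow> bool" where
  "is_rep K X R \<longleftrightarrow>
    (let Q = Top X; P = Base X; \<eta> = bdry X; N = rep_N R; M = rep_M R; \<mu> = rep_mu R;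
         lN = rep_lN R; rN = rep_rN R; lM = rep_lM R; rM = rep_rM R;
         \<xi>1 = rep_xi1 R; \<xi>2 = rep_xi2 R
     in
       abelian_module K N \<and> abelian_module K M \<and> \<mu> \<in> lin K N M \<and>
       ext2 P N lN \<and> ext2 N P rN \<and> ext2 P M lM \<and> ext2 M P rM \<and> ext2 Q M \<xi>1 \<and> ext2 M Q \<xi>2 \<and>
       leibniz_action K P N lN rN \<and> leibniz_action K P M lM rM \<and>
       (\<forall>p\<in>carrier P. \<forall>n\<in>carrier N. \<mu> (lN p n) = lM p (\<mu> n) \<and> \<mu> (rN n p) = rM (\<mu> n) p) \<and>
       bilinear_map K Q M N \<xi>1 \<and> bilinear_map K M Q N \<xi>2 \<and>
       (\<forall>q\<in>carrier Q. \<forall>m\<in>carrier M.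
          \<mu> (\<xi>2 m q) = rM m (\<eta> q) \<and> \<mu> (\<xi>1 q m) = lM (\<eta> q) m) \<and>
       (\<forall>q\<in>carrier Q. \<forall>n\<in>carrier N.
          \<xi>2 (\<mu> n) q = rN n (\<eta> q) \<and> \<xi>1 q (\<mu> n) = lN (\<eta> q) n) \<and>
       (\<forall>p\<in>carrier P. \<forall>q\<in>carrier Q. \<forall>m\<in>carrier M.
          \<xi>2 m (lact X p q) = \<xi>2 (rM m p) q \<ominus>\<^bsub>N\<^esub> rN (\<xi>2 m q) p \<and>
          \<xi>1 (lact X p q) m = \<xi>2 (lM p m) q \<ominus>\<^bsub>N\<^esub> lN p (\<xi>2 m q) \<and>
          \<xi>2 m (ract X q p) = rN (\<xi>2 m q) p \<ominus>\<^bsub>N\<^esub> \<xi>2 (rM m p) q \<and>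
          \<xi>1 (ract X q p) m = rN (\<xi>1 q m) p \<ominus>\<^bsub>N\<^esub> \<xi>1 q (rM m p) \<and>
          \<xi>1 q (lM p m) = \<ominus>\<^bsub>N\<^esub> \<xi>1 q (rM m p) \<and>
          lN p (\<xi>1 q m) = \<ominus>\<^bsub>N\<^esub> lN p (\<xi>2 m q)) \<and>
       (\<forall>q\<in>carrier Q. \<forall>q'\<in>carrier Q. \<forall>m\<in>carrier M.
          \<xi>2 m (q \<otimes>\<^bsub>Q\<^esub> q') = rN (\<xi>2 m q) (\<eta> q') \<ominus>\<^bsub>N\<^esub> rN (\<xi>2 m q') (\<eta> q) \<and>
          \<xi>1 (q \<otimes>\<^bsub>Q\<^esub> q') m = rN (\<xi>1 q m) (\<eta> q') \<ominus>\<^bsub>N\<^esub> lN (\<eta> q) (\<xi>2 m q')))"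

definition rep_hom ::
  "'k ring \<Rightarrow> ('k, 'q, 'p) xmod \<Rightarrow> ('k, 'q, 'p, 'n, 'm) rep \<Rightarrow> ('k, 'q, 'p, 'n, 'm) rep
    \<Rightarrow> (('n \<Rightarrow> 'n) \<times> ('m \<Rightarrow> 'm)) set"
where
  "rep_hom K X R R' =
    {(f, g). f \<in> lin K (rep_N R) (rep_N R') \<and> g \<in> lin K (rep_M R) (rep_M R') \<and>
      (\<forall>n\<in>carrier (rep_N R). g (rep_mu R n) = rep_mu R' (f n)) \<and>
      (\<forall>p\<in>carrier (Base X). \<forall>n\<in>carrier (rep_N R).
         f (rep_lN R p n) = rep_lN R' p (f n) \<and> f (rep_rN R n p) = rep_rN R' (f n) p) \<and>
      (\<forall>p\<in>carrier (Base X). \<forall>m\<in>carrier (rep_M R).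
         g (rep_lM R p m) = rep_lM R' p (g m) \<and> g (rep_rM R m p) = rep_rM R' (g m) p) \<and>
      (\<forall>q\<in>carrier (Top X). \<forall>m\<in>carrier (rep_M R).
         f (rep_xi1 R q m) = rep_xi1 R' q (g m) \<and> f (rep_xi2 R m q) = rep_xi2 R' (g m) q)}"

definition rep_category ::
  "'k ring \<Rightarrow> ('k, 'q, 'p) xmod
    \<Rightarrow> (('k, 'q, 'p, 'n, 'm) rep, ('n \<Rightarrow> 'n) \<times> ('m \<Rightarrow> 'm)) category"
where
  "rep_category K X =
     \<lparr>Obj = {R. is_rep K X R},
      Hom = rep_hom K X,
      Id = (\<lambda>R. (\<lambda>n\<in>carrier (rep_N R). n, \<lambda>m\<in>carrier (rep_M R). m)),
      Comp = (\<lambda>R _ _ (f', g') (f, g).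
        (compose (carrier (rep_N R)) f' f, compose (carrier (rep_M R)) g' g))\<rparr>"

section \<open>Crossed modules of associative algebras and their left modules\<close>

definition alg_action ::
  "'k ring \<Rightarrow> ('k, 'a) module \<Rightarrow> ('k, 'b) module \<Rightarrow> ('a \<Rightarrow> 'b \<Rightarrow> 'b) \<Rightarrow> ('b \<Rightarrow> 'a \<Rightarrow> 'b) \<Rightarrow> bool"
where
  "alg_action K A B l r \<longleftrightarrow>
     bilinear_map K A B B l \<and> bilinear_map K B A B r \<and>
     (\<forall>a\<in>carrier A. \<forall>a'\<in>carrier A. \<forall>b\<in>carrier B.
        l (a \<otimes>\<^bsub>A\<^esub> a') b = l a (l a' b) \<and>
        r (r b a) a' = r b (a \<otimes>\<^bsub>A\<^esub> a') \<and>
        r (l a b) a' = l a (r b a')) \<and>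
     (\<forall>a\<in>carrier A. \<forall>b\<in>carrier B. \<forall>b'\<in>carrier B.
        l a (b \<otimes>\<^bsub>B\<^esub> b') = l a b \<otimes>\<^bsub>B\<^esub> b' \<and>
        r b a \<otimes>\<^bsub>B\<^esub> b' = b \<otimes>\<^bsub>B\<^esub> l a b' \<and>
        r (b \<otimes>\<^bsub>B\<^esub> b') a = b \<otimes>\<^bsub>B\<^esub> r b' a)"

definition alg_crossed_module :: "'k ring \<Rightarrow> ('k, 'b, 'a) xmod \<Rightarrow> bool" where
  "alg_crossed_module K X \<longleftrightarrow>
     assoc_algebra K (Top X) \<and> assoc_algebra K (Base X) \<and>
     alg_hom K (Top X) (Base X) (bdry X) \<and>
     alg_action K (Base X) (Top X) (lact X) (ract X) \<and>
     (\<forall>a\<in>carrier (Base X). \<forall>b\<in>carrier (Top X).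
        bdry X (lact X a b) = a \<otimes>\<^bsub>Base X\<^esub> bdry X b \<and>
        bdry X (ract X b a) = bdry X b \<otimes>\<^bsub>Base X\<^esub> a) \<and>
     (\<forall>b\<in>carrier (Top X). \<forall>b'\<in>carrier (Top X).
        lact X (bdry X b) b' = b \<otimes>\<^bsub>Top X\<^esub> b' \<and>
        b \<otimes>\<^bsub>Top X\<^esub> b' = ract X b (bdry X b'))"

definition alg_xmod_hom ::
  "'k ring \<Rightarrow> ('k, 'b, 'a) xmod \<Rightarrow> ('k, 'd, 'c) xmod \<Rightarrow> ('b \<Rightarrow> 'd) \<Rightarrow> ('a \<Rightarrow> 'c) \<Rightarrow> bool"
where
  "alg_xmod_hom K X Y \<phi> \<psi> \<longleftrightarrow>
     alg_crossed_module K X \<and> alg_crossed_module K Y \<and>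
     alg_hom K (Top X) (Top Y) \<phi> \<and> alg_hom K (Base X) (Base Y) \<psi> \<and>
     (\<forall>b\<in>carrier (Top X). \<psi> (bdry X b) = bdry Y (\<phi> b)) \<and>
     (\<forall>a\<in>carrier (Base X). \<forall>b\<in>carrier (Top X).
        \<phi> (ract X b a) = ract Y (\<phi> b) (\<psi> a) \<and> \<phi> (lact X a b) = lact Y (\<psi> a) (\<phi> b))"

definition Hom_alg ::
  "'k ring \<Rightarrow> ('k, 'v) module \<Rightarrow> ('k, 'w) module \<Rightarrow> ('v \<Rightarrow> 'w) \<Rightarrow> ('k, 'w \<Rightarrow> 'v) module"
where
  "Hom_alg K V W \<delta> =
     \<lparr>carrier = lin K W V,
      mult = (\<lambda>d d'. \<lambda>w\<in>carrier W. d (\<delta> (d' w))),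
      one = undefined,
      zero = (\<lambda>w\<in>carrier W. \<zero>\<^bsub>V\<^esub>),
      add = (\<lambda>d d'. \<lambda>w\<in>carrier W. d w \<oplus>\<^bsub>V\<^esub> d' w),
      smult = (\<lambda>k d. \<lambda>w\<in>carrier W. k \<odot>\<^bsub>V\<^esub> d w)\<rparr>"

definition End_alg ::
  "'k ring \<Rightarrow> ('k, 'v) module \<Rightarrow> ('k, 'w) module \<Rightarrow> ('v \<Rightarrow> 'w)
    \<Rightarrow> ('k, ('v \<Rightarrow> 'v) \<times> ('w \<Rightarrow> 'w)) module"
where
  "End_alg K V W \<delta> =
     \<lparr>carrier = {(\<alpha>, \<beta>). \<alpha> \<in> lin K V V \<and> \<beta> \<in> lin K W W \<and> (\<forall>v\<in>carrier V. \<beta> (\<delta> v) = \<delta> (\<alpha> v))},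
      mult = (\<lambda>(\<alpha>, \<beta>) (\<alpha>', \<beta>'). (compose (carrier V) \<alpha> \<alpha>', compose (carrier W) \<beta> \<beta>')),
      one = (\<lambda>v\<in>carrier V. v, \<lambda>w\<in>carrier W. w),
      zero = (\<lambda>v\<in>carrier V. \<zero>\<^bsub>V\<^esub>, \<lambda>w\<in>carrier W. \<zero>\<^bsub>W\<^esub>),
      add = (\<lambda>(\<alpha>, \<beta>) (\<alpha>', \<beta>').
        (\<lambda>v\<in>carrier V. \<alpha> v \<oplus>\<^bsub>V\<^esub> \<alpha>' v, \<lambda>w\<in>carrier W. \<beta> w \<oplus>\<^bsub>W\<^esub> \<beta>' w)),
      smult = (\<lambda>k (\<alpha>, \<beta>). (\<lambda>v\<in>carrier V. k \<odot>\<^bsub>V\<^esub> \<alpha> v, \<lambda>w\<in>carrier W. k \<odot>\<^bsub>W\<^esub> \<beta> w))\<rparr>"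

definition End_xmod ::
  "'k ring \<Rightarrow> ('k, 'v) module \<Rightarrow> ('k, 'w) module \<Rightarrow> ('v \<Rightarrow> 'w)
    \<Rightarrow> ('k, 'w \<Rightarrow> 'v, ('v \<Rightarrow> 'v) \<times> ('w \<Rightarrow> 'w)) xmod"
where
  "End_xmod K V W \<delta> =
     \<lparr>Top = Hom_alg K V W \<delta>,
      Base = End_alg K V W \<delta>,
      bdry = (\<lambda>d. (compose (carrier V) d \<delta>, compose (carrier W) \<delta> d)),
      lact = (\<lambda>(\<alpha>, \<beta>) d. compose (carrier W) \<alpha> d),
      ract = (\<lambda>d (\<alpha>, \<beta>). compose (carrier W) d \<beta>)\<rparr>"

record ('k, 'b, 'a, 'v, 'w) left_module =
  lm_V :: "('k, 'v) module"
  lm_W :: "('k, 'w) module"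
  lm_delta :: "'v \<Rightarrow> 'w"
  lm_phi :: "'b \<Rightarrow> ('w \<Rightarrow> 'v)"
  lm_psi :: "'a \<Rightarrow> ('v \<Rightarrow> 'v) \<times> ('w \<Rightarrow> 'w)"

text \<open>
  This notion is used for crossed modules whose base algebra is unital.  As usual for modules
  over a unital algebra, \<open>1\<close> is required to act as the identity.  Without this requirement, the left
  modules over \<open>(0, K, 0)\<close>, the enveloping crossed module of the zero Leibniz crossed module,
  would be the linear maps with an idempotent endomorphism, whereas the representations of the
  zero Leibniz crossed module are the bare linear maps.
\<close>

definition is_left_module ::
  "'k ring \<Rightarrow> ('k, 'b, 'a) xmod \<Rightarrow> ('k, 'b, 'a, 'v, 'w) left_module \<Rightarrow> bool"
where
  "is_left_module K X L \<longleftrightarrow>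
    (let V = lm_V L; W = lm_W L; \<delta> = lm_delta L; \<phi> = lm_phi L; \<psi> = lm_psi L in
       abelian_module K V \<and> abelian_module K W \<and> \<delta> \<in> lin K V W \<and>
       \<phi> \<in> extensional (carrier (Top X)) \<and> \<psi> \<in> extensional (carrier (Base X)) \<and>
       alg_xmod_hom K X (End_xmod K V W \<delta>) \<phi> \<psi> \<and>
       \<psi> \<one>\<^bsub>Base X\<^esub> = \<one>\<^bsub>End_alg K V W \<delta>\<^esub>)"

definition left_module_hom ::
  "'k ring \<Rightarrow> ('k, 'b, 'a) xmod \<Rightarrow> ('k, 'b, 'a, 'v, 'w) left_module
    \<Rightarrow> ('k, 'b, 'a, 'v, 'w) left_module \<Rightarrow> (('v \<Rightarrow> 'v) \<times> ('w \<Rightarrow> 'w)) set"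
where
  "left_module_hom K X L L' =
    {(f, g). f \<in> lin K (lm_V L) (lm_V L') \<and> g \<in> lin K (lm_W L) (lm_W L') \<and>
      (\<forall>v\<in>carrier (lm_V L). g (lm_delta L v) = lm_delta L' (f v)) \<and>
      (\<forall>a\<in>carrier (Base X).
         (\<forall>v\<in>carrier (lm_V L). f (fst (lm_psi L a) v) = fst (lm_psi L' a) (f v)) \<and>
         (\<forall>w\<in>carrier (lm_W L). g (snd (lm_psi L a) w) = snd (lm_psi L' a) (g w))) \<and>
      (\<forall>b\<in>carrier (Top X). \<forall>w\<in>carrier (lm_W L). f (lm_phi L b w) = lm_phi L' b (g w))}"

definition left_module_category ::
  "'k ring \<Rightarrow> ('k, 'b, 'a) xmod
    \<Rightarrow> (('k, 'b, 'a, 'v, 'w) left_module, ('v \<Rightarrow> 'v) \<times> ('w \<Rightarrow> 'w)) category"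
where
  "left_module_category K X =
     \<lparr>Obj = {L. is_left_module K X L},
      Hom = left_module_hom K X,
      Id = (\<lambda>L. (\<lambda>v\<in>carrier (lm_V L). v, \<lambda>w\<in>carrier (lm_W L). w)),
      Comp = (\<lambda>L _ _ (f', g') (f, g).
        (compose (carrier (lm_V L)) f' f, compose (carrier (lm_W L)) g' g))\<rparr>"

section \<open>Tensor algebras\<close>

definition quot_alg :: "('k, 'a) module \<Rightarrow> 'a set \<Rightarrow> ('k, 'a set) module" where
  "quot_alg A I =
     \<lparr>carrier = carrier (A Quot I), mult = mult (A Quot I), one = one (A Quot I),
      zero = zero (A Quot I), add = add (A Quot I),
      smult = (\<lambda>k X. \<Union>x\<in>X. I +>\<^bsub>A\<^esub> (k \<odot>\<^bsub>A\<^esub> x))\<rparr>"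

text \<open>
  The map induced on a quotient by a map \<open>h\<close> that is constant on cosets.
\<close>

definition induced :: "('a \<Rightarrow> 'b) \<Rightarrow> 'a set \<Rightarrow> 'b" where
  "induced h X = the_elem (h ` X)"

text \<open>
  The free unital associative \<open>K\<close>-algebra on a set \<open>S\<close>: finitely supported functions on the words
  over \<open>S\<close>, with the convolution product.
\<close>

definition free_algebra :: "'k ring \<Rightarrow> 'v set \<Rightarrow> ('k, 'v list \<Rightarrow> 'k) module" where
  "free_algebra K S =
     \<lparr>carrier = {f. (\<forall>u. f u \<in> carrier K) \<and> finite {u. f u \<noteq> \<zero>\<^bsub>K\<^esub>} \<and>
                    (\<forall>u. u \<notin> lists S \<longrightarrow> f u = \<zero>\<^bsub>K\<^esub>)},
      mult = (\<lambda>f g u. \<Oplus>\<^bsub>K\<^esub>i\<in>{..length u}. f (take i u) \<otimes>\<^bsub>K\<^esub> g (drop i u)),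
      one = (\<lambda>u. if u = [] then \<one>\<^bsub>K\<^esub> else \<zero>\<^bsub>K\<^esub>),
      zero = (\<lambda>u. \<zero>\<^bsub>K\<^esub>),
      add = (\<lambda>f g u. f u \<oplus>\<^bsub>K\<^esub> g u),
      smult = (\<lambda>k f u. k \<otimes>\<^bsub>K\<^esub> f u)\<rparr>"

definition letter :: "'k ring \<Rightarrow> 'v \<Rightarrow> 'v list \<Rightarrow> 'k" where
  "letter K v = (\<lambda>u. if u = [v] then \<one>\<^bsub>K\<^esub> else \<zero>\<^bsub>K\<^esub>)"

text \<open>
  The ideal generated by the linearity relations on letters is homogeneous; its part of
  degree \<open>n\<close> is spanned by the multilinearity relations on words of length \<open>n\<close>, so that the
  quotient is the direct sum of the tensor powers of \<open>V\<close>.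
\<close>

definition tensor_ideal :: "'k ring \<Rightarrow> ('k, 'v) module \<Rightarrow> ('v list \<Rightarrow> 'k) set" where
  "tensor_ideal K V = (let F = free_algebra K (carrier V) in
     Idl\<^bsub>F\<^esub>
       ({letter K (v \<oplus>\<^bsub>V\<^esub> w) \<ominus>\<^bsub>F\<^esub> (letter K v \<oplus>\<^bsub>F\<^esub> letter K w) | v w.
           v \<in> carrier V \<and> w \<in> carrier V} \<union>
        {letter K (k \<odot>\<^bsub>V\<^esub> v) \<ominus>\<^bsub>F\<^esub> k \<odot>\<^bsub>F\<^esub> letter K v | k v.
           k \<in> carrier K \<and> v \<in> carrier V}))"

definition tensor_algebra :: "'k ring \<Rightarrow> ('k, 'v) module \<Rightarrow> ('k, ('v list \<Rightarrow> 'k) set) module" where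
  "tensor_algebra K V = quot_alg (free_algebra K (carrier V)) (tensor_ideal K V)"

definition tensor_incl :: "'k ring \<Rightarrow> ('k, 'v) module \<Rightarrow> 'v \<Rightarrow> ('v list \<Rightarrow> 'k) set" where
  "tensor_incl K V v = tensor_ideal K V +>\<^bsub>free_algebra K (carrier V)\<^esub> letter K v"

definition free_map :: "'k ring \<Rightarrow> ('v \<Rightarrow> 'w) \<Rightarrow> ('v list \<Rightarrow> 'k) \<Rightarrow> ('w list \<Rightarrow> 'k)" where
  "free_map K g f = (\<lambda>u'. \<Oplus>\<^bsub>K\<^esub>u\<in>{u. f u \<noteq> \<zero>\<^bsub>K\<^esub> \<and> map g u = u'}. f u)"

text \<open>The algebra homomorphism \<open>T(V) \<rightarrow> T(W)\<close> given by a linear map \<open>g : V \<rightarrow> W\<close>.\<close>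

definition tensor_map ::
  "'k ring \<Rightarrow> ('k, 'w) module \<Rightarrow> ('v \<Rightarrow> 'w) \<Rightarrow> ('v list \<Rightarrow> 'k) set \<Rightarrow> ('w list \<Rightarrow> 'k) set"
where
  "tensor_map K W g =
     induced (\<lambda>f. tensor_ideal K W +>\<^bsub>free_algebra K (carrier W)\<^esub> free_map K g f)"

section \<open>The universal enveloping algebra of a Leibniz algebra\<close>

text \<open>
  The direct sum of two copies of \<open>P\<close>, the first being the left and the second the right one.
\<close>

definition double :: "('k, 'p) module \<Rightarrow> ('k, 'p \<times> 'p) module" where
  "double P =
     \<lparr>carrier = carrier P \<times> carrier P, mult = undefined, one = undefined,
      zero = (\<zero>\<^bsub>P\<^esub>, \<zero>\<^bsub>P\<^esub>),
      add = (\<lambda>(x, y) (x', y'). (x \<oplus>\<^bsub>P\<^esub> x', y \<oplus>\<^bsub>P\<^esub> y')),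
      smult = (\<lambda>k (x, y). (k \<odot>\<^bsub>P\<^esub> x, k \<odot>\<^bsub>P\<^esub> y))\<rparr>"

definition left_gen :: "'k ring \<Rightarrow> ('k, 'p) module \<Rightarrow> 'p \<Rightarrow> (('p \<times> 'p) list \<Rightarrow> 'k) set" where
  "left_gen K P x = tensor_incl K (double P) (x, \<zero>\<^bsub>P\<^esub>)"

definition right_gen :: "'k ring \<Rightarrow> ('k, 'p) module \<Rightarrow> 'p \<Rightarrow> (('p \<times> 'p) list \<Rightarrow> 'k) set" where
  "right_gen K P x = tensor_incl K (double P) (\<zero>\<^bsub>P\<^esub>, x)"

definition UL_ideal :: "'k ring \<Rightarrow> ('k, 'p) module \<Rightarrow> (('p \<times> 'p) list \<Rightarrow> 'k) set set" where
  "UL_ideal K P = (let T = tensor_algebra K (double P); l = left_gen K P; r = right_gen K P in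
     Idl\<^bsub>T\<^esub>
       ({r (x \<otimes>\<^bsub>P\<^esub> y) \<ominus>\<^bsub>T\<^esub> (r x \<otimes>\<^bsub>T\<^esub> r y \<ominus>\<^bsub>T\<^esub> r y \<otimes>\<^bsub>T\<^esub> r x) | x y.
           x \<in> carrier P \<and> y \<in> carrier P} \<union>
        {l (x \<otimes>\<^bsub>P\<^esub> y) \<ominus>\<^bsub>T\<^esub> (l x \<otimes>\<^bsub>T\<^esub> r y \<ominus>\<^bsub>T\<^esub> r y \<otimes>\<^bsub>T\<^esub> l x) | x y.
           x \<in> carrier P \<and> y \<in> carrier P} \<union>
        {(r y \<oplus>\<^bsub>T\<^esub> l y) \<otimes>\<^bsub>T\<^esub> l x | x y. x \<in> carrier P \<and> y \<in> carrier P}))"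

definition UL :: "'k ring \<Rightarrow> ('k, 'p) module \<Rightarrow> ('k, (('p \<times> 'p) list \<Rightarrow> 'k) set set) module" where
  "UL K P = quot_alg (tensor_algebra K (double P)) (UL_ideal K P)"

text \<open>\<open>UL(f) : UL(P) \<rightarrow> UL(P')\<close> for a homomorphism \<open>f : P \<rightarrow> P'\<close> of Leibniz algebras.\<close>

definition UL_map ::
  "'k ring \<Rightarrow> ('k, 'p2) module \<Rightarrow> ('p \<Rightarrow> 'p2) \<Rightarrow> (('p \<times> 'p) list \<Rightarrow> 'k) set set
    \<Rightarrow> (('p2 \<times> 'p2) list \<Rightarrow> 'k) set set"
where
  "UL_map K P' f =
     induced (\<lambda>z. UL_ideal K P' +>\<^bsub>tensor_algebra K (double P')\<^esub>
                    tensor_map K (double P') (map_prod f f) z)"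

section \<open>The universal enveloping crossed module\<close>

definition src :: "('k, 'q, 'p) xmod \<Rightarrow> 'q \<times> 'p \<Rightarrow> 'p" where
  "src X = (\<lambda>(q, p). p)"

definition tgt :: "('k, 'q, 'p) xmod \<Rightarrow> 'q \<times> 'p \<Rightarrow> 'p" where
  "tgt X = (\<lambda>(q, p). bdry X q \<oplus>\<^bsub>Base X\<^esub> p)"

type_synonym ('k, 'p) ul = "(('p \<times> 'p) list \<Rightarrow> 'k) set set"

definition UL_kernel ::
  "'k ring \<Rightarrow> ('k, 'q, 'p) xmod \<Rightarrow> ('q \<times> 'p \<Rightarrow> 'p) \<Rightarrow> ('k, 'q \<times> 'p) ul set"
where
  "UL_kernel K X f =
     a_kernel (UL K (semidirect X)) (UL K (Base X)) (UL_map K (Base X) f)"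

definition XUL_ideal :: "'k ring \<Rightarrow> ('k, 'q, 'p) xmod \<Rightarrow> ('k, 'q \<times> 'p) ul set" where
  "XUL_ideal K X = (let U = UL K (semidirect X);
       Ks = UL_kernel K X (src X); Kt = UL_kernel K X (tgt X) in
     ideal_prod U Ks Kt <+>\<^bsub>U\<^esub> ideal_prod U Kt Ks)"

definition UL_bar :: "'k ring \<Rightarrow> ('k, 'q, 'p) xmod \<Rightarrow> ('k, ('k, 'q \<times> 'p) ul set) module" where
  "UL_bar K X = quot_alg (UL K (semidirect X)) (XUL_ideal K X)"

definition UL_bar_map ::
  "'k ring \<Rightarrow> ('k, 'q, 'p) xmod \<Rightarrow> ('q \<times> 'p \<Rightarrow> 'p) \<Rightarrow> ('k, 'q \<times> 'p) ul set \<Rightarrow> ('k, 'p) ul"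
where
  "UL_bar_map K X f = induced (UL_map K (Base X) f)"

definition UL_bar_incl ::
  "'k ring \<Rightarrow> ('k, 'q, 'p) xmod \<Rightarrow> ('k, 'p) ul \<Rightarrow> ('k, 'q \<times> 'p) ul set"
where
  "UL_bar_incl K X a =
     XUL_ideal K X +>\<^bsub>UL K (semidirect X)\<^esub>
       UL_map K (semidirect X) (\<lambda>p. (\<zero>\<^bsub>Top X\<^esub>, p)) a"

definition XUL ::
  "'k ring \<Rightarrow> ('k, 'q, 'p) xmod \<Rightarrow> ('k, ('k, 'q \<times> 'p) ul set, ('k, 'p) ul) xmod"
where
  "XUL K X =
     \<lparr>Top = (UL_bar K X)
        \<lparr>carrier := a_kernel (UL_bar K X) (UL K (Base X)) (UL_bar_map K X (src X))\<rparr>,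
      Base = UL K (Base X),
      bdry = UL_bar_map K X (tgt X),
      lact = (\<lambda>a b. UL_bar_incl K X a \<otimes>\<^bsub>UL_bar K X\<^esub> b),
      ract = (\<lambda>b a. b \<otimes>\<^bsub>UL_bar K X\<^esub> UL_bar_incl K X a)\<rparr>"

end

theory Submission
  imports Defs
begin

text \<open>
  Representations of a Leibniz algebra \<open>\<pp>\<close> are right modules over \<open>UL(\<pp>)\<close>, with \<open>x\<^sub>r\<close> and \<open>x\<^sub>l\<close>
  acting as \<open>[_, x]\<close> and \<open>[x, _]\<close>.  Since \<open>x\<^sub>r \<mapsto> - x\<^sub>r\<close>, \<open>x\<^sub>l \<mapsto> x\<^sub>l + x\<^sub>r\<close> is an anti-automorphism
  of \<open>UL(\<pp>)\<close>, they are also left modules, with \<open>x\<^sub>r = - [_, x]\<close> and \<open>x\<^sub>l = [x, _] + [_, x]\<close>.  For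
  crossed modules one puts likewise \<open>q\<^sub>r = - \<xi>\<^sub>2(_, q)\<close> and \<open>q\<^sub>l = \<xi>\<^sub>1(q, _) + \<xi>\<^sub>2(_, q)\<close>.

  A morphism from \<open>XUL(\<qq>, \<pp>, \<eta>)\<close> to a crossed module of algebras \<open>Y\<close> with unital base amounts
  to images of the generators \<open>p\<^sub>l, p\<^sub>r\<close> in the base and \<open>q\<^sub>l, q\<^sub>r\<close> in the top of \<open>Y\<close>, subject to the
  enveloping relations: these are the data of an algebra map from \<open>UL(\<qq> \<rtimes> \<pp>)\<close> to the semidirect
  product of \<open>Y\<close>.  For \<open>Y\<close> the endomorphism crossed module of \<open>\<mu> : N \<rightarrow> M\<close> the relations are the
  axioms of a representation on \<open>\<mu>\<close>, after the change of generators above.  Compatibility of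
  linear maps with the generators implies compatibility with all of \<open>XUL(\<qq>, \<pp>, \<eta>)\<close>, so both
  categories have the same morphisms.
\<close>

text \<open>Elements of \<open>XUL\<close> are cosets of cosets of cosets of finitely supported
  functions, so they are never computed with: maps come from universal properties and identities
  between maps are checked on generators. The obstacle is the top of \<open>XUL\<close>, which is
  given as the kernel \<open>Ker Sb\<close> and not by generators. Dividing by the products of the
  two kernels removes it: in the quotient the kernels annihilate each other, hence
  \<open>b b' = b Ib (Tb b')\<close> for \<open>b\<close>, \<open>b'\<close> in
  \<open>Ker Sb\<close>, and \<open>Ker Sb\<close> turns out to be the UL(p)-bimodule spanned by the
  \<open>q_l\<close> and \<open>q_r\<close>.

  From a representation the universal property yields a left module only as an existence statement.
  The explicit functor therefore goes the other way: \<open>rep_of\<close> evaluates a left module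
  at the generators and is the identity on morphisms. It is onto on objects by the universal
  property. It is injective because modules with the same image have the same morphisms, so that the
  identity map is a morphism between them.\<close>

locale unital_algebra = A?: ring A + module K A for K :: "'k ring" and A :: "('k, 'a) module" +
  assumes smult_mult_l: "\<lbrakk>k \<in> carrier K; x \<in> carrier A; y \<in> carrier A\<rbrakk>
      \<Longrightarrow> (k \<odot>\<^bsub>A\<^esub> x) \<otimes>\<^bsub>A\<^esub> y = k \<odot>\<^bsub>A\<^esub> (x \<otimes>\<^bsub>A\<^esub> y)"
    and smult_mult_r: "\<lbrakk>k \<in> carrier K; x \<in> carrier A; y \<in> carrier A\<rbrakk>
      \<Longrightarrow> x \<otimes>\<^bsub>A\<^esub> (k \<odot>\<^bsub>A\<^esub> y) = k \<odot>\<^bsub>A\<^esub> (x \<otimes>\<^bsub>A\<^esub> y)"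

lemma (in unital_algebra) assoc_algebra: "assoc_algebra K A"
  unfolding assoc_algebra_def bilinear_map_def linear_map_def
  using module_axioms A.m_assoc
  by (auto simp: A.l_distr A.r_distr smult_mult_l smult_mult_r)

text \<open>\<open>alg_hom\<close> leaves the unit free. Preservation of \<open>1\<close> is what
  makes a map out of a free, tensor or enveloping algebra determined by its values on generators,
  the empty word being one of the basis elements.\<close>

definition ualg_hom :: "'k ring \<Rightarrow> ('k, 'a) module \<Rightarrow> ('k, 'b) module \<Rightarrow> ('a \<Rightarrow> 'b) \<Rightarrow> bool" where
  "ualg_hom K A B h \<longleftrightarrow> alg_hom K A B h \<and> h \<one>\<^bsub>A\<^esub> = \<one>\<^bsub>B\<^esub>"

lemma linear_mapI:
  assumes "\<And>x. x \<in> carrier V \<Longrightarrow> f x \<in> carrier W"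
    "\<And>x y. x \<in> carrier V \<Longrightarrow> y \<in> carrier V \<Longrightarrow> f (x \<oplus>\<^bsub>V\<^esub> y) = f x \<oplus>\<^bsub>W\<^esub> f y"
    "\<And>k x. k \<in> carrier K \<Longrightarrow> x \<in> carrier V \<Longrightarrow> f (k \<odot>\<^bsub>V\<^esub> x) = k \<odot>\<^bsub>W\<^esub> f x"
  shows "linear_map K V W f"
  using assms unfolding linear_map_def by auto

lemma linear_mapD:
  assumes "linear_map K V W f"
  shows "x \<in> carrier V \<Longrightarrow> f x \<in> carrier W"
    "x \<in> carrier V \<Longrightarrow> y \<in> carrier V \<Longrightarrow> f (x \<oplus>\<^bsub>V\<^esub> y) = f x \<oplus>\<^bsub>W\<^esub> f y"
    "k \<in> carrier K \<Longrightarrow> x \<in> carrier V \<Longrightarrow> f (k \<odot>\<^bsub>V\<^esub> x) = k \<odot>\<^bsub>W\<^esub> f x"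
  using assms unfolding linear_map_def by auto

lemma ualg_homI:
  assumes "linear_map K A B h"
    "\<And>x y. x \<in> carrier A \<Longrightarrow> y \<in> carrier A \<Longrightarrow> h (x \<otimes>\<^bsub>A\<^esub> y) = h x \<otimes>\<^bsub>B\<^esub> h y"
    "h \<one>\<^bsub>A\<^esub> = \<one>\<^bsub>B\<^esub>"
  shows "ualg_hom K A B h"
  using assms unfolding ualg_hom_def alg_hom_def by auto

lemma ualg_homD:
  assumes "ualg_hom K A B h"
  shows "x \<in> carrier A \<Longrightarrow> h x \<in> carrier B"
    "x \<in> carrier A \<Longrightarrow> y \<in> carrier A \<Longrightarrow> h (x \<oplus>\<^bsub>A\<^esub> y) = h x \<oplus>\<^bsub>B\<^esub> h y"
    "k \<in> carrier K \<Longrightarrow> x \<in> carrier A \<Longrightarrow> h (k \<odot>\<^bsub>A\<^esub> x) = k \<odot>\<^bsub>B\<^esub> h x"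
    "x \<in> carrier A \<Longrightarrow> y \<in> carrier A \<Longrightarrow> h (x \<otimes>\<^bsub>A\<^esub> y) = h x \<otimes>\<^bsub>B\<^esub> h y"
    "h \<one>\<^bsub>A\<^esub> = \<one>\<^bsub>B\<^esub>"
    "linear_map K A B h"
  using assms unfolding ualg_hom_def alg_hom_def linear_map_def by auto

lemma ualg_hom_comp:
  "ualg_hom K A B g \<Longrightarrow> ualg_hom K B C h \<Longrightarrow> ualg_hom K A C (\<lambda>x. h (g x))"
  unfolding ualg_hom_def alg_hom_def linear_map_def by (auto simp: Pi_iff)

lemma linear_map_comp:
  "linear_map K A B g \<Longrightarrow> linear_map K B C h \<Longrightarrow> linear_map K A C (\<lambda>x. h (g x))"
  unfolding linear_map_def by (auto simp: Pi_iff)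

lemma (in abelian_group) minus_eq_zero_iff:
  "x \<in> carrier G \<Longrightarrow> y \<in> carrier G \<Longrightarrow> x \<ominus> y = \<zero> \<longleftrightarrow> x = y"
  by (metis a_minus_def minus_equality minus_minus r_neg a_inv_closed)

lemma linear_map_zero:
  assumes "abelian_group V" "abelian_group W" "linear_map K V W f"
  shows "f \<zero>\<^bsub>V\<^esub> = \<zero>\<^bsub>W\<^esub>"
proof -
  interpret V: abelian_group V by fact
  interpret W: abelian_group W by fact
  have "f \<zero>\<^bsub>V\<^esub> \<oplus>\<^bsub>W\<^esub> f \<zero>\<^bsub>V\<^esub> = f \<zero>\<^bsub>V\<^esub>" "f \<zero>\<^bsub>V\<^esub> \<in> carrier W"
    using linear_mapD[OF assms(3)] by (metis V.l_zero V.zero_closed)+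
  then show ?thesis by (metis W.add.r_cancel_one')
qed

lemma linear_map_uminus:
  assumes "abelian_group V" "abelian_group W" "linear_map K V W f" "x \<in> carrier V"
  shows "f (\<ominus>\<^bsub>V\<^esub> x) = \<ominus>\<^bsub>W\<^esub> f x"
proof -
  interpret V: abelian_group V by fact
  interpret W: abelian_group W by fact
  have "f (\<ominus>\<^bsub>V\<^esub> x) \<oplus>\<^bsub>W\<^esub> f x = \<zero>\<^bsub>W\<^esub>"
    using linear_mapD[OF assms(3)] linear_map_zero[OF assms(1-3)] assms(4)
    by (metis V.l_neg V.a_inv_closed)
  then show ?thesis
    using linear_mapD(1)[OF assms(3)] assms(4) by (simp add: W.minus_equality)
qed

lemma linear_map_minus:
  assumes "abelian_group V" "abelian_group W" "linear_map K V W f" "x \<in> carrier V" "y \<in> carrier V"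
  shows "f (x \<ominus>\<^bsub>V\<^esub> y) = f x \<ominus>\<^bsub>W\<^esub> f y"
proof -
  interpret V: abelian_group V by fact
  show ?thesis unfolding a_minus_def
    using linear_mapD[OF assms(3)] linear_map_uminus[OF assms(1-3)] assms(4,5) by simp
qed

lemma ualg_hom_ring_hom:
  assumes "ring A" "ring B" "ualg_hom K A B h"
  shows "ring_hom_ring A B h"
  using assms by (intro ring_hom_ringI) (auto dest: ualg_homD)

lemma a_kernel_iff:
  "x \<in> a_kernel A B h \<longleftrightarrow> x \<in> carrier A \<and> h x = \<zero>\<^bsub>B\<^esub>"
  by (auto simp: a_kernel_def' )

locale unital_alg_hom = dom: unital_algebra K A + cod: unital_algebra K B
  for K :: "'k ring" and A :: "('k, 'a) module" and B :: "('k, 'b) module" +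
  fixes h
  assumes hom: "ualg_hom K A B h"
begin

lemmas hom_closed = ualg_homD(1)[OF hom]
lemmas hom_add = ualg_homD(2)[OF hom]
lemmas hom_smult = ualg_homD(3)[OF hom]
lemmas hom_mult = ualg_homD(4)[OF hom]
lemmas hom_one = ualg_homD(5)[OF hom]
lemmas hom_linear = ualg_homD(6)[OF hom]
lemmas hom_zero = linear_map_zero[OF dom.A.abelian_group_axioms cod.A.abelian_group_axioms hom_linear]
lemmas hom_minus = linear_map_minus[OF dom.A.abelian_group_axioms cod.A.abelian_group_axioms hom_linear]

lemma kernel_ideal: "ideal (a_kernel A B h) A"
  using ring_hom_ring.kernel_is_ideal[OF ualg_hom_ring_hom[OF dom.A.ring_axioms cod.A.ring_axioms hom]] .

text \<open>The kernel is an ideal, so it contains the smallest ideal over \<open>Y\<close>. Maps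
  descend to the quotients by relations in this way.\<close>

lemma kills_genideal:
  assumes "\<And>x. x \<in> Y \<Longrightarrow> x \<in> carrier A \<and> h x = \<zero>\<^bsub>B\<^esub>" "x \<in> Idl\<^bsub>A\<^esub> Y"
  shows "h x = \<zero>\<^bsub>B\<^esub>"
  using dom.A.genideal_minimal[OF kernel_ideal, of Y] assms by (auto simp: a_kernel_iff subset_iff)

end

section \<open>Quotients of unital algebras\<close>

locale alg_ideal = unital_algebra K A + ideal I A
  for K :: "'k ring" and A :: "('k, 'a) module" and I
begin

text \<open>A ring ideal is closed under scalars because \<open>k x = (k 1) x\<close>. Hence the
  ideals generated by relations in the ring sense are submodules, and their quotients are
  algebras.\<close>

lemma smult_ideal: "k \<in> carrier K \<Longrightarrow> x \<in> I \<Longrightarrow> k \<odot>\<^bsub>A\<^esub> x \<in> I"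
  using I_l_closed[of x "k \<odot>\<^bsub>A\<^esub> \<one>\<^bsub>A\<^esub>"] smult_mult_l[of k "\<one>\<^bsub>A\<^esub>" x]
  by (simp add: Icarr)

lemma coset_eq_iff:
  "x \<in> carrier A \<Longrightarrow> y \<in> carrier A \<Longrightarrow> I +>\<^bsub>A\<^esub> x = I +>\<^bsub>A\<^esub> y \<longleftrightarrow> x \<ominus>\<^bsub>A\<^esub> y \<in> I"
  using A.quotient_eq_iff_same_a_r_cos[OF ideal_axioms] by simp

lemma mem_coset:
  "x \<in> carrier A \<Longrightarrow> y \<in> I +>\<^bsub>A\<^esub> x \<Longrightarrow> y \<in> carrier A \<and> I +>\<^bsub>A\<^esub> y = I +>\<^bsub>A\<^esub> x"
  using a_repr_independence' a_elemrcos_carrier by blast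

lemma carrier_quot: "carrier (quot_alg A I) = (\<lambda>x. I +>\<^bsub>A\<^esub> x) ` carrier A"
  by (auto simp: quot_alg_def FactRing_simps)

lemma quot_ops:
  assumes "x \<in> carrier A" "y \<in> carrier A"
  shows "(I +>\<^bsub>A\<^esub> x) \<oplus>\<^bsub>quot_alg A I\<^esub> (I +>\<^bsub>A\<^esub> y) = I +>\<^bsub>A\<^esub> (x \<oplus>\<^bsub>A\<^esub> y)"
    "(I +>\<^bsub>A\<^esub> x) \<otimes>\<^bsub>quot_alg A I\<^esub> (I +>\<^bsub>A\<^esub> y) = I +>\<^bsub>A\<^esub> (x \<otimes>\<^bsub>A\<^esub> y)"
  using assms by (simp_all add: quot_alg_def FactRing_def a_rcos_sum rcoset_mult_add)

text \<open>In \<open>quot_alg\<close> a scalar multiple is a union over all representatives. By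
  \<open>smult_ideal\<close> the cosets in this union coincide, so the union is a single
  coset.\<close>

lemma quot_smult:
  assumes "k \<in> carrier K" "x \<in> carrier A"
  shows "k \<odot>\<^bsub>quot_alg A I\<^esub> (I +>\<^bsub>A\<^esub> x) = I +>\<^bsub>A\<^esub> (k \<odot>\<^bsub>A\<^esub> x)"
proof -
  have "I +>\<^bsub>A\<^esub> (k \<odot>\<^bsub>A\<^esub> y) = I +>\<^bsub>A\<^esub> (k \<odot>\<^bsub>A\<^esub> x)" if "y \<in> I +>\<^bsub>A\<^esub> x" for y
  proof -
    have y: "y \<in> carrier A" "y \<ominus>\<^bsub>A\<^esub> x \<in> I"
      using mem_coset[OF assms(2) that] coset_eq_iff assms(2) by auto
    have "k \<odot>\<^bsub>A\<^esub> (y \<ominus>\<^bsub>A\<^esub> x) = (k \<odot>\<^bsub>A\<^esub> y) \<ominus>\<^bsub>A\<^esub> (k \<odot>\<^bsub>A\<^esub> x)"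
      using y assms by (simp add: a_minus_def smult_r_distr smult_r_minus)
    then show ?thesis
      using smult_ideal[OF assms(1) y(2)] y assms by (simp add: coset_eq_iff)
  qed
  moreover have "x \<in> I +>\<^bsub>A\<^esub> x" using assms a_rcos_self by blast
  ultimately have "(\<Union>y\<in>I +>\<^bsub>A\<^esub> x. I +>\<^bsub>A\<^esub> (k \<odot>\<^bsub>A\<^esub> y)) = I +>\<^bsub>A\<^esub> (k \<odot>\<^bsub>A\<^esub> x)"
    by blast
  then show ?thesis by (simp add: quot_alg_def)
qed

lemma quot_one: "\<one>\<^bsub>quot_alg A I\<^esub> = I +>\<^bsub>A\<^esub> \<one>\<^bsub>A\<^esub>"
  and quot_zero: "\<zero>\<^bsub>quot_alg A I\<^esub> = I +>\<^bsub>A\<^esub> \<zero>\<^bsub>A\<^esub>"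
  by (simp_all add: quot_alg_def FactRing_def A.a_rcos_zero[OF ideal_axioms])

lemma quot_ring: "ring (quot_alg A I)"
proof -
  have inv: "\<exists>y\<in>carrier (quot_alg A I). y \<oplus>\<^bsub>quot_alg A I\<^esub> x = \<zero>\<^bsub>quot_alg A I\<^esub>"
    if x: "x \<in> carrier (quot_alg A I)" for x
  proof -
    obtain a where a: "a \<in> carrier A" "x = I +>\<^bsub>A\<^esub> a"
      using x by (auto simp: carrier_quot)
    have "(I +>\<^bsub>A\<^esub> (\<ominus>\<^bsub>A\<^esub> a)) \<oplus>\<^bsub>quot_alg A I\<^esub> x = \<zero>\<^bsub>quot_alg A I\<^esub>"
      using a by (simp add: quot_ops quot_zero A.l_neg)
    then show ?thesis using a by (auto simp: carrier_quot)
  qed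
  show ?thesis
    by (intro ringI abelian_groupI monoidI inv)
      (auto simp: carrier_quot quot_ops quot_zero quot_one A.a_ac A.m_assoc
        A.l_distr A.r_distr)
qed

lemma quot_unital_algebra: "unital_algebra K (quot_alg A I)"
proof -
  interpret Q: ring "quot_alg A I" by (rule quot_ring)
  show ?thesis
  proof (intro unital_algebra.intro moduleI unital_algebra_axioms.intro)
    show "cring K" by (rule is_cring)
    show "abelian_group (quot_alg A I)" "ring (quot_alg A I)"
      by (rule Q.abelian_group_axioms quot_ring)+
  qed (auto simp: carrier_quot quot_ops quot_smult smult_l_distr smult_r_distr smult_assoc1
      smult_mult_l smult_mult_r)
qed

lemma quot_proj_hom: "ualg_hom K A (quot_alg A I) (\<lambda>x. I +>\<^bsub>A\<^esub> x)"
  by (intro ualg_homI linear_mapI) (auto simp: carrier_quot quot_ops quot_smult quot_one)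

lemma quot_proj_zero: "x \<in> I \<Longrightarrow> I +>\<^bsub>A\<^esub> x = \<zero>\<^bsub>quot_alg A I\<^esub>"
  by (simp add: quot_zero coset_eq_iff Icarr a_minus_def)

text \<open>Two representatives differ by an element of \<open>I\<close>, which \<open>h\<close>
  kills. So \<open>h\<close> is constant on the coset and its image there is a singleton, as
  \<open>the_elem\<close> in \<open>induced\<close> needs.\<close>

lemma induced_coset:
  assumes "unital_alg_hom K A B h" "\<And>x. x \<in> I \<Longrightarrow> h x = \<zero>\<^bsub>B\<^esub>" "x \<in> carrier A"
  shows "induced h (I +>\<^bsub>A\<^esub> x) = h x"
proof -
  interpret h: unital_alg_hom K A B h by fact
  have "h y = h x" if "y \<in> I +>\<^bsub>A\<^esub> x" for y
  proof -
    have y: "y \<in> carrier A" "y \<ominus>\<^bsub>A\<^esub> x \<in> I"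
      using mem_coset[OF assms(3) that] coset_eq_iff assms(3) by auto
    have "h y \<ominus>\<^bsub>B\<^esub> h x = \<zero>\<^bsub>B\<^esub>"
      using assms(2)[OF y(2)] h.hom_minus[OF y(1) assms(3)] by simp
    then show ?thesis using h.hom_closed y assms(3) by (simp add: h.cod.A.minus_eq_zero_iff)
  qed
  moreover have "x \<in> I +>\<^bsub>A\<^esub> x" using assms a_rcos_self by blast
  ultimately have "h ` (I +>\<^bsub>A\<^esub> x) = {h x}" by blast
  then show ?thesis by (simp add: induced_def)
qed

lemma induced_hom:
  assumes "unital_alg_hom K A B h" "\<And>x. x \<in> I \<Longrightarrow> h x = \<zero>\<^bsub>B\<^esub>"
  shows "ualg_hom K (quot_alg A I) B (induced h)"
proof -
  interpret h: unital_alg_hom K A B h by fact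
  note ind = induced_coset[OF assms]
  show ?thesis
  proof (intro ualg_homI linear_mapI)
    show "induced h \<one>\<^bsub>quot_alg A I\<^esub> = \<one>\<^bsub>B\<^esub>"
      by (simp add: quot_one ind h.hom_one)
    fix x assume "x \<in> carrier (quot_alg A I)"
    then obtain a where a: "a \<in> carrier A" "x = I +>\<^bsub>A\<^esub> a"
      by (auto simp: carrier_quot)
    show "induced h x \<in> carrier B"
      using a by (simp add: ind h.hom_closed)
    show "induced h (k \<odot>\<^bsub>quot_alg A I\<^esub> x) = k \<odot>\<^bsub>B\<^esub> induced h x" if "k \<in> carrier K" for k
      using a that by (simp add: ind quot_smult h.hom_smult)
    fix y assume "y \<in> carrier (quot_alg A I)"
    then obtain b where b: "b \<in> carrier A" "y = I +>\<^bsub>A\<^esub> b"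
      by (auto simp: carrier_quot)
    show "induced h (x \<oplus>\<^bsub>quot_alg A I\<^esub> y) = induced h x \<oplus>\<^bsub>B\<^esub> induced h y"
      "induced h (x \<otimes>\<^bsub>quot_alg A I\<^esub> y) = induced h x \<otimes>\<^bsub>B\<^esub> induced h y"
      using a b by (simp_all add: ind quot_ops h.hom_add h.hom_mult)
  qed
qed

end

section \<open>The free algebra\<close>

text \<open>The basis vectors of the free algebra: letters are the one-letter words, the unit is the
  empty word, and products concatenate (\<open>word_mult_word\<close>).\<close>

definition word :: "'k ring \<Rightarrow> 'v list \<Rightarrow> 'v list \<Rightarrow> 'k" where
  "word K w = (\<lambda>u. if u = w then \<one>\<^bsub>K\<^esub> else \<zero>\<^bsub>K\<^esub>)"

lemma letter_word: "letter K v = word K [v]"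
  by (simp add: letter_def word_def)

locale free_alg = cring K for K :: "'k ring" (structure) + fixes S :: "'v set"
begin

abbreviation F where "F \<equiv> free_algebra K S"

lemma carrier_F:
  "f \<in> carrier F \<longleftrightarrow> (\<forall>u. f u \<in> carrier K) \<and> finite {u. f u \<noteq> \<zero>} \<and> (\<forall>u. u \<notin> lists S \<longrightarrow> f u = \<zero>)"
  by (simp add: free_algebra_def)

lemma F_ops:
  "f \<oplus>\<^bsub>F\<^esub> g = (\<lambda>u. f u \<oplus> g u)" "\<zero>\<^bsub>F\<^esub> = (\<lambda>u. \<zero>)" "k \<odot>\<^bsub>F\<^esub> f = (\<lambda>u. k \<otimes> f u)"
  "f \<otimes>\<^bsub>F\<^esub> g = (\<lambda>u. \<Oplus>i\<in>{..length u}. f (take i u) \<otimes> g (drop i u))" "\<one>\<^bsub>F\<^esub> = word K []"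
  by (simp_all add: free_algebra_def word_def)

lemma F_val: "f \<in> carrier F \<Longrightarrow> f u \<in> carrier K"
  by (simp add: carrier_F)

lemma word_closed: "w \<in> lists S \<Longrightarrow> word K w \<in> carrier F"
  by (auto simp: carrier_F word_def)

lemma letter_closed: "v \<in> S \<Longrightarrow> letter K v \<in> carrier F"
  by (simp add: letter_word word_closed)

lemma F_add_closed: "f \<in> carrier F \<Longrightarrow> g \<in> carrier F \<Longrightarrow> f \<oplus>\<^bsub>F\<^esub> g \<in> carrier F"
  unfolding carrier_F F_ops
  by (auto intro: finite_subset[of _ "{u. f u \<noteq> \<zero>} \<union> {u. g u \<noteq> \<zero>}"])

lemma F_smult_closed: "k \<in> carrier K \<Longrightarrow> f \<in> carrier F \<Longrightarrow> k \<odot>\<^bsub>F\<^esub> f \<in> carrier F"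
  unfolding carrier_F F_ops
  by (auto intro: finite_subset[of _ "{u. f u \<noteq> \<zero>}"])

text \<open>A word in the support of the product is a concatenation of words from the two supports.
  This bounds the support by a finite set and keeps it inside the words over
  \<open>S\<close>.\<close>

lemma F_mult_closed:
  assumes f: "f \<in> carrier F" and g: "g \<in> carrier F"
  shows "f \<otimes>\<^bsub>F\<^esub> g \<in> carrier F"
proof -
  have val: "(f \<otimes>\<^bsub>F\<^esub> g) u \<in> carrier K" for u
    by (simp add: F_ops F_val f g)
  have nz: "\<exists>a b. u = a @ b \<and> f a \<noteq> \<zero> \<and> g b \<noteq> \<zero>" if "(f \<otimes>\<^bsub>F\<^esub> g) u \<noteq> \<zero>" for u
  proof (rule ccontr)
    assume *: "\<not> ?thesis"
    have "f (take i u) \<otimes> g (drop i u) = \<zero>" for i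
      using * F_val[OF f] F_val[OF g] append_take_drop_id[of i u] by (metis l_null r_null)
    then have "(f \<otimes>\<^bsub>F\<^esub> g) u = \<zero>" by (simp add: F_ops)
    with that show False by simp
  qed
  have "{u. (f \<otimes>\<^bsub>F\<^esub> g) u \<noteq> \<zero>} \<subseteq> (\<lambda>(a, b). a @ b) ` ({u. f u \<noteq> \<zero>} \<times> {u. g u \<noteq> \<zero>})"
    using nz by fastforce
  moreover have "finite ((\<lambda>(a, b). a @ b) ` ({u. f u \<noteq> \<zero>} \<times> {u. g u \<noteq> \<zero>}))"
    using f g by (simp add: carrier_F)
  ultimately have "finite {u. (f \<otimes>\<^bsub>F\<^esub> g) u \<noteq> \<zero>}" by (rule finite_subset)
  moreover have "(f \<otimes>\<^bsub>F\<^esub> g) u = \<zero>" if "u \<notin> lists S" for u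
    using nz[of u] that f g unfolding carrier_F by (metis append_in_lists_conv)
  ultimately show ?thesis using val by (simp add: carrier_F)
qed

text \<open>Both sides run over the pairs \<open>(j, k)\<close> with \<open>j + k \<le> n\<close>,
  grouped by the total \<open>i = j + k\<close> on the left and by \<open>j\<close> on the right.
  Associativity of the convolution product rests on this exchange.\<close>

lemma finsum_triangle:
  assumes "\<And>i j. G i j \<in> carrier K"
  shows "(\<Oplus>i\<in>{..n::nat}. \<Oplus>j\<in>{..i}. G j (i - j)) = (\<Oplus>j\<in>{..n}. \<Oplus>i\<in>{..n - j}. G j i)"
proof (induction n)
  case 0
  show ?case using assms by simp
next
  case (Suc n)
  have "(\<Oplus>j\<in>{..Suc n}. \<Oplus>i\<in>{..Suc n - j}. G j i)
      = (\<Oplus>i\<in>{..0}. G (Suc n) i) \<oplus> (\<Oplus>j\<in>{..n}. \<Oplus>i\<in>{..Suc n - j}. G j i)"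
    using assms by (simp add: finsum_Suc)
  also have "(\<Oplus>j\<in>{..n}. \<Oplus>i\<in>{..Suc n - j}. G j i)
      = (\<Oplus>j\<in>{..n}. G j (Suc n - j) \<oplus> (\<Oplus>i\<in>{..n - j}. G j i))"
    by (rule finsum_cong') (auto simp: assms Suc_diff_le finsum_Suc)
  also have "\<dots> = (\<Oplus>j\<in>{..n}. G j (Suc n - j)) \<oplus> (\<Oplus>j\<in>{..n}. \<Oplus>i\<in>{..n - j}. G j i)"
    by (rule finsum_addf) (auto simp: assms)
  finally show ?case
    using assms Suc.IH[symmetric] by (simp add: finsum_Suc a_assoc)
qed

lemma F_mult_assoc:
  assumes f: "f \<in> carrier F" and g: "g \<in> carrier F" and h: "h \<in> carrier F"
  shows "(f \<otimes>\<^bsub>F\<^esub> g) \<otimes>\<^bsub>F\<^esub> h = f \<otimes>\<^bsub>F\<^esub> (g \<otimes>\<^bsub>F\<^esub> h)"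
proof
  fix u :: "'v list"
  let ?n = "length u"
  \<comment> \<open>The term of the triple product for the cut of \<open>u\<close> into a prefix of
    length \<open>j\<close>, a middle part of length \<open>i\<close> and the rest.\<close>
  define G where "G j i = f (take j u) \<otimes> (g (take i (drop j u)) \<otimes> h (drop (i + j) u))" for i j
  note val = F_val[OF f] F_val[OF g] F_val[OF h]
  have "((f \<otimes>\<^bsub>F\<^esub> g) \<otimes>\<^bsub>F\<^esub> h) u
      = (\<Oplus>i\<in>{..?n}. (\<Oplus>j\<in>{..length (take i u)}. f (take j (take i u)) \<otimes> g (drop j (take i u)))
          \<otimes> h (drop i u))"
    by (simp add: F_ops)
  also have "\<dots> = (\<Oplus>i\<in>{..?n}. \<Oplus>j\<in>{..i}. G j (i - j))"
  proof (rule finsum_cong')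
    fix i assume i: "i \<in> {..?n}"
    have "(\<Oplus>j\<in>{..length (take i u)}. f (take j (take i u)) \<otimes> g (drop j (take i u))) \<otimes> h (drop i u)
      = (\<Oplus>j\<in>{..i}. f (take j (take i u)) \<otimes> g (drop j (take i u)) \<otimes> h (drop i u))"
      using i by (simp add: val finsum_ldistr)
    also have "\<dots> = (\<Oplus>j\<in>{..i}. G j (i - j))"
      by (rule finsum_cong') (auto simp: G_def val m_assoc min_def drop_take)
    finally show "(\<Oplus>j\<in>{..length (take i u)}. f (take j (take i u)) \<otimes> g (drop j (take i u)))
        \<otimes> h (drop i u) = (\<Oplus>j\<in>{..i}. G j (i - j))" .
  qed (auto simp: G_def val)
  also have "\<dots> = (\<Oplus>j\<in>{..?n}. \<Oplus>i\<in>{..?n - j}. G j i)"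
    by (rule finsum_triangle) (simp add: G_def val)
  also have "\<dots> = (f \<otimes>\<^bsub>F\<^esub> (g \<otimes>\<^bsub>F\<^esub> h)) u"
    unfolding F_ops
    by (rule finsum_cong') (auto simp: G_def val finsum_rdistr add.commute)
  finally show "((f \<otimes>\<^bsub>F\<^esub> g) \<otimes>\<^bsub>F\<^esub> h) u = (f \<otimes>\<^bsub>F\<^esub> (g \<otimes>\<^bsub>F\<^esub> h)) u" .
qed

text \<open>Among all cuts of \<open>u\<close> only the one after \<open>length w\<close> letters
  can contribute, and only if it cuts off \<open>w\<close>.\<close>

lemma word_mult:
  assumes "g \<in> carrier F"
  shows "word K w \<otimes>\<^bsub>F\<^esub> g
    = (\<lambda>u. if take (length w) u = w then g (drop (length w) u) else \<zero>)" (is "_ = ?r")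
proof
  fix u :: "'v list"
  let ?T = "\<lambda>i. word K w (take i u) \<otimes> g (drop i u)"
  show "(word K w \<otimes>\<^bsub>F\<^esub> g) u = ?r u"
  proof (cases "take (length w) u = w")
    case True
    then have le: "length w \<le> length u" by (metis length_take min.cobounded1)
    have "(\<Oplus>i\<in>{..length u}. ?T i)
        = (\<Oplus>i\<in>{..length u}. if length w = i then g (drop i u) else \<zero>)"
      by (rule finsum_cong') (use True F_val[OF assms] in \<open>auto simp: word_def\<close>)
    also have "\<dots> = g (drop (length w) u)"
      by (rule finsum_singleton) (use le F_val[OF assms] in auto)
    finally show ?thesis using True by (simp add: F_ops)
  next
    case False
    then have "?T i = \<zero>" if "i \<le> length u" for i
      using that F_val[OF assms] by (auto simp: word_def)
    then have "(\<Oplus>i\<in>{..length u}. ?T i) = \<zero>" by (intro add.finprod_one_eqI) auto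
    then show ?thesis using False by (simp add: F_ops)
  qed
qed

lemma word_mult_word:
  assumes "w' \<in> lists S"
  shows "word K w \<otimes>\<^bsub>F\<^esub> word K w' = word K (w @ w')"
  unfolding word_mult[OF word_closed[OF assms]]
  by (rule ext) (auto simp: word_def append_eq_conv_conj, metis append_take_drop_id)

lemma mult_word_Nil:
  assumes "f \<in> carrier F"
  shows "f \<otimes>\<^bsub>F\<^esub> word K [] = f"
proof
  fix u :: "'v list"
  have "(\<Oplus>i\<in>{..length u}. f (take i u) \<otimes> word K [] (drop i u))
      = (\<Oplus>i\<in>{..length u}. if length u = i then f (take i u) else \<zero>)"
    by (rule finsum_cong') (use F_val[OF assms] in \<open>auto simp: word_def\<close>)
  also have "\<dots> = f (take (length u) u)"
    by (rule finsum_singleton) (use F_val[OF assms] in auto)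
  finally show "(f \<otimes>\<^bsub>F\<^esub> word K []) u = f u" by (simp add: F_ops)
qed

lemma F_unital_algebra: "unital_algebra K F"
proof -
  have ab: "abelian_group F"
  proof (rule abelian_groupI)
    show "\<exists>g\<in>carrier F. g \<oplus>\<^bsub>F\<^esub> f = \<zero>\<^bsub>F\<^esub>" if "f \<in> carrier F" for f
    proof
      show "(\<ominus> \<one>) \<odot>\<^bsub>F\<^esub> f \<in> carrier F" using that by (simp add: F_smult_closed)
      show "(\<ominus> \<one>) \<odot>\<^bsub>F\<^esub> f \<oplus>\<^bsub>F\<^esub> f = \<zero>\<^bsub>F\<^esub>"
        using F_val[OF that] by (simp add: F_ops l_minus l_neg)
    qed
  qed (auto simp: F_add_closed, auto simp: F_ops F_val a_ac carrier_F)
  have mon: "Group.monoid F"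
  proof (rule monoidI)
    show "\<one>\<^bsub>F\<^esub> \<in> carrier F" by (simp add: F_ops word_closed)
    show "\<one>\<^bsub>F\<^esub> \<otimes>\<^bsub>F\<^esub> f = f" if "f \<in> carrier F" for f
      using word_mult[OF that, of "[]"] by (simp add: F_ops(5))
    show "f \<otimes>\<^bsub>F\<^esub> \<one>\<^bsub>F\<^esub> = f" if "f \<in> carrier F" for f
      using mult_word_Nil[OF that] by (simp add: F_ops(5))
  qed (simp_all add: F_mult_closed F_mult_assoc)
  have rng: "ring F"
  proof (rule ringI[OF ab mon])
    fix f g h assume fgh: "f \<in> carrier F" "g \<in> carrier F" "h \<in> carrier F"
    note val = fgh[THEN F_val]
    show "(f \<oplus>\<^bsub>F\<^esub> g) \<otimes>\<^bsub>F\<^esub> h = f \<otimes>\<^bsub>F\<^esub> h \<oplus>\<^bsub>F\<^esub> g \<otimes>\<^bsub>F\<^esub> h"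
      unfolding F_ops
      by (rule ext, subst finsum_addf[symmetric]) (auto intro!: finsum_cong' simp: val l_distr)
    show "h \<otimes>\<^bsub>F\<^esub> (f \<oplus>\<^bsub>F\<^esub> g) = h \<otimes>\<^bsub>F\<^esub> f \<oplus>\<^bsub>F\<^esub> h \<otimes>\<^bsub>F\<^esub> g"
      unfolding F_ops
      by (rule ext, subst finsum_addf[symmetric]) (auto intro!: finsum_cong' simp: val r_distr)
  qed
  show ?thesis
  proof (intro unital_algebra.intro moduleI unital_algebra_axioms.intro rng ab is_cring)
    fix k f g assume kfg: "k \<in> carrier K" "f \<in> carrier F" "g \<in> carrier F"
    note val = kfg(2,3)[THEN F_val]
    show "(k \<odot>\<^bsub>F\<^esub> f) \<otimes>\<^bsub>F\<^esub> g = k \<odot>\<^bsub>F\<^esub> (f \<otimes>\<^bsub>F\<^esub> g)" "f \<otimes>\<^bsub>F\<^esub> (k \<odot>\<^bsub>F\<^esub> g) = k \<odot>\<^bsub>F\<^esub> (f \<otimes>\<^bsub>F\<^esub> g)"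
      unfolding F_ops
      by (rule ext, simp add: kfg(1) val finsum_rdistr m_assoc m_lcomm)+
  qed (auto simp: F_smult_closed, auto simp: F_ops F_val l_distr r_distr m_assoc)
qed

text \<open>Words are split off one at a time, by induction on a finite set \<open>A\<close> that
  contains the support. Taking a superset of the support covers the case in which \<open>f\<close>
  vanishes at the word removed.\<close>

lemma free_induct [consumes 1, case_names word add]:
  assumes "f \<in> carrier F"
    and word: "\<And>k w. k \<in> carrier K \<Longrightarrow> w \<in> lists S \<Longrightarrow> P (k \<odot>\<^bsub>F\<^esub> word K w)"
    and add: "\<And>f g. f \<in> carrier F \<Longrightarrow> g \<in> carrier F \<Longrightarrow> P f \<Longrightarrow> P g \<Longrightarrow> P (f \<oplus>\<^bsub>F\<^esub> g)"
  shows "P f"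
proof -
  have "finite A \<Longrightarrow> f \<in> carrier F \<Longrightarrow> {u. f u \<noteq> \<zero>} \<subseteq> A \<Longrightarrow> P f" for A f
  proof (induction A arbitrary: f rule: finite_induct)
    case empty
    \<comment> \<open>The zero function is written as \<open>\<zero>\<close> times the empty word,
      so that \<open>P\<close> has to be checked on scaled words and sums alone.\<close>
    then have "f = \<zero> \<odot>\<^bsub>F\<^esub> word K []" by (auto simp: F_ops word_def fun_eq_iff)
    then show ?case using word[of \<zero> "[]"] by simp
  next
    case (insert w A)
    show ?case
    proof (cases "w \<in> lists S")
      case False
      then have "{u. f u \<noteq> \<zero>} \<subseteq> A" using insert.prems by (auto simp: carrier_F)
      then show ?thesis using insert by simp
    next
      case True
      let ?g = "\<lambda>u. if u = w then \<zero> else f u"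
      have g: "?g \<in> carrier F" "{u. ?g u \<noteq> \<zero>} \<subseteq> A"
        using insert.prems by (auto simp: carrier_F intro: finite_subset[of _ "{u. f u \<noteq> \<zero>}"])
      have "f = (f w \<odot>\<^bsub>F\<^esub> word K w) \<oplus>\<^bsub>F\<^esub> ?g"
        using F_val[OF insert.prems(1)] by (auto simp: F_ops word_def fun_eq_iff)
      moreover have "P ((f w \<odot>\<^bsub>F\<^esub> word K w) \<oplus>\<^bsub>F\<^esub> ?g)"
        using F_val[OF insert.prems(1)] True g
        by (intro add F_smult_closed word_closed word insert.IH) auto
      ultimately show ?thesis by simp
    qed
  qed
  from this[of "{u. f u \<noteq> \<zero>}" f] assms(1) show ?thesis by (simp add: carrier_F)
qed

end

section \<open>The universal property of the free algebra\<close>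

definition free_ext :: "('k, 'a) module \<Rightarrow> 'k ring \<Rightarrow> ('v \<Rightarrow> 'a) \<Rightarrow> ('v list \<Rightarrow> 'k) \<Rightarrow> 'a" where
  "free_ext A K h f = (\<Oplus>\<^bsub>A\<^esub>u\<in>{u. f u \<noteq> \<zero>\<^bsub>K\<^esub>}. f u \<odot>\<^bsub>A\<^esub> foldr (\<lambda>v a. h v \<otimes>\<^bsub>A\<^esub> a) u \<one>\<^bsub>A\<^esub>)"

locale free_alg_ext = free_alg K S + A: unital_algebra K A
  for K :: "'k ring" (structure) and S :: "'v set" and A :: "('k, 'a) module" +
  fixes h :: "'v \<Rightarrow> 'a"
  assumes h: "\<And>v. v \<in> S \<Longrightarrow> h v \<in> carrier A"
begin

abbreviation wval where "wval u \<equiv> foldr (\<lambda>v a. h v \<otimes>\<^bsub>A\<^esub> a) u \<one>\<^bsub>A\<^esub>"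

lemma wval_closed: "u \<in> lists S \<Longrightarrow> wval u \<in> carrier A"
  by (induction u) (auto simp: h)

lemma wval_append: "u \<in> lists S \<Longrightarrow> w \<in> lists S \<Longrightarrow> wval (u @ w) = wval u \<otimes>\<^bsub>A\<^esub> wval w"
  by (induction u) (auto simp: h wval_closed A.A.m_assoc)

text \<open>Lets the sums for \<open>f\<close>, \<open>g\<close> and \<open>f + g\<close>, whose
  supports differ, run over one common index set.\<close>

lemma free_ext_superset:
  assumes f: "f \<in> carrier F" and B: "finite B" "B \<subseteq> lists S" "{u. f u \<noteq> \<zero>} \<subseteq> B"
  shows "free_ext A K h f = (\<Oplus>\<^bsub>A\<^esub>u\<in>B. f u \<odot>\<^bsub>A\<^esub> wval u)"
  unfolding free_ext_def
  by (rule A.A.add.finprod_mono_neutral_cong_left)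
    (use B F_val[OF f] wval_closed in \<open>auto simp: subset_iff\<close>)

lemma support_lists: "f \<in> carrier F \<Longrightarrow> {u. f u \<noteq> \<zero>} \<subseteq> lists S"
  unfolding carrier_F by blast

lemma finite_support: "f \<in> carrier F \<Longrightarrow> finite {u. f u \<noteq> \<zero>}"
  by (simp add: carrier_F)

lemma free_ext_closed: "f \<in> carrier F \<Longrightarrow> free_ext A K h f \<in> carrier A"
  unfolding free_ext_def
  using support_lists F_val wval_closed
  by (intro A.A.finsum_closed) (auto simp: subset_iff)

lemma free_ext_add:
  assumes f: "f \<in> carrier F" and g: "g \<in> carrier F"
  shows "free_ext A K h (f \<oplus>\<^bsub>F\<^esub> g) = free_ext A K h f \<oplus>\<^bsub>A\<^esub> free_ext A K h g"
proof -
  let ?B = "{u. f u \<noteq> \<zero>} \<union> {u. g u \<noteq> \<zero>}"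
  have B: "finite ?B" "?B \<subseteq> lists S" "{u. (f \<oplus>\<^bsub>F\<^esub> g) u \<noteq> \<zero>} \<subseteq> ?B"
    using finite_support f g support_lists by (auto simp: F_ops)
  have "free_ext A K h (f \<oplus>\<^bsub>F\<^esub> g) = (\<Oplus>\<^bsub>A\<^esub>u\<in>?B. (f \<oplus>\<^bsub>F\<^esub> g) u \<odot>\<^bsub>A\<^esub> wval u)"
    by (rule free_ext_superset[OF F_add_closed[OF f g] B])
  also have "\<dots> = (\<Oplus>\<^bsub>A\<^esub>u\<in>?B. f u \<odot>\<^bsub>A\<^esub> wval u \<oplus>\<^bsub>A\<^esub> g u \<odot>\<^bsub>A\<^esub> wval u)"
    by (rule A.A.finsum_cong')
      (use B F_val[OF f] F_val[OF g] wval_closed in \<open>auto simp: F_ops A.smult_l_distr subset_iff\<close>)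
  also have "\<dots> = (\<Oplus>\<^bsub>A\<^esub>u\<in>?B. f u \<odot>\<^bsub>A\<^esub> wval u) \<oplus>\<^bsub>A\<^esub> (\<Oplus>\<^bsub>A\<^esub>u\<in>?B. g u \<odot>\<^bsub>A\<^esub> wval u)"
    by (rule A.A.finsum_addf)
      (use B F_val[OF f] F_val[OF g] wval_closed in \<open>auto simp: subset_iff\<close>)
  also have "\<dots> = free_ext A K h f \<oplus>\<^bsub>A\<^esub> free_ext A K h g"
    using B free_ext_superset[OF f, of ?B] free_ext_superset[OF g, of ?B] by simp
  finally show ?thesis .
qed

lemma free_ext_word:
  assumes "k \<in> carrier K" "w \<in> lists S"
  shows "free_ext A K h (k \<odot>\<^bsub>F\<^esub> word K w) = k \<odot>\<^bsub>A\<^esub> wval w"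
proof -
  have "free_ext A K h (k \<odot>\<^bsub>F\<^esub> word K w) = (\<Oplus>\<^bsub>A\<^esub>u\<in>{w}. (k \<odot>\<^bsub>F\<^esub> word K w) u \<odot>\<^bsub>A\<^esub> wval u)"
    by (rule free_ext_superset[OF F_smult_closed[OF assms(1) word_closed[OF assms(2)]]])
      (use assms in \<open>auto simp: F_ops word_def\<close>)
  also have "\<dots> = k \<odot>\<^bsub>A\<^esub> wval w"
    using assms wval_closed[OF assms(2)] by (simp add: F_ops word_def)
  finally show ?thesis .
qed

lemma free_ext_hom: "ualg_hom K F A (free_ext A K h)"
proof -
  interpret F: unital_algebra K F by (rule F_unital_algebra)
  have smult: "free_ext A K h (k \<odot>\<^bsub>F\<^esub> f) = k \<odot>\<^bsub>A\<^esub> free_ext A K h f"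
    if k: "k \<in> carrier K" and f: "f \<in> carrier F" for k f
    using f
  proof (induction f rule: free_induct)
    case (word k' w)
    then show ?case
      using k by (simp add: free_ext_word wval_closed A.smult_assoc1
          F.smult_assoc1[symmetric] word_closed)
  next
    case (add f g)
    then show ?case
      using k by (simp add: F.smult_r_distr free_ext_add F_smult_closed A.smult_r_distr free_ext_closed)
  qed
  \<comment> \<open>Both sides are additive in each factor, so multiplicativity reduces to scaled
    words, where it is \<open>wval_append\<close>. The second factor is reduced here, the first one
    in \<open>mult\<close>.\<close>
  have mult_word: "free_ext A K h ((k \<odot>\<^bsub>F\<^esub> word K w) \<otimes>\<^bsub>F\<^esub> g)
      = free_ext A K h (k \<odot>\<^bsub>F\<^esub> word K w) \<otimes>\<^bsub>A\<^esub> free_ext A K h g"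
    if k: "k \<in> carrier K" and w: "w \<in> lists S" and g: "g \<in> carrier F" for k w g
    using g
  proof (induction g rule: free_induct)
    case (word k' w')
    then have "(k \<odot>\<^bsub>F\<^esub> word K w) \<otimes>\<^bsub>F\<^esub> (k' \<odot>\<^bsub>F\<^esub> word K w')
        = (k \<otimes> k') \<odot>\<^bsub>F\<^esub> word K (w @ w')"
      using k w by (simp add: F.smult_mult_l F.smult_mult_r word_closed word_mult_word
          F.smult_assoc1[symmetric] m_comm)
    then show ?case
      using k w word by (simp add: free_ext_word wval_closed wval_append A.smult_mult_l
          A.smult_mult_r A.smult_assoc1[symmetric] m_comm del: foldr_append)
  next
    case (add f g)
    then show ?case
      using k w by (simp add: F.A.r_distr F_smult_closed word_closed free_ext_add F_mult_closed
          A.A.r_distr free_ext_closed)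
  qed
  have mult: "free_ext A K h (f \<otimes>\<^bsub>F\<^esub> g) = free_ext A K h f \<otimes>\<^bsub>A\<^esub> free_ext A K h g"
    if f: "f \<in> carrier F" and g: "g \<in> carrier F" for f g
    using f
  proof (induction f rule: free_induct)
    case (word k w)
    then show ?case using mult_word g by simp
  next
    case (add f f')
    then show ?case
      using g by (simp add: F.A.l_distr free_ext_add F_mult_closed A.A.l_distr free_ext_closed)
  qed
  have "free_ext A K h \<one>\<^bsub>F\<^esub> = \<one>\<^bsub>A\<^esub>"
    using free_ext_word[of \<one> "[]"] F.smult_one[OF word_closed[of "[]"]] by (simp add: F_ops)
  then show ?thesis
    by (intro ualg_homI linear_mapI) (simp_all add: free_ext_closed free_ext_add smult mult)
qed

lemma free_ext_letter:
  assumes "v \<in> S"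
  shows "free_ext A K h (letter K v) = h v"
proof -
  interpret F: unital_algebra K F by (rule F_unital_algebra)
  show ?thesis
    using free_ext_word[of \<one> "[v]"] F.smult_one[OF word_closed[of "[v]"]] assms h
    by (simp add: letter_word)
qed

end

text \<open>\<open>free_map\<close> adds up coefficients along the fibres of \<open>map g\<close>,
  since \<open>g\<close> may identify words. Both sides are additive in \<open>f\<close> and agree
  on scaled words; through this identification \<open>free_map\<close> inherits the homomorphism
  property of \<open>free_ext\<close>.\<close>

lemma free_map_eq_ext:
  assumes K: "cring K" and g: "\<And>v. v \<in> S \<Longrightarrow> g v \<in> S'" and f: "f \<in> carrier (free_algebra K S)"
  shows "free_map K g f = free_ext (free_algebra K S') K (\<lambda>v. letter K (g v)) f"
proof -
  interpret K: cring K by fact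
  interpret S: free_alg K S by unfold_locales
  interpret S': free_alg K S' by unfold_locales
  interpret F': unital_algebra K S'.F by (rule S'.F_unital_algebra)
  interpret E: free_alg_ext K S S'.F "\<lambda>v. letter K (g v)"
    by unfold_locales (simp add: g S'.letter_closed)
  have wval: "E.wval u = word K (map g u)" if "u \<in> lists S" for u
    using that
  proof (induction u)
    case (Cons v u)
    then have "map g u \<in> lists S'" by (auto simp: g)
    then show ?case
      using Cons by (simp add: letter_word S'.word_mult_word)
  qed (simp add: S'.F_ops(5))
  \<comment> \<open>The index set in \<open>free_map\<close> depends on \<open>f\<close>. Moving the
    condition on words into the summand allows any finite superset of the support, so that the sums
    for \<open>f\<close>, \<open>f'\<close> and \<open>f + f'\<close> become comparable.\<close>
  have eq: "free_map K g f u' = (\<Oplus>\<^bsub>K\<^esub>u\<in>B. if map g u = u' then f u else \<zero>\<^bsub>K\<^esub>)"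
    if f: "f \<in> carrier S.F" and B: "finite B" "{u. f u \<noteq> \<zero>\<^bsub>K\<^esub>} \<subseteq> B" for f u' B
    unfolding free_map_def
    by (rule K.add.finprod_mono_neutral_cong_left) (use B S.F_val[OF f] in auto)
  show ?thesis
    using f
  proof (induction f rule: S.free_induct)
    case (word k w)
    have "free_map K g (k \<odot>\<^bsub>S.F\<^esub> word K w) u' = (k \<odot>\<^bsub>S'.F\<^esub> word K (map g w)) u'" for u'
    proof -
      have "free_map K g (k \<odot>\<^bsub>S.F\<^esub> word K w) u'
        = (\<Oplus>\<^bsub>K\<^esub>u\<in>{w}. if map g u = u' then (k \<odot>\<^bsub>S.F\<^esub> word K w) u else \<zero>\<^bsub>K\<^esub>)"
        by (rule eq[OF S.F_smult_closed[OF word(1) S.word_closed[OF word(2)]]])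
          (use word in \<open>auto simp: S.F_ops word_def\<close>)
      then show ?thesis using word by (auto simp: S.F_ops S'.F_ops word_def)
    qed
    then show ?case
      using word by (simp add: E.free_ext_word wval fun_eq_iff)
  next
    case (add f f')
    let ?B = "{u. f u \<noteq> \<zero>\<^bsub>K\<^esub>} \<union> {u. f' u \<noteq> \<zero>\<^bsub>K\<^esub>}"
    have B: "finite ?B" using add by (simp add: S.carrier_F)
    have "free_map K g (f \<oplus>\<^bsub>S.F\<^esub> f') u' = free_map K g f u' \<oplus>\<^bsub>K\<^esub> free_map K g f' u'" for u'
    proof -
      have "free_map K g (f \<oplus>\<^bsub>S.F\<^esub> f') u'
        = (\<Oplus>\<^bsub>K\<^esub>u\<in>?B. if map g u = u' then (f \<oplus>\<^bsub>S.F\<^esub> f') u else \<zero>\<^bsub>K\<^esub>)"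
        by (rule eq[OF S.F_add_closed B]) (use add in \<open>auto simp: S.F_ops\<close>)
      also have "\<dots> = (\<Oplus>\<^bsub>K\<^esub>u\<in>?B. (if map g u = u' then f u else \<zero>\<^bsub>K\<^esub>) \<oplus>\<^bsub>K\<^esub>
          (if map g u = u' then f' u else \<zero>\<^bsub>K\<^esub>))"
        by (rule K.finsum_cong') (use add S.F_val in \<open>auto simp: S.F_ops\<close>)
      also have "\<dots> = (\<Oplus>\<^bsub>K\<^esub>u\<in>?B. if map g u = u' then f u else \<zero>\<^bsub>K\<^esub>) \<oplus>\<^bsub>K\<^esub>
          (\<Oplus>\<^bsub>K\<^esub>u\<in>?B. if map g u = u' then f' u else \<zero>\<^bsub>K\<^esub>)"
        by (rule K.finsum_addf) (use add S.F_val in auto)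
      also have "\<dots> = free_map K g f u' \<oplus>\<^bsub>K\<^esub> free_map K g f' u'"
        using eq[OF add(1) B, of u'] eq[OF add(2) B, of u'] by auto
      finally show ?thesis .
    qed
    then show ?case
      using add by (simp add: E.free_ext_add S'.F_ops fun_eq_iff)
  qed
qed

lemma (in unital_algebra) ualg_hom_cong:
  assumes "ualg_hom K A B h" "\<And>x. x \<in> carrier A \<Longrightarrow> h' x = h x"
  shows "ualg_hom K A B h'"
  using assms(1) unfolding ualg_hom_def alg_hom_def linear_map_def
  by (auto simp: assms(2) Pi_iff)

section \<open>The universal enveloping algebra\<close>

text \<open>The possible images of the generators under unital algebra maps from UL(P) to
  \<open>A\<close>: \<open>UL_universal\<close> extends such data to a map, and
  \<open>UL_gens_data\<close> is the universal instance.\<close>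

definition UL_data :: "'k ring \<Rightarrow> ('k, 'p) module \<Rightarrow> ('k, 'a) module \<Rightarrow> ('p \<Rightarrow> 'a) \<Rightarrow> ('p \<Rightarrow> 'a) \<Rightarrow> bool"
where
  "UL_data K P A l r \<longleftrightarrow>
     linear_map K P A l \<and> linear_map K P A r \<and>
     (\<forall>x\<in>carrier P. \<forall>y\<in>carrier P.
        r (x \<otimes>\<^bsub>P\<^esub> y) = r x \<otimes>\<^bsub>A\<^esub> r y \<ominus>\<^bsub>A\<^esub> r y \<otimes>\<^bsub>A\<^esub> r x \<and>
        l (x \<otimes>\<^bsub>P\<^esub> y) = l x \<otimes>\<^bsub>A\<^esub> r y \<ominus>\<^bsub>A\<^esub> r y \<otimes>\<^bsub>A\<^esub> l x \<and>
        (r y \<oplus>\<^bsub>A\<^esub> l y) \<otimes>\<^bsub>A\<^esub> l x = \<zero>\<^bsub>A\<^esub>)"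

definition UL_l :: "'k ring \<Rightarrow> ('k, 'p) module \<Rightarrow> 'p \<Rightarrow> ('k, 'p) ul" where
  "UL_l K P x = UL_ideal K P +>\<^bsub>tensor_algebra K (double P)\<^esub> left_gen K P x"

definition UL_r :: "'k ring \<Rightarrow> ('k, 'p) module \<Rightarrow> 'p \<Rightarrow> ('k, 'p) ul" where
  "UL_r K P x = UL_ideal K P +>\<^bsub>tensor_algebra K (double P)\<^esub> right_gen K P x"

text \<open>A closed bracket is all that forming the enveloping algebra takes, so the construction
  applies to the semidirect product as soon as closure is checked there.\<close>

locale bracket_module = P: module K P for K :: "'k ring" and P :: "('k, 'p) module" +
  assumes bracket_closed: "\<lbrakk>x \<in> carrier P; y \<in> carrier P\<rbrakk> \<Longrightarrow> x \<otimes>\<^bsub>P\<^esub> y \<in> carrier P"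
begin

lemma cring_K: "cring K"
  by (rule module.axioms(1)[OF P.module_axioms])

abbreviation D where "D \<equiv> double P"
abbreviation T where "T \<equiv> tensor_algebra K D"
abbreviation U where "U \<equiv> UL K P"

abbreviation tensor_rels where
  "tensor_rels \<equiv>
     {letter K (v \<oplus>\<^bsub>D\<^esub> w) \<ominus>\<^bsub>free_algebra K (carrier D)\<^esub>
        (letter K v \<oplus>\<^bsub>free_algebra K (carrier D)\<^esub> letter K w) | v w.
           v \<in> carrier D \<and> w \<in> carrier D} \<union>
     {letter K (k \<odot>\<^bsub>D\<^esub> v) \<ominus>\<^bsub>free_algebra K (carrier D)\<^esub>
        k \<odot>\<^bsub>free_algebra K (carrier D)\<^esub> letter K v | k v. k \<in> carrier K \<and> v \<in> carrier D}"

abbreviation UL_rels where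
  "UL_rels \<equiv>
     {right_gen K P (x \<otimes>\<^bsub>P\<^esub> y) \<ominus>\<^bsub>T\<^esub> (right_gen K P x \<otimes>\<^bsub>T\<^esub> right_gen K P y
        \<ominus>\<^bsub>T\<^esub> right_gen K P y \<otimes>\<^bsub>T\<^esub> right_gen K P x) | x y. x \<in> carrier P \<and> y \<in> carrier P} \<union>
     {left_gen K P (x \<otimes>\<^bsub>P\<^esub> y) \<ominus>\<^bsub>T\<^esub> (left_gen K P x \<otimes>\<^bsub>T\<^esub> right_gen K P y
        \<ominus>\<^bsub>T\<^esub> right_gen K P y \<otimes>\<^bsub>T\<^esub> left_gen K P x) | x y. x \<in> carrier P \<and> y \<in> carrier P} \<union>
     {(right_gen K P y \<oplus>\<^bsub>T\<^esub> left_gen K P y) \<otimes>\<^bsub>T\<^esub> left_gen K P x | x y.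
        x \<in> carrier P \<and> y \<in> carrier P}"

lemma tensor_ideal_eq: "tensor_ideal K D = Idl\<^bsub>free_algebra K (carrier D)\<^esub> tensor_rels"
  by (simp only: tensor_ideal_def Let_def)

lemma UL_ideal_eq: "UL_ideal K P = Idl\<^bsub>T\<^esub> UL_rels"
  by (simp only: UL_ideal_def Let_def)

lemma double_simps:
  "carrier D = carrier P \<times> carrier P"
  "(x, y) \<oplus>\<^bsub>D\<^esub> (x', y') = (x \<oplus>\<^bsub>P\<^esub> x', y \<oplus>\<^bsub>P\<^esub> y')"
  "k \<odot>\<^bsub>D\<^esub> (x, y) = (k \<odot>\<^bsub>P\<^esub> x, k \<odot>\<^bsub>P\<^esub> y)"
  by (simp_all add: double_def)

lemma double_closed:
  "v \<in> carrier D \<Longrightarrow> w \<in> carrier D \<Longrightarrow> v \<oplus>\<^bsub>D\<^esub> w \<in> carrier D"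
  "k \<in> carrier K \<Longrightarrow> v \<in> carrier D \<Longrightarrow> k \<odot>\<^bsub>D\<^esub> v \<in> carrier D"
  by (auto simp: double_simps)

sublocale free_alg K "carrier D" ..
sublocale F: unital_algebra K F by (rule F_unital_algebra)

lemma tensor_rels_closed: "tensor_rels \<subseteq> carrier F"
  by (auto intro!: F.A.minus_closed letter_closed double_closed)

sublocale TI: alg_ideal K F "tensor_ideal K D"
  unfolding tensor_ideal_eq
  by (intro alg_ideal.intro F_unital_algebra F.A.genideal_ideal tensor_rels_closed)

sublocale T: unital_algebra K T
  unfolding tensor_algebra_def by (rule TI.quot_unital_algebra)

lemma tensor_proj_hom: "ualg_hom K F T (\<lambda>f. tensor_ideal K D +>\<^bsub>F\<^esub> f)"
  unfolding tensor_algebra_def by (rule TI.quot_proj_hom)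

lemma tensor_incl_linear: "linear_map K D T (tensor_incl K D)"
proof -
  let ?p = "\<lambda>f. tensor_ideal K D +>\<^bsub>F\<^esub> f"
  note gen = F.A.genideal_self[OF tensor_rels_closed, THEN subsetD, folded tensor_ideal_eq]
  have rel1: "letter K (v \<oplus>\<^bsub>D\<^esub> w) \<ominus>\<^bsub>F\<^esub> (letter K v \<oplus>\<^bsub>F\<^esub> letter K w) \<in> tensor_ideal K D"
    if "v \<in> carrier D" "w \<in> carrier D" for v w
    using that by (intro gen) blast
  have rel2: "letter K (k \<odot>\<^bsub>D\<^esub> v) \<ominus>\<^bsub>F\<^esub> k \<odot>\<^bsub>F\<^esub> letter K v \<in> tensor_ideal K D"
    if "v \<in> carrier D" "k \<in> carrier K" for v k
    using that by (intro gen) blast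
  show ?thesis
  proof (rule linear_mapI)
    fix v assume v: "v \<in> carrier D"
    show "tensor_incl K D v \<in> carrier T"
      using ualg_homD(1)[OF tensor_proj_hom] letter_closed[OF v] by (simp add: tensor_incl_def)
    show "tensor_incl K D (k \<odot>\<^bsub>D\<^esub> v) = k \<odot>\<^bsub>T\<^esub> tensor_incl K D v" if k: "k \<in> carrier K" for k
    proof -
      have "?p (letter K (k \<odot>\<^bsub>D\<^esub> v)) = ?p (k \<odot>\<^bsub>F\<^esub> letter K v)"
        using rel2[OF v k] v k by (subst TI.coset_eq_iff) (auto simp: letter_closed double_closed)
      then show ?thesis
        using ualg_homD(3)[OF tensor_proj_hom] v k by (simp add: tensor_incl_def letter_closed)
    qed
    fix w assume w: "w \<in> carrier D"
    have "?p (letter K (v \<oplus>\<^bsub>D\<^esub> w)) = ?p (letter K v \<oplus>\<^bsub>F\<^esub> letter K w)"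
      using rel1[OF v w] v w by (subst TI.coset_eq_iff) (auto simp: letter_closed double_closed)
    then show "tensor_incl K D (v \<oplus>\<^bsub>D\<^esub> w) = tensor_incl K D v \<oplus>\<^bsub>T\<^esub> tensor_incl K D w"
      using ualg_homD(2)[OF tensor_proj_hom] v w by (simp add: tensor_incl_def letter_closed)
  qed
qed

text \<open>Stated for an algebra map \<open>E\<close> on the free algebra rather than for a linear
  map on \<open>D\<close>. It then serves both the universal property, with \<open>E\<close> a
  \<open>free_ext\<close>, and functoriality, where \<open>tensor_map\<close> is
  \<open>induced\<close> by a map built from \<open>free_map\<close>.\<close>

lemma tensor_lift:
  assumes E: "unital_alg_hom K F B E" and lin: "linear_map K D B (\<lambda>v. E (letter K v))"
  shows "ualg_hom K T B (induced E)"
    and "v \<in> carrier D \<Longrightarrow> induced E (tensor_incl K D v) = E (letter K v)"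
proof -
  interpret E: unital_alg_hom K F B E by (rule E)
  have kills: "E x = \<zero>\<^bsub>B\<^esub>" if "x \<in> tensor_ideal K D" for x
    using _ that unfolding tensor_ideal_eq
  proof (rule E.kills_genideal)
    fix y assume "y \<in> tensor_rels"
    then consider
        v w where "v \<in> carrier D" "w \<in> carrier D"
          "y = letter K (v \<oplus>\<^bsub>D\<^esub> w) \<ominus>\<^bsub>F\<^esub> (letter K v \<oplus>\<^bsub>F\<^esub> letter K w)"
      | k v where "v \<in> carrier D" "k \<in> carrier K"
          "y = letter K (k \<odot>\<^bsub>D\<^esub> v) \<ominus>\<^bsub>F\<^esub> k \<odot>\<^bsub>F\<^esub> letter K v"
      by blast
    then show "y \<in> carrier F \<and> E y = \<zero>\<^bsub>B\<^esub>"
    proof cases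
      case 1
      then show ?thesis
        using linear_mapD(1,2)[OF lin]
        by (simp add: letter_closed double_closed E.hom_minus E.hom_add
            E.cod.A.minus_eq_zero_iff)
    next
      case 2
      then show ?thesis
        using linear_mapD(1,3)[OF lin]
        by (simp add: letter_closed double_closed E.hom_minus E.hom_smult
            E.cod.A.minus_eq_zero_iff)
    qed
  qed
  show "ualg_hom K T B (induced E)"
    unfolding tensor_algebra_def by (rule TI.induced_hom[OF E kills])
  show "induced E (tensor_incl K D v) = E (letter K v)" if "v \<in> carrier D"
    unfolding tensor_incl_def by (rule TI.induced_coset[OF E kills letter_closed[OF that]])
qed

lemma gens_linear:
  shows "linear_map K P T (left_gen K P)" "linear_map K P T (right_gen K P)"
proof -
  have "linear_map K P D (\<lambda>x. (x, \<zero>\<^bsub>P\<^esub>))" "linear_map K P D (\<lambda>x. (\<zero>\<^bsub>P\<^esub>, x))"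
    by (auto intro!: linear_mapI simp: double_simps)
  from this[THEN linear_map_comp[OF _ tensor_incl_linear]]
  show "linear_map K P T (left_gen K P)" "linear_map K P T (right_gen K P)"
    unfolding left_gen_def right_gen_def by simp_all
qed

lemmas gens_closed = linear_mapD(1)[OF gens_linear(1)] linear_mapD(1)[OF gens_linear(2)]

lemma UL_rels_closed: "UL_rels \<subseteq> carrier T"
  by (auto intro!: T.A.minus_closed gens_closed bracket_closed)

sublocale UI: alg_ideal K T "UL_ideal K P"
  unfolding UL_ideal_eq
  by (intro alg_ideal.intro T.unital_algebra_axioms T.A.genideal_ideal UL_rels_closed)

sublocale U: unital_algebra K U
  unfolding UL_def by (rule UI.quot_unital_algebra)

lemma UL_proj_hom: "ualg_hom K T U (\<lambda>z. UL_ideal K P +>\<^bsub>T\<^esub> z)"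
  unfolding UL_def by (rule UI.quot_proj_hom)

lemma UL_gens_linear: "linear_map K P U (UL_l K P)" "linear_map K P U (UL_r K P)"
  using gens_linear[THEN linear_map_comp[OF _ ualg_homD(6)[OF UL_proj_hom]]]
  unfolding UL_l_def UL_r_def by auto

lemmas UL_gens_closed = linear_mapD(1)[OF UL_gens_linear(1)] linear_mapD(1)[OF UL_gens_linear(2)]

lemma UL_gens_data: "UL_data K P U (UL_l K P) (UL_r K P)"
proof -
  interpret p: unital_alg_hom K T U "\<lambda>z. UL_ideal K P +>\<^bsub>T\<^esub> z"
    by unfold_locales (rule UL_proj_hom)
  note gen = T.A.genideal_self[OF UL_rels_closed, THEN subsetD, folded UL_ideal_eq]
  let ?l = "left_gen K P" and ?r = "right_gen K P"
  have rel: "?r (x \<otimes>\<^bsub>P\<^esub> y) \<ominus>\<^bsub>T\<^esub> (?r x \<otimes>\<^bsub>T\<^esub> ?r y \<ominus>\<^bsub>T\<^esub> ?r y \<otimes>\<^bsub>T\<^esub> ?r x) \<in> UL_ideal K P"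
    "?l (x \<otimes>\<^bsub>P\<^esub> y) \<ominus>\<^bsub>T\<^esub> (?l x \<otimes>\<^bsub>T\<^esub> ?r y \<ominus>\<^bsub>T\<^esub> ?r y \<otimes>\<^bsub>T\<^esub> ?l x) \<in> UL_ideal K P"
    "(?r y \<oplus>\<^bsub>T\<^esub> ?l y) \<otimes>\<^bsub>T\<^esub> ?l x \<in> UL_ideal K P"
    if "x \<in> carrier P" "y \<in> carrier P" for x y
    using that by (intro gen, blast)+
  have eq: "UL_ideal K P +>\<^bsub>T\<^esub> a = UL_ideal K P +>\<^bsub>T\<^esub> b"
    if "a \<ominus>\<^bsub>T\<^esub> b \<in> UL_ideal K P" "a \<in> carrier T" "b \<in> carrier T" for a b
    using that by (simp add: UI.coset_eq_iff)
  note z = UI.quot_proj_zero[OF rel(3), folded UL_def]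
  show ?thesis
    unfolding UL_data_def
  proof (intro conjI ballI UL_gens_linear)
    fix x y assume xy: "x \<in> carrier P" "y \<in> carrier P"
    show "UL_r K P (x \<otimes>\<^bsub>P\<^esub> y)
        = UL_r K P x \<otimes>\<^bsub>U\<^esub> UL_r K P y \<ominus>\<^bsub>U\<^esub> UL_r K P y \<otimes>\<^bsub>U\<^esub> UL_r K P x"
      using eq[OF rel(1)[OF xy]] xy
      by (simp add: UL_r_def gens_closed bracket_closed p.hom_minus p.hom_mult)
    show "UL_l K P (x \<otimes>\<^bsub>P\<^esub> y)
        = UL_l K P x \<otimes>\<^bsub>U\<^esub> UL_r K P y \<ominus>\<^bsub>U\<^esub> UL_r K P y \<otimes>\<^bsub>U\<^esub> UL_l K P x"
      using eq[OF rel(2)[OF xy]] xy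
      by (simp add: UL_r_def UL_l_def gens_closed bracket_closed p.hom_minus p.hom_mult)
    show "(UL_r K P y \<oplus>\<^bsub>U\<^esub> UL_l K P y) \<otimes>\<^bsub>U\<^esub> UL_l K P x = \<zero>\<^bsub>U\<^esub>"
      using z[OF xy] xy by (simp add: UL_r_def UL_l_def gens_closed p.hom_add p.hom_mult)
  qed
qed

text \<open>The analogue of \<open>tensor_lift\<close> one quotient further, with the enveloping
  relations in place of linearity; again it serves both the universal property and
  \<open>UL_map\<close>.\<close>

lemma UL_lift:
  assumes E: "unital_alg_hom K T B E"
    and data: "UL_data K P B (\<lambda>x. E (left_gen K P x)) (\<lambda>x. E (right_gen K P x))"
  shows "ualg_hom K U B (induced E)"
    and "x \<in> carrier P \<Longrightarrow> induced E (UL_l K P x) = E (left_gen K P x)"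
    and "x \<in> carrier P \<Longrightarrow> induced E (UL_r K P x) = E (right_gen K P x)"
proof -
  interpret E: unital_alg_hom K T B E by (rule E)
  let ?l = "left_gen K P" and ?r = "right_gen K P"
  have kills: "E x = \<zero>\<^bsub>B\<^esub>" if "x \<in> UL_ideal K P" for x
    using _ that unfolding UL_ideal_eq
  proof (rule E.kills_genideal)
    fix z assume "z \<in> UL_rels"
    then obtain x y where xy: "x \<in> carrier P" "y \<in> carrier P" and
      z: "z = ?r (x \<otimes>\<^bsub>P\<^esub> y) \<ominus>\<^bsub>T\<^esub> (?r x \<otimes>\<^bsub>T\<^esub> ?r y \<ominus>\<^bsub>T\<^esub> ?r y \<otimes>\<^bsub>T\<^esub> ?r x)
        \<or> z = ?l (x \<otimes>\<^bsub>P\<^esub> y) \<ominus>\<^bsub>T\<^esub> (?l x \<otimes>\<^bsub>T\<^esub> ?r y \<ominus>\<^bsub>T\<^esub> ?r y \<otimes>\<^bsub>T\<^esub> ?l x)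
        \<or> z = (?r y \<oplus>\<^bsub>T\<^esub> ?l y) \<otimes>\<^bsub>T\<^esub> ?l x"
      by blast
    have cl: "?l x \<in> carrier T" "?l y \<in> carrier T" "?r x \<in> carrier T" "?r y \<in> carrier T"
      "?l (x \<otimes>\<^bsub>P\<^esub> y) \<in> carrier T" "?r (x \<otimes>\<^bsub>P\<^esub> y) \<in> carrier T"
      using xy by (auto intro: gens_closed bracket_closed)
    have d: "E (?r (x \<otimes>\<^bsub>P\<^esub> y)) = E (?r x) \<otimes>\<^bsub>B\<^esub> E (?r y) \<ominus>\<^bsub>B\<^esub> E (?r y) \<otimes>\<^bsub>B\<^esub> E (?r x)"
      "E (?l (x \<otimes>\<^bsub>P\<^esub> y)) = E (?l x) \<otimes>\<^bsub>B\<^esub> E (?r y) \<ominus>\<^bsub>B\<^esub> E (?r y) \<otimes>\<^bsub>B\<^esub> E (?l x)"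
      "(E (?r y) \<oplus>\<^bsub>B\<^esub> E (?l y)) \<otimes>\<^bsub>B\<^esub> E (?l x) = \<zero>\<^bsub>B\<^esub>"
      using data xy unfolding UL_data_def by blast+
    from z show "z \<in> carrier T \<and> E z = \<zero>\<^bsub>B\<^esub>"
      using cl d E.hom_closed
      by (auto simp: E.hom_minus E.hom_mult E.hom_add E.cod.A.minus_eq_zero_iff
          E.cod.A.minus_closed)
  qed
  show "ualg_hom K U B (induced E)"
    unfolding UL_def by (rule UI.induced_hom[OF E kills])
  show "induced E (UL_l K P x) = E (left_gen K P x)" "induced E (UL_r K P x) = E (right_gen K P x)"
    if "x \<in> carrier P"
    unfolding UL_l_def UL_r_def
    by (rule UI.induced_coset[OF E kills gens_closed(1)[OF that]]
        UI.induced_coset[OF E kills gens_closed(2)[OF that]], assumption)+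
qed

theorem UL_universal:
  assumes B: "unital_algebra K B" and data: "UL_data K P B l r"
  obtains h where "ualg_hom K U B h"
    "\<And>x. x \<in> carrier P \<Longrightarrow> h (UL_l K P x) = l x" "\<And>x. x \<in> carrier P \<Longrightarrow> h (UL_r K P x) = r x"
proof -
  interpret B: unital_algebra K B by (rule B)
  have lr: "linear_map K P B l" "linear_map K P B r"
    using data unfolding UL_data_def by auto
  note lr_zero = lr[THEN linear_map_zero[OF P.abelian_group_axioms B.A.abelian_group_axioms]]
  note lrD = linear_mapD[OF lr(1)] linear_mapD[OF lr(2)]
  \<comment> \<open>A linear map on the direct sum of the two copies is given by one on each:
    \<open>l\<close> on the left copy, \<open>r\<close> on the right one. It extends to the free
    algebra and then descends through the two quotients.\<close>
  define h where "h = (\<lambda>(x, y). l x \<oplus>\<^bsub>B\<^esub> r y)"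
  have h: "h (x, y) = l x \<oplus>\<^bsub>B\<^esub> r y" for x y
    by (simp add: h_def)
  have lin: "linear_map K D B h"
    unfolding h_def by (rule linear_mapI) (auto simp: double_simps lrD B.smult_r_distr B.A.a_ac)
  interpret E: free_alg_ext K "carrier D" B h
    by unfold_locales (rule linear_mapD(1)[OF lin])
  let ?E = "free_ext B K h"
  have E: "unital_alg_hom K F B ?E" "linear_map K D B (\<lambda>v. ?E (letter K v))"
    using E.free_ext_hom lin
    by (auto intro!: unital_alg_hom.intro F_unital_algebra B unital_alg_hom_axioms.intro linear_mapI
        simp: E.free_ext_letter double_closed linear_mapD[OF lin])
  let ?E1 = "induced ?E"
  have E1: "unital_alg_hom K T B ?E1"
    using tensor_lift(1)[OF E]
    by (auto intro!: unital_alg_hom.intro B unital_alg_hom_axioms.intro T.unital_algebra_axioms)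
  have val: "?E1 (left_gen K P x) = l x" "?E1 (right_gen K P x) = r x" if "x \<in> carrier P" for x
    using that by (simp_all add: left_gen_def right_gen_def tensor_lift(2)[OF E] double_simps
      E.free_ext_letter h lr_zero lrD)
  have data1: "UL_data K P B (\<lambda>x. ?E1 (left_gen K P x)) (\<lambda>x. ?E1 (right_gen K P x))"
    using data unfolding UL_data_def linear_map_def by (auto simp: val bracket_closed Pi_iff)
  show ?thesis
    using that[OF UL_lift(1)[OF E1 data1]] UL_lift(2,3)[OF E1 data1] val by simp
qed

text \<open>The left and right generators generate UL(P) as a unital algebra: every element is the
  class of a combination of words, and the letter \<open>(x, y)\<close> goes to the sum of
  \<open>UL_l K P x\<close> and \<open>UL_r K P y\<close>.\<close>

lemma UL_induct [consumes 1, case_names one l r add mult smult]: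
  assumes z: "z \<in> carrier U"
    and one: "Q \<one>\<^bsub>U\<^esub>"
    and l: "\<And>x. x \<in> carrier P \<Longrightarrow> Q (UL_l K P x)" and r: "\<And>x. x \<in> carrier P \<Longrightarrow> Q (UL_r K P x)"
    and add: "\<And>a b. a \<in> carrier U \<Longrightarrow> b \<in> carrier U \<Longrightarrow> Q a \<Longrightarrow> Q b \<Longrightarrow> Q (a \<oplus>\<^bsub>U\<^esub> b)"
    and mult: "\<And>a b. a \<in> carrier U \<Longrightarrow> b \<in> carrier U \<Longrightarrow> Q a \<Longrightarrow> Q b \<Longrightarrow> Q (a \<otimes>\<^bsub>U\<^esub> b)"
    and smult: "\<And>k a. k \<in> carrier K \<Longrightarrow> a \<in> carrier U \<Longrightarrow> Q a \<Longrightarrow> Q (k \<odot>\<^bsub>U\<^esub> a)"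
  shows "Q z"
proof -
  let ?p = "\<lambda>f. UL_ideal K P +>\<^bsub>T\<^esub> (tensor_ideal K D +>\<^bsub>F\<^esub> f)"
  have p: "ualg_hom K F U ?p"
    by (rule ualg_hom_comp[OF tensor_proj_hom UL_proj_hom])
  note pD = ualg_homD[OF p]
  obtain f where f: "f \<in> carrier F" "z = ?p f"
    using z unfolding UL_def UI.carrier_quot
    by (auto simp: tensor_algebra_def TI.carrier_quot)
  have letter: "Q (?p (letter K v))" if "v \<in> carrier D" for v
  proof -
    have "v \<in> carrier P \<times> carrier P" using that by (simp add: double_simps)
    then obtain x y where v: "v = (x, y)" "x \<in> carrier P" "y \<in> carrier P" by (rule SigmaE)
    have "tensor_incl K D v = left_gen K P x \<oplus>\<^bsub>T\<^esub> right_gen K P y"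
      using linear_mapD(2)[OF tensor_incl_linear, of "(x, \<zero>\<^bsub>P\<^esub>)" "(\<zero>\<^bsub>P\<^esub>, y)"] v
      by (simp add: left_gen_def right_gen_def double_simps)
    then have "?p (letter K v) = UL_l K P x \<oplus>\<^bsub>U\<^esub> UL_r K P y"
      using ualg_homD(2)[OF UL_proj_hom] v
      by (simp add: tensor_incl_def UL_l_def UL_r_def gens_closed)
    then show ?thesis using v by (simp add: add l r UL_gens_closed)
  qed
  have Q_word: "Q (?p (word K w))" if "w \<in> lists (carrier D)" for w
    using that
  proof (induction w)
    case Nil
    then show ?case using pD(5) one by (simp add: F_ops(5))
  next
    case (Cons v w)
    then have "?p (word K (v # w)) = ?p (letter K v) \<otimes>\<^bsub>U\<^esub> ?p (word K w)"
      using pD(4)[of "word K [v]" "word K w"]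
      by (simp add: letter_word word_mult_word word_closed)
    then show ?case
      using Cons by (simp add: mult letter pD(1) letter_closed word_closed)
  qed
  have "Q (?p f)"
    using f(1)
  proof (induction f rule: free_induct)
    case (word k w)
    then show ?case
      using Q_word by (simp add: pD(1,3) smult word_closed)
  next
    case (add f g)
    then show ?case using assms(5) by (simp add: pD(1,2))
  qed
  then show ?thesis by (simp add: f)
qed

end

section \<open>Functoriality of tensor algebras and enveloping algebras\<close>

lemma tensor_map_hom:
  assumes P: "bracket_module K P" and P': "bracket_module K P'" and g: "linear_map K (double P) (double P') g"
  shows "ualg_hom K (tensor_algebra K (double P)) (tensor_algebra K (double P'))
      (tensor_map K (double P') g)"
    and "v \<in> carrier (double P) \<Longrightarrow>
      tensor_map K (double P') g (tensor_incl K (double P) v) = tensor_incl K (double P') (g v)"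
proof -
  interpret P: bracket_module K P by fact
  interpret P': bracket_module K P' by fact
  note gD = linear_mapD[OF g]
  interpret E: free_alg_ext K "carrier P.D" P'.F "\<lambda>v. letter K (g v)"
    by unfold_locales (simp add: gD P'.letter_closed)
  let ?E = "\<lambda>f. tensor_ideal K P'.D +>\<^bsub>P'.F\<^esub> free_map K g f"
  have eq: "?E f = tensor_ideal K P'.D +>\<^bsub>P'.F\<^esub> free_ext P'.F K (\<lambda>v. letter K (g v)) f"
    if "f \<in> carrier P.F" for f
    using free_map_eq_ext[OF P.cring_K _ that, of g "carrier P'.D"] gD(1) by simp
  have "ualg_hom K P.F P'.T ?E"
    using P.F.ualg_hom_cong[OF ualg_hom_comp[OF E.free_ext_hom P'.tensor_proj_hom]] eq by simp
  then have E: "unital_alg_hom K P.F P'.T ?E"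
    by (intro unital_alg_hom.intro unital_alg_hom_axioms.intro P.F_unital_algebra
        P'.T.unital_algebra_axioms)
  have letter: "?E (letter K v) = tensor_incl K P'.D (g v)" if "v \<in> carrier P.D" for v
    using that eq[OF P.letter_closed[OF that]] by (simp add: E.free_ext_letter tensor_incl_def)
  have lin: "linear_map K P.D P'.T (\<lambda>v. ?E (letter K v))"
    using linear_map_comp[OF g P'.tensor_incl_linear]
    unfolding linear_map_def by (auto simp: letter P.double_closed Pi_iff)
  show "ualg_hom K P.T P'.T (tensor_map K P'.D g)"
    unfolding tensor_map_def by (rule P.tensor_lift(1)[OF E lin])
  show "tensor_map K P'.D g (tensor_incl K P.D v) = tensor_incl K P'.D (g v)" if "v \<in> carrier P.D"
    unfolding tensor_map_def using P.tensor_lift(2)[OF E lin that] letter[OF that] by simp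
qed

lemma UL_map:
  assumes P: "bracket_module K P" and P': "bracket_module K P'" and f: "alg_hom K P P' f"
  shows UL_map_hom: "ualg_hom K (UL K P) (UL K P') (UL_map K P' f)"
    and UL_map_l: "x \<in> carrier P \<Longrightarrow> UL_map K P' f (UL_l K P x) = UL_l K P' (f x)"
    and UL_map_r: "x \<in> carrier P \<Longrightarrow> UL_map K P' f (UL_r K P x) = UL_r K P' (f x)"
proof -
  interpret P: bracket_module K P by fact
  interpret P': bracket_module K P' by fact
  have f_lin: "linear_map K P P' f" and
    f_mult: "\<And>x y. x \<in> carrier P \<Longrightarrow> y \<in> carrier P \<Longrightarrow> f (x \<otimes>\<^bsub>P\<^esub> y) = f x \<otimes>\<^bsub>P'\<^esub> f y"
    using f unfolding alg_hom_def by auto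
  note fD = linear_mapD[OF f_lin]
  have f_zero: "f \<zero>\<^bsub>P\<^esub> = \<zero>\<^bsub>P'\<^esub>"
    by (rule linear_map_zero[OF P.P.abelian_group_axioms P'.P.abelian_group_axioms f_lin])
  have g: "linear_map K P.D P'.D (map_prod f f)"
    by (rule linear_mapI) (auto simp: P.double_simps P'.double_simps fD)
  let ?t = "tensor_map K P'.D (map_prod f f)"
  let ?E = "\<lambda>z. UL_ideal K P' +>\<^bsub>P'.T\<^esub> ?t z"
  have "ualg_hom K P.T P'.U ?E"
    by (rule ualg_hom_comp[OF tensor_map_hom(1)[OF P P' g] P'.UL_proj_hom])
  then have E: "unital_alg_hom K P.T P'.U ?E"
    by (intro unital_alg_hom.intro unital_alg_hom_axioms.intro P.T.unital_algebra_axioms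
        P'.U.unital_algebra_axioms)
  have val: "?E (left_gen K P x) = UL_l K P' (f x)" "?E (right_gen K P x) = UL_r K P' (f x)"
    if "x \<in> carrier P" for x
    using that by (simp_all add: left_gen_def right_gen_def UL_l_def UL_r_def f_zero
        tensor_map_hom(2)[OF P P' g] P.double_simps)
  have data: "UL_data K P P'.U (\<lambda>x. ?E (left_gen K P x)) (\<lambda>x. ?E (right_gen K P x))"
    using P'.UL_gens_data fD f_mult
    unfolding UL_data_def linear_map_def by (auto simp: val P.bracket_closed Pi_iff)
  show "ualg_hom K (UL K P) (UL K P') (UL_map K P' f)"
    unfolding UL_map_def by (rule P.UL_lift(1)[OF E data])
  show "UL_map K P' f (UL_l K P x) = UL_l K P' (f x)" "UL_map K P' f (UL_r K P x) = UL_r K P' (f x)"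
    if "x \<in> carrier P"
    unfolding UL_map_def using P.UL_lift(2,3)[OF E data that] val[OF that] by simp_all
qed

text \<open>The uniqueness half of the universal property. It serves for the section identities
  \<open>SI\<close> and \<open>TI\<close> and for the source and target of maps into semidirect
  products.\<close>

lemma (in bracket_module) UL_hom_eq:
  assumes g: "ualg_hom K U B g" and h: "ualg_hom K U B h"
    and "\<And>x. x \<in> carrier P \<Longrightarrow> g (UL_l K P x) = h (UL_l K P x)"
    and "\<And>x. x \<in> carrier P \<Longrightarrow> g (UL_r K P x) = h (UL_r K P x)"
    and "z \<in> carrier U"
  shows "g z = h z"
  using assms(5)
  by (induction z rule: UL_induct) (simp_all add: assms(3,4) ualg_homD[OF g] ualg_homD[OF h])

section \<open>Crossed modules of unital algebras\<close>

lemma kernel_assoc_algebra: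
  assumes "unital_alg_hom K A B s"
  shows "assoc_algebra K (A\<lparr>carrier := a_kernel A B s\<rparr>)"
proof -
  interpret s: unital_alg_hom K A B s by fact
  let ?N = "A\<lparr>carrier := a_kernel A B s\<rparr>"
  have "abelian_group ?N"
  proof (rule abelian_groupI)
    show "\<exists>y\<in>carrier ?N. y \<oplus>\<^bsub>?N\<^esub> x = \<zero>\<^bsub>?N\<^esub>" if "x \<in> carrier ?N" for x
      using that linear_map_uminus[OF s.dom.A.abelian_group_axioms s.cod.A.abelian_group_axioms s.hom_linear]
      by (intro bexI[of _ "\<ominus>\<^bsub>A\<^esub> x"]) (auto simp: a_kernel_iff s.dom.A.l_neg)
  qed (use s.hom_zero in \<open>auto simp: a_kernel_iff s.hom_add s.dom.A.a_ac\<close>)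
  then have "module K ?N"
    by (intro moduleI s.dom.R.cring_axioms)
      (auto simp: a_kernel_iff s.hom_smult s.dom.smult_l_distr s.dom.smult_r_distr s.dom.smult_assoc1)
  then show ?thesis
    unfolding assoc_algebra_def bilinear_map_def
    by (auto simp: a_kernel_iff s.hom_mult s.hom_closed s.dom.A.l_distr s.dom.A.r_distr s.dom.A.m_assoc
        s.dom.smult_mult_l s.dom.smult_mult_r intro!: linear_mapI)
qed

text \<open>Multiplying the kernel condition with \<open>x - i (t x) \<in> Ker t\<close> gives the Peiffer identity.\<close>

lemma cat1_peiffer:
  assumes s: "unital_alg_hom K A B s" and t: "unital_alg_hom K A B t"
    and i: "unital_alg_hom K B A i"
    and ti: "\<And>a. a \<in> carrier B \<Longrightarrow> t (i a) = a"
    and ker: "\<And>x y. x \<in> carrier A \<Longrightarrow> y \<in> carrier A \<Longrightarrow> s x = \<zero>\<^bsub>B\<^esub> \<Longrightarrow> t y = \<zero>\<^bsub>B\<^esub> \<Longrightarrow>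
        x \<otimes>\<^bsub>A\<^esub> y = \<zero>\<^bsub>A\<^esub> \<and> y \<otimes>\<^bsub>A\<^esub> x = \<zero>\<^bsub>A\<^esub>"
    and b: "b \<in> carrier A" "s b = \<zero>\<^bsub>B\<^esub>" and x: "x \<in> carrier A"
  shows "i (t x) \<otimes>\<^bsub>A\<^esub> b = x \<otimes>\<^bsub>A\<^esub> b" "b \<otimes>\<^bsub>A\<^esub> x = b \<otimes>\<^bsub>A\<^esub> i (t x)"
proof -
  interpret s: unital_alg_hom K A B s by fact
  interpret t: unital_alg_hom K A B t by fact
  interpret i: unital_alg_hom K B A i by fact
  have c: "i (t x) \<in> carrier A" using x by (simp add: i.hom_closed t.hom_closed)
  have "t (x \<ominus>\<^bsub>A\<^esub> i (t x)) = \<zero>\<^bsub>B\<^esub>"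
    using x c by (simp add: t.hom_minus ti t.hom_closed s.cod.A.minus_eq_zero_iff)
  then have k: "(x \<ominus>\<^bsub>A\<^esub> i (t x)) \<otimes>\<^bsub>A\<^esub> b = \<zero>\<^bsub>A\<^esub>" "b \<otimes>\<^bsub>A\<^esub> (x \<ominus>\<^bsub>A\<^esub> i (t x)) = \<zero>\<^bsub>A\<^esub>"
    using ker[of b "x \<ominus>\<^bsub>A\<^esub> i (t x)"] x c b by simp_all
  have "x \<otimes>\<^bsub>A\<^esub> b \<ominus>\<^bsub>A\<^esub> i (t x) \<otimes>\<^bsub>A\<^esub> b = \<zero>\<^bsub>A\<^esub>"
    using k(1) x c b by (simp add: a_minus_def s.dom.A.l_distr s.dom.A.l_minus)
  then show "i (t x) \<otimes>\<^bsub>A\<^esub> b = x \<otimes>\<^bsub>A\<^esub> b"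
    using x c b by (simp add: s.dom.A.minus_eq_zero_iff)
  have "b \<otimes>\<^bsub>A\<^esub> x \<ominus>\<^bsub>A\<^esub> b \<otimes>\<^bsub>A\<^esub> i (t x) = \<zero>\<^bsub>A\<^esub>"
    using k(2) x c b by (simp add: a_minus_def s.dom.A.r_distr s.dom.A.r_minus)
  then show "b \<otimes>\<^bsub>A\<^esub> x = b \<otimes>\<^bsub>A\<^esub> i (t x)"
    using x c b by (simp add: s.dom.A.minus_eq_zero_iff)
qed

text \<open>The passage from a cat1-algebra to a crossed module: the top is the kernel of
  \<open>s\<close>, the boundary is \<open>t\<close>, and the base acts by multiplication through
  the section \<open>i\<close>. The bimodule laws are associativity in \<open>A\<close>; the Peiffer
  laws are where the mutual annihilation of the kernels enters.\<close>

lemma cat1_crossed_module: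
  assumes s: "unital_alg_hom K A B s" and t: "unital_alg_hom K A B t"
    and i: "unital_alg_hom K B A i"
    and si: "\<And>a. a \<in> carrier B \<Longrightarrow> s (i a) = a" and ti: "\<And>a. a \<in> carrier B \<Longrightarrow> t (i a) = a"
    and ker: "\<And>x y. x \<in> carrier A \<Longrightarrow> y \<in> carrier A \<Longrightarrow> s x = \<zero>\<^bsub>B\<^esub> \<Longrightarrow> t y = \<zero>\<^bsub>B\<^esub> \<Longrightarrow>
        x \<otimes>\<^bsub>A\<^esub> y = \<zero>\<^bsub>A\<^esub> \<and> y \<otimes>\<^bsub>A\<^esub> x = \<zero>\<^bsub>A\<^esub>"
  shows "alg_crossed_module K \<lparr>Top = A\<lparr>carrier := a_kernel A B s\<rparr>, Base = B, bdry = t,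
      lact = (\<lambda>a b. i a \<otimes>\<^bsub>A\<^esub> b), ract = (\<lambda>b a. b \<otimes>\<^bsub>A\<^esub> i a)\<rparr>"
proof -
  interpret s: unital_alg_hom K A B s by fact
  interpret t: unital_alg_hom K A B t by fact
  interpret i: unital_alg_hom K B A i by fact
  note simps = a_kernel_iff s.hom_mult s.hom_closed t.hom_mult t.hom_closed i.hom_closed i.hom_mult
    i.hom_add i.hom_smult t.hom_add t.hom_smult si ti
    s.dom.A.l_distr s.dom.A.r_distr s.dom.A.m_assoc s.dom.smult_mult_l s.dom.smult_mult_r
  let ?N = "A\<lparr>carrier := a_kernel A B s\<rparr>"
  have act: "alg_action K B ?N (\<lambda>a b. i a \<otimes>\<^bsub>A\<^esub> b) (\<lambda>b a. b \<otimes>\<^bsub>A\<^esub> i a)"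
    unfolding alg_action_def bilinear_map_def by (auto simp: simps intro!: linear_mapI)
  have hom: "alg_hom K ?N B t"
    by (auto simp: alg_hom_def simps intro!: linear_mapI)
  have peiffer: "\<forall>b\<in>carrier ?N. \<forall>b'\<in>carrier ?N.
      i (t b) \<otimes>\<^bsub>A\<^esub> b' = b \<otimes>\<^bsub>?N\<^esub> b' \<and> b \<otimes>\<^bsub>?N\<^esub> b' = b \<otimes>\<^bsub>A\<^esub> i (t b')"
    by (auto simp: a_kernel_iff intro!: cat1_peiffer[OF s t i ti ker])
  show ?thesis
    unfolding alg_crossed_module_def xmod.simps
    by (intro conjI kernel_assoc_algebra[OF s] s.cod.assoc_algebra act hom peiffer)
      (auto simp: simps)
qed

section \<open>Crossed modules with unital base and their semidirect products\<close>

locale unital_xmod = Base: unital_algebra K "Base Y"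
  for K :: "'k ring" and Y :: "('k, 'b, 'a) xmod" +
  assumes xmod: "alg_crossed_module K Y"
    and lact_one: "b \<in> carrier (Top Y) \<Longrightarrow> lact Y \<one>\<^bsub>Base Y\<^esub> b = b"
    and ract_one: "b \<in> carrier (Top Y) \<Longrightarrow> ract Y b \<one>\<^bsub>Base Y\<^esub> = b"
begin

abbreviation A where "A \<equiv> Base Y"
abbreviation B where "B \<equiv> Top Y"

lemma top_algebra: "assoc_algebra K B"
  using xmod unfolding alg_crossed_module_def by blast

sublocale Top: module K B
  using top_algebra unfolding assoc_algebra_def by blast

lemma lact_linear:
  "a \<in> carrier A \<Longrightarrow> linear_map K B B (lact Y a)"
  "b \<in> carrier B \<Longrightarrow> linear_map K A B (\<lambda>a. lact Y a b)"
  using xmod unfolding alg_crossed_module_def alg_action_def bilinear_map_def by auto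

lemma ract_linear:
  "b \<in> carrier B \<Longrightarrow> linear_map K A B (ract Y b)"
  "a \<in> carrier A \<Longrightarrow> linear_map K B B (\<lambda>b. ract Y b a)"
  using xmod unfolding alg_crossed_module_def alg_action_def bilinear_map_def by auto

lemma top_mult_linear:
  "b \<in> carrier B \<Longrightarrow> linear_map K B B (\<lambda>b'. b \<otimes>\<^bsub>B\<^esub> b')"
  "b' \<in> carrier B \<Longrightarrow> linear_map K B B (\<lambda>b. b \<otimes>\<^bsub>B\<^esub> b')"
  using top_algebra unfolding assoc_algebra_def bilinear_map_def by auto

lemma bdry_hom: "alg_hom K B A (bdry Y)"
  using xmod unfolding alg_crossed_module_def by blast

lemma bdry_linear: "linear_map K B A (bdry Y)"
  using bdry_hom unfolding alg_hom_def by blast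

lemmas top_closed = linear_mapD(1)[OF lact_linear(1)] linear_mapD(1)[OF ract_linear(1)]
  linear_mapD(1)[OF top_mult_linear(1)] linear_mapD(1)[OF bdry_linear]

lemmas top_add = linear_mapD(2)[OF lact_linear(1)] linear_mapD(2)[OF lact_linear(2)]
  linear_mapD(2)[OF ract_linear(1)] linear_mapD(2)[OF ract_linear(2)]
  linear_mapD(2)[OF top_mult_linear(1)] linear_mapD(2)[OF top_mult_linear(2)]
  linear_mapD(2)[OF bdry_linear]

lemmas top_smult = linear_mapD(3)[OF lact_linear(1)] linear_mapD(3)[OF lact_linear(2)]
  linear_mapD(3)[OF ract_linear(1)] linear_mapD(3)[OF ract_linear(2)]
  linear_mapD(3)[OF top_mult_linear(1)] linear_mapD(3)[OF top_mult_linear(2)]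
  linear_mapD(3)[OF bdry_linear]

lemmas top_zero =
  linear_map_zero[OF Top.abelian_group_axioms Top.abelian_group_axioms lact_linear(1)]
  linear_map_zero[OF Base.A.abelian_group_axioms Top.abelian_group_axioms lact_linear(2)]
  linear_map_zero[OF Base.A.abelian_group_axioms Top.abelian_group_axioms ract_linear(1)]
  linear_map_zero[OF Top.abelian_group_axioms Top.abelian_group_axioms ract_linear(2)]
  linear_map_zero[OF Top.abelian_group_axioms Top.abelian_group_axioms top_mult_linear(1)]
  linear_map_zero[OF Top.abelian_group_axioms Top.abelian_group_axioms top_mult_linear(2)]
  linear_map_zero[OF Top.abelian_group_axioms Base.A.abelian_group_axioms bdry_linear]

lemma top_assoc:
  "\<lbrakk>b \<in> carrier B; b' \<in> carrier B; b'' \<in> carrier B\<rbrakk>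
    \<Longrightarrow> (b \<otimes>\<^bsub>B\<^esub> b') \<otimes>\<^bsub>B\<^esub> b'' = b \<otimes>\<^bsub>B\<^esub> (b' \<otimes>\<^bsub>B\<^esub> b'')"
  using top_algebra unfolding assoc_algebra_def by blast

lemma act_assoc:
  "\<lbrakk>a \<in> carrier A; a' \<in> carrier A; b \<in> carrier B\<rbrakk>
    \<Longrightarrow> lact Y (a \<otimes>\<^bsub>A\<^esub> a') b = lact Y a (lact Y a' b)"
  "\<lbrakk>a \<in> carrier A; a' \<in> carrier A; b \<in> carrier B\<rbrakk>
    \<Longrightarrow> ract Y (ract Y b a) a' = ract Y b (a \<otimes>\<^bsub>A\<^esub> a')"
  "\<lbrakk>a \<in> carrier A; a' \<in> carrier A; b \<in> carrier B\<rbrakk>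
    \<Longrightarrow> ract Y (lact Y a b) a' = lact Y a (ract Y b a')"
  "\<lbrakk>a \<in> carrier A; b \<in> carrier B; b' \<in> carrier B\<rbrakk>
    \<Longrightarrow> lact Y a (b \<otimes>\<^bsub>B\<^esub> b') = lact Y a b \<otimes>\<^bsub>B\<^esub> b'"
  "\<lbrakk>a \<in> carrier A; b \<in> carrier B; b' \<in> carrier B\<rbrakk>
    \<Longrightarrow> ract Y b a \<otimes>\<^bsub>B\<^esub> b' = b \<otimes>\<^bsub>B\<^esub> lact Y a b'"
  "\<lbrakk>a \<in> carrier A; b \<in> carrier B; b' \<in> carrier B\<rbrakk>
    \<Longrightarrow> ract Y (b \<otimes>\<^bsub>B\<^esub> b') a = b \<otimes>\<^bsub>B\<^esub> ract Y b' a"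
  using xmod unfolding alg_crossed_module_def alg_action_def by blast+

lemma bdry_act:
  "\<lbrakk>a \<in> carrier A; b \<in> carrier B\<rbrakk> \<Longrightarrow> bdry Y (lact Y a b) = a \<otimes>\<^bsub>A\<^esub> bdry Y b"
  "\<lbrakk>a \<in> carrier A; b \<in> carrier B\<rbrakk> \<Longrightarrow> bdry Y (ract Y b a) = bdry Y b \<otimes>\<^bsub>A\<^esub> a"
  "\<lbrakk>b \<in> carrier B; b' \<in> carrier B\<rbrakk> \<Longrightarrow> bdry Y (b \<otimes>\<^bsub>B\<^esub> b') = bdry Y b \<otimes>\<^bsub>A\<^esub> bdry Y b'"
  using xmod unfolding alg_crossed_module_def alg_hom_def by blast+

lemma peiffer:
  "\<lbrakk>b \<in> carrier B; b' \<in> carrier B\<rbrakk> \<Longrightarrow> lact Y (bdry Y b) b' = b \<otimes>\<^bsub>B\<^esub> b'"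
  "\<lbrakk>b \<in> carrier B; b' \<in> carrier B\<rbrakk> \<Longrightarrow> ract Y b (bdry Y b') = b \<otimes>\<^bsub>B\<^esub> b'"
  using xmod unfolding alg_crossed_module_def by metis+

text \<open>The formula in \<open>semidirect\<close> involves only multiplications and actions, so
  it also yields the semidirect product of algebras. It leaves the unit undefined;
  \<open>(0, 1)\<close> is a unit because the unit of the base acts as the identity.\<close>

definition SD :: "('k, 'b \<times> 'a) module" where
  "SD = (semidirect Y)\<lparr>one := (\<zero>\<^bsub>B\<^esub>, \<one>\<^bsub>A\<^esub>)\<rparr>"

lemma SD_simps:
  "carrier SD = carrier B \<times> carrier A"
  "(b, a) \<oplus>\<^bsub>SD\<^esub> (b', a') = (b \<oplus>\<^bsub>B\<^esub> b', a \<oplus>\<^bsub>A\<^esub> a')"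
  "k \<odot>\<^bsub>SD\<^esub> (b, a) = (k \<odot>\<^bsub>B\<^esub> b, k \<odot>\<^bsub>A\<^esub> a)"
  "(b, a) \<otimes>\<^bsub>SD\<^esub> (b', a')
    = (b \<otimes>\<^bsub>B\<^esub> b' \<oplus>\<^bsub>B\<^esub> lact Y a b' \<oplus>\<^bsub>B\<^esub> ract Y b a', a \<otimes>\<^bsub>A\<^esub> a')"
  "\<one>\<^bsub>SD\<^esub> = (\<zero>\<^bsub>B\<^esub>, \<one>\<^bsub>A\<^esub>)" "\<zero>\<^bsub>SD\<^esub> = (\<zero>\<^bsub>B\<^esub>, \<zero>\<^bsub>A\<^esub>)"
  by (simp_all add: SD_def semidirect_def Let_def)

lemma SD_unital_algebra: "unital_algebra K SD"
proof -
  have ab: "abelian_group SD"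
  proof (rule abelian_groupI)
    show "\<exists>y\<in>carrier SD. y \<oplus>\<^bsub>SD\<^esub> x = \<zero>\<^bsub>SD\<^esub>" if "x \<in> carrier SD" for x
      using that by (intro bexI[of _ "(\<ominus>\<^bsub>B\<^esub> fst x, \<ominus>\<^bsub>A\<^esub> snd x)"])
        (auto simp: SD_simps Top.M.l_neg Base.A.l_neg)
  qed (auto simp: SD_simps Top.M.a_ac Base.A.a_ac)
  have mon: "Group.monoid SD"
    by (rule monoidI) (auto simp: SD_simps top_closed top_add top_zero top_assoc act_assoc
        lact_one ract_one Base.A.m_assoc Top.M.a_ac)
  have "ring SD"
    by (rule ringI[OF ab mon]) (auto simp: SD_simps top_closed top_add Top.M.a_ac Base.A.l_distr Base.A.r_distr)
  with ab show ?thesis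
    by (intro unital_algebra.intro moduleI unital_algebra_axioms.intro Base.R.cring_axioms)
      (auto simp: SD_simps top_closed top_smult Top.smult_l_distr Top.smult_r_distr
        Top.smult_assoc1 Base.smult_l_distr Base.smult_r_distr Base.smult_assoc1
        Base.smult_mult_l Base.smult_mult_r)
qed

sublocale SD: unital_algebra K SD by (rule SD_unital_algebra)

text \<open>Source, target and section of the semidirect product. The product of two targets expands
  into four terms, three of which are boundaries by \<open>bdry_act\<close>.\<close>

lemma SD_homs:
  "ualg_hom K SD A snd"
  "ualg_hom K SD A (\<lambda>x. bdry Y (fst x) \<oplus>\<^bsub>A\<^esub> snd x)"
  "ualg_hom K A SD (\<lambda>a. (\<zero>\<^bsub>B\<^esub>, a))"
  by (intro ualg_homI linear_mapI;
      auto simp: SD_simps top_closed top_add top_smult top_zero bdry_act Base.A.a_ac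
        Base.smult_r_distr Base.A.l_distr Base.A.r_distr)+

end

section \<open>The universal enveloping crossed module\<close>

locale leibniz_xmod =
  fixes K :: "'k ring" and X :: "('k, 'q, 'p) xmod"
  assumes cring_K: "cring K" and leibniz_xmod: "leibniz_crossed_module K X"
begin

abbreviation P where "P \<equiv> Base X"
abbreviation Q where "Q \<equiv> Top X"
abbreviation G where "G \<equiv> semidirect X"
abbreviation \<eta> where "\<eta> \<equiv> bdry X"
abbreviation UP where "UP \<equiv> UL K P"
abbreviation UG where "UG \<equiv> UL K G"

lemma bracket_linear:
  "p \<in> carrier P \<Longrightarrow> linear_map K P P (\<lambda>p'. p \<otimes>\<^bsub>P\<^esub> p')"
  "p' \<in> carrier P \<Longrightarrow> linear_map K P P (\<lambda>p. p \<otimes>\<^bsub>P\<^esub> p')"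
  "q \<in> carrier Q \<Longrightarrow> linear_map K Q Q (\<lambda>q'. q \<otimes>\<^bsub>Q\<^esub> q')"
  "q' \<in> carrier Q \<Longrightarrow> linear_map K Q Q (\<lambda>q. q \<otimes>\<^bsub>Q\<^esub> q')"
  "p \<in> carrier P \<Longrightarrow> linear_map K Q Q (lact X p)"
  "q \<in> carrier Q \<Longrightarrow> linear_map K P Q (\<lambda>p. lact X p q)"
  "q \<in> carrier Q \<Longrightarrow> linear_map K P Q (ract X q)"
  "p \<in> carrier P \<Longrightarrow> linear_map K Q Q (\<lambda>q. ract X q p)"
  "linear_map K Q P \<eta>"
  using leibniz_xmod unfolding leibniz_crossed_module_def leibniz_algebra_def bilinear_map_def
    leibniz_action_def alg_hom_def by auto

sublocale P: bracket_module K P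
  using leibniz_xmod linear_mapD(1)[OF bracket_linear(1)]
  unfolding leibniz_crossed_module_def leibniz_algebra_def
  by (intro bracket_module.intro bracket_module_axioms.intro) blast+

sublocale Q: module K Q
  using leibniz_xmod unfolding leibniz_crossed_module_def leibniz_algebra_def by blast

lemmas bracket_add = bracket_linear[THEN linear_mapD(2)]

lemmas xmod_closed = linear_mapD(1)[OF bracket_linear(3)] linear_mapD(1)[OF bracket_linear(5)]
  linear_mapD(1)[OF bracket_linear(7)] linear_mapD(1)[OF bracket_linear(9)]

lemmas xmod_zero =
  linear_map_zero[OF P.P.abelian_group_axioms P.P.abelian_group_axioms bracket_linear(1)]
  linear_map_zero[OF P.P.abelian_group_axioms P.P.abelian_group_axioms bracket_linear(2)]
  linear_map_zero[OF Q.abelian_group_axioms Q.abelian_group_axioms bracket_linear(3)]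
  linear_map_zero[OF Q.abelian_group_axioms Q.abelian_group_axioms bracket_linear(4)]
  linear_map_zero[OF Q.abelian_group_axioms Q.abelian_group_axioms bracket_linear(5)]
  linear_map_zero[OF P.P.abelian_group_axioms Q.abelian_group_axioms bracket_linear(6)]
  linear_map_zero[OF P.P.abelian_group_axioms Q.abelian_group_axioms bracket_linear(7)]
  linear_map_zero[OF Q.abelian_group_axioms Q.abelian_group_axioms bracket_linear(8)]
  linear_map_zero[OF Q.abelian_group_axioms P.P.abelian_group_axioms bracket_linear(9)]

lemma eta_act:
  "\<lbrakk>p \<in> carrier P; q \<in> carrier Q\<rbrakk> \<Longrightarrow> \<eta> (lact X p q) = p \<otimes>\<^bsub>P\<^esub> \<eta> q"
  "\<lbrakk>p \<in> carrier P; q \<in> carrier Q\<rbrakk> \<Longrightarrow> \<eta> (ract X q p) = \<eta> q \<otimes>\<^bsub>P\<^esub> p"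
  "\<lbrakk>q \<in> carrier Q; q' \<in> carrier Q\<rbrakk> \<Longrightarrow> \<eta> (q \<otimes>\<^bsub>Q\<^esub> q') = \<eta> q \<otimes>\<^bsub>P\<^esub> \<eta> q'"
  using leibniz_xmod unfolding leibniz_crossed_module_def alg_hom_def by blast+

lemma lact_eta: "\<lbrakk>q \<in> carrier Q; q' \<in> carrier Q\<rbrakk> \<Longrightarrow> lact X (\<eta> q) q' = q \<otimes>\<^bsub>Q\<^esub> q'"
  using leibniz_xmod unfolding leibniz_crossed_module_def by blast

lemma semidirect_simps:
  "carrier G = carrier Q \<times> carrier P"
  "(q, p) \<oplus>\<^bsub>G\<^esub> (q', p') = (q \<oplus>\<^bsub>Q\<^esub> q', p \<oplus>\<^bsub>P\<^esub> p')"
  "k \<odot>\<^bsub>G\<^esub> (q, p) = (k \<odot>\<^bsub>Q\<^esub> q, k \<odot>\<^bsub>P\<^esub> p)"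
  "(q, p) \<otimes>\<^bsub>G\<^esub> (q', p')
    = (q \<otimes>\<^bsub>Q\<^esub> q' \<oplus>\<^bsub>Q\<^esub> lact X p q' \<oplus>\<^bsub>Q\<^esub> ract X q p', p \<otimes>\<^bsub>P\<^esub> p')"
  "\<zero>\<^bsub>G\<^esub> = (\<zero>\<^bsub>Q\<^esub>, \<zero>\<^bsub>P\<^esub>)"
  by (simp_all add: semidirect_def Let_def)

sublocale G: bracket_module K G
proof (intro bracket_module.intro bracket_module_axioms.intro moduleI cring_K)
  show "abelian_group G"
  proof (rule abelian_groupI)
    show "\<exists>y\<in>carrier G. y \<oplus>\<^bsub>G\<^esub> x = \<zero>\<^bsub>G\<^esub>" if "x \<in> carrier G" for x
      using that by (intro bexI[of _ "(\<ominus>\<^bsub>Q\<^esub> fst x, \<ominus>\<^bsub>P\<^esub> snd x)"])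
        (auto simp: semidirect_simps Q.M.l_neg P.P.M.l_neg)
  qed (auto simp: semidirect_simps Q.M.a_ac P.P.M.a_ac)
qed (auto simp: semidirect_simps xmod_closed P.bracket_closed Q.smult_l_distr Q.smult_r_distr
    Q.smult_assoc1 P.P.smult_l_distr P.P.smult_r_distr P.P.smult_assoc1)

section \<open>Source, target and inclusion, and the maps they induce on enveloping algebras\<close>

definition inc :: "'p \<Rightarrow> 'q \<times> 'p" where
  "inc = (\<lambda>p. (\<zero>\<^bsub>Q\<^esub>, p))"

lemma src_hom: "alg_hom K G P (src X)"
  unfolding alg_hom_def src_def by (auto simp: semidirect_simps intro!: linear_mapI)

lemma tgt_hom: "alg_hom K G P (tgt X)"
  unfolding alg_hom_def tgt_def
  by (auto simp: semidirect_simps xmod_closed bracket_add eta_act P.bracket_closed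
      linear_mapD(3)[OF bracket_linear(9)] P.P.smult_r_distr P.P.M.a_ac intro!: linear_mapI)

lemma inc_hom: "alg_hom K P G inc"
  unfolding alg_hom_def inc_def
  by (auto simp: semidirect_simps xmod_zero P.bracket_closed intro!: linear_mapI)

abbreviation S where "S \<equiv> UL_map K P (src X)"
abbreviation T where "T \<equiv> UL_map K P (tgt X)"
abbreviation I where "I \<equiv> UL_map K G inc"

sublocale S: unital_alg_hom K "UG" "UP" S
  by (intro unital_alg_hom.intro G.U.unital_algebra_axioms P.U.unital_algebra_axioms
      unital_alg_hom_axioms.intro UL_map_hom G.bracket_module_axioms P.bracket_module_axioms src_hom)

sublocale T: unital_alg_hom K "UG" "UP" T
  by (intro unital_alg_hom.intro G.U.unital_algebra_axioms P.U.unital_algebra_axioms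
      unital_alg_hom_axioms.intro UL_map_hom G.bracket_module_axioms P.bracket_module_axioms tgt_hom)

sublocale I: unital_alg_hom K "UP" "UG" I
  by (intro unital_alg_hom.intro G.U.unital_algebra_axioms P.U.unital_algebra_axioms
      unital_alg_hom_axioms.intro UL_map_hom G.bracket_module_axioms P.bracket_module_axioms inc_hom)

lemmas UL_map_gens =
  UL_map_l[OF G.bracket_module_axioms P.bracket_module_axioms src_hom]
  UL_map_r[OF G.bracket_module_axioms P.bracket_module_axioms src_hom]
  UL_map_l[OF G.bracket_module_axioms P.bracket_module_axioms tgt_hom]
  UL_map_r[OF G.bracket_module_axioms P.bracket_module_axioms tgt_hom]
  UL_map_l[OF P.bracket_module_axioms G.bracket_module_axioms inc_hom]
  UL_map_r[OF P.bracket_module_axioms G.bracket_module_axioms inc_hom]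

lemma inc_simps:
  "p \<in> carrier P \<Longrightarrow> inc p \<in> carrier G" "src X (inc p) = p"
  "p \<in> carrier P \<Longrightarrow> tgt X (inc p) = p"
  by (auto simp: inc_def src_def tgt_def semidirect_simps xmod_zero)

lemma id_ualg_hom: "ualg_hom K A A (\<lambda>x. x)"
  by (auto intro!: ualg_homI linear_mapI)

lemma SI: "a \<in> carrier UP \<Longrightarrow> S (I a) = a"
  by (rule P.UL_hom_eq[OF ualg_hom_comp[OF I.hom S.hom] id_ualg_hom])
    (auto simp: UL_map_gens inc_simps)

lemma TI: "a \<in> carrier UP \<Longrightarrow> T (I a) = a"
  by (rule P.UL_hom_eq[OF ualg_hom_comp[OF I.hom T.hom] id_ualg_hom])
    (auto simp: UL_map_gens inc_simps)

lemma UL_kernel_eq: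
  "UL_kernel K X (src X) = a_kernel UG UP S"
  "UL_kernel K X (tgt X) = a_kernel UG UP T"
  by (simp_all add: UL_kernel_def)

lemma kernel_ideals: "ideal (UL_kernel K X (src X)) UG" "ideal (UL_kernel K X (tgt X)) UG"
  unfolding UL_kernel_eq by (rule S.kernel_ideal T.kernel_ideal)+

abbreviation KK where
  "KK \<equiv> ideal_prod UG (UL_kernel K X (src X)) (UL_kernel K X (tgt X))"
abbreviation KK' where
  "KK' \<equiv> ideal_prod UG (UL_kernel K X (tgt X)) (UL_kernel K X (src X))"

lemma KK_ideals: "ideal KK UG" "ideal KK' UG"
  by (intro G.U.A.ideal_prod_is_ideal kernel_ideals)+

lemma XUL_ideal_eq: "XUL_ideal K X = KK <+>\<^bsub>UG\<^esub> KK'"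
  by (simp add: XUL_ideal_def Let_def)

sublocale XI: alg_ideal K "UG" "XUL_ideal K X"
  unfolding XUL_ideal_eq
  by (intro alg_ideal.intro G.U.unital_algebra_axioms G.U.A.add_ideals KK_ideals)

lemma XUL_ideal_mem:
  assumes "x \<in> carrier UG" "y \<in> carrier UG"
    "S x = \<zero>\<^bsub>UP\<^esub>" "T y = \<zero>\<^bsub>UP\<^esub>"
  shows "x \<otimes>\<^bsub>UG\<^esub> y \<in> XUL_ideal K X" "y \<otimes>\<^bsub>UG\<^esub> x \<in> XUL_ideal K X"
proof -
  have xy: "x \<in> UL_kernel K X (src X)" "y \<in> UL_kernel K X (tgt X)"
    using assms by (simp_all add: UL_kernel_eq a_kernel_iff)
  have zero: "\<zero>\<^bsub>UG\<^esub> \<in> KK" "\<zero>\<^bsub>UG\<^esub> \<in> KK'"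
    using KK_ideals[THEN ideal.axioms(1)] additive_subgroup.zero_closed by blast+
  note prods = ideal_prod.prod[OF xy, of "UG"] ideal_prod.prod[OF xy(2,1), of "UG"]
  have sum: "a \<oplus>\<^bsub>UG\<^esub> b \<in> XUL_ideal K X" if "a \<in> KK" "b \<in> KK'" for a b
    unfolding XUL_ideal_eq set_add_defs
    by (rule UN_I[OF that(1)], rule UN_I[OF that(2)]) simp
  have "x \<otimes>\<^bsub>UG\<^esub> y \<oplus>\<^bsub>UG\<^esub> \<zero>\<^bsub>UG\<^esub> \<in> XUL_ideal K X"
    "\<zero>\<^bsub>UG\<^esub> \<oplus>\<^bsub>UG\<^esub> y \<otimes>\<^bsub>UG\<^esub> x \<in> XUL_ideal K X"
    by (rule sum[OF prods(1) zero(2)] sum[OF zero(1) prods(2)])+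
  then show "x \<otimes>\<^bsub>UG\<^esub> y \<in> XUL_ideal K X" "y \<otimes>\<^bsub>UG\<^esub> x \<in> XUL_ideal K X"
    using assms(1,2) by simp_all
qed

text \<open>An element of the ideal is a sum of products of one factor from \<open>Ker S\<close> and
  one from \<open>Ker T\<close>, in either order, so \<open>h\<close> only has to kill
  those.\<close>

lemma kills_XUL_ideal:
  assumes h: "unital_alg_hom K UG B h"
    and ker: "\<And>x y. x \<in> carrier UG \<Longrightarrow> y \<in> carrier UG \<Longrightarrow>
      S x = \<zero>\<^bsub>UP\<^esub> \<Longrightarrow> T y = \<zero>\<^bsub>UP\<^esub> \<Longrightarrow>
      h x \<otimes>\<^bsub>B\<^esub> h y = \<zero>\<^bsub>B\<^esub> \<and> h y \<otimes>\<^bsub>B\<^esub> h x = \<zero>\<^bsub>B\<^esub>"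
    and z: "z \<in> XUL_ideal K X"
  shows "h z = \<zero>\<^bsub>B\<^esub>"
proof -
  interpret h: unital_alg_hom K "UG" B h by (rule h)
  have "x \<in> carrier UG \<and> h x = \<zero>\<^bsub>B\<^esub>" if "x \<in> KK" for x
    using that
    by induction (auto simp: UL_kernel_eq a_kernel_iff h.hom_mult h.hom_add ker)
  moreover have "x \<in> carrier UG \<and> h x = \<zero>\<^bsub>B\<^esub>" if "x \<in> KK'" for x
    using that
    by induction (auto simp: UL_kernel_eq a_kernel_iff h.hom_mult h.hom_add ker)
  ultimately show ?thesis
    using z unfolding XUL_ideal_eq set_add_defs by (auto simp: h.hom_add)
qed

section \<open>The quotient by the products of the kernels, and its crossed module\<close>

abbreviation Ub where "Ub \<equiv> UL_bar K X"
abbreviation pr where "pr \<equiv> \<lambda>z. XUL_ideal K X +>\<^bsub>UG\<^esub> z"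
abbreviation Sb where "Sb \<equiv> UL_bar_map K X (src X)"
abbreviation Tb where "Tb \<equiv> UL_bar_map K X (tgt X)"
abbreviation Ib where "Ib \<equiv> UL_bar_incl K X"

sublocale Ub: unital_algebra K Ub
  unfolding UL_bar_def by (rule XI.quot_unital_algebra)

sublocale pr: unital_alg_hom K "UG" Ub pr
  by unfold_locales (unfold UL_bar_def, rule XI.quot_proj_hom)

lemma carrier_Ub: "carrier Ub = pr ` carrier UG"
  unfolding UL_bar_def by (rule XI.carrier_quot)

lemma S_kills: "z \<in> XUL_ideal K X \<Longrightarrow> S z = \<zero>\<^bsub>UP\<^esub>"
  by (rule kills_XUL_ideal[OF S.unital_alg_hom_axioms]) (auto simp: S.hom_closed)

lemma T_kills: "z \<in> XUL_ideal K X \<Longrightarrow> T z = \<zero>\<^bsub>UP\<^esub>"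
  by (rule kills_XUL_ideal[OF T.unital_alg_hom_axioms]) (auto simp: T.hom_closed)

lemma Sb_pr: "z \<in> carrier UG \<Longrightarrow> Sb (pr z) = S z"
  unfolding UL_bar_map_def by (rule XI.induced_coset[OF S.unital_alg_hom_axioms S_kills])

lemma Tb_pr: "z \<in> carrier UG \<Longrightarrow> Tb (pr z) = T z"
  unfolding UL_bar_map_def by (rule XI.induced_coset[OF T.unital_alg_hom_axioms T_kills])

sublocale Sb: unital_alg_hom K Ub "UP" Sb
  by unfold_locales (unfold UL_bar_def UL_bar_map_def,
    rule XI.induced_hom[OF S.unital_alg_hom_axioms S_kills])

sublocale Tb: unital_alg_hom K Ub "UP" Tb
  by unfold_locales (unfold UL_bar_def UL_bar_map_def,
    rule XI.induced_hom[OF T.unital_alg_hom_axioms T_kills])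

lemma Ib_eq: "Ib a = pr (I a)"
  by (simp add: UL_bar_incl_def inc_def)

sublocale Ib: unital_alg_hom K "UP" Ub Ib
  by unfold_locales (use ualg_hom_comp[OF I.hom pr.hom] in \<open>simp add: Ib_eq[abs_def]\<close>)

lemma Sb_Ib: "a \<in> carrier UP \<Longrightarrow> Sb (Ib a) = a"
  by (simp add: Ib_eq Sb_pr I.hom_closed SI)

lemma Tb_Ib: "a \<in> carrier UP \<Longrightarrow> Tb (Ib a) = a"
  by (simp add: Ib_eq Tb_pr I.hom_closed TI)

text \<open>Because \<open>Sb (pr a) = S a\<close> and \<open>Tb (pr b) = T b\<close>, arbitrary
  representatives of \<open>x\<close> and \<open>y\<close> lie in \<open>Ker S\<close> and
  \<open>Ker T\<close>; their products belong to the ideal that was divided out.\<close>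

lemma Ub_ker_mult:
  assumes "x \<in> carrier Ub" "y \<in> carrier Ub" "Sb x = \<zero>\<^bsub>UP\<^esub>" "Tb y = \<zero>\<^bsub>UP\<^esub>"
  shows "x \<otimes>\<^bsub>Ub\<^esub> y = \<zero>\<^bsub>Ub\<^esub> \<and> y \<otimes>\<^bsub>Ub\<^esub> x = \<zero>\<^bsub>Ub\<^esub>"
proof -
  obtain a b where ab: "a \<in> carrier UG" "x = pr a" "b \<in> carrier UG" "y = pr b"
    using assms(1,2) unfolding carrier_Ub by blast
  then have "S a = \<zero>\<^bsub>UP\<^esub>" "T b = \<zero>\<^bsub>UP\<^esub>"
    using assms(3,4) by (simp_all add: Sb_pr Tb_pr)
  note mem = XUL_ideal_mem[OF ab(1,3) this]
  show ?thesis
    using mem[THEN XI.quot_proj_zero, folded UL_bar_def] ab by (simp add: pr.hom_mult)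
qed

lemma XUL_eq:
  "XUL K X = \<lparr>Top = Ub\<lparr>carrier := a_kernel Ub UP Sb\<rparr>, Base = UP, bdry = Tb,
      lact = (\<lambda>a b. Ib a \<otimes>\<^bsub>Ub\<^esub> b), ract = (\<lambda>b a. b \<otimes>\<^bsub>Ub\<^esub> Ib a)\<rparr>"
  by (simp add: XUL_def)

lemma XUL_simps:
  "Base (XUL K X) = UP" "bdry (XUL K X) = Tb"
  "lact (XUL K X) = (\<lambda>a b. Ib a \<otimes>\<^bsub>Ub\<^esub> b)" "ract (XUL K X) = (\<lambda>b a. b \<otimes>\<^bsub>Ub\<^esub> Ib a)"
  "add (Top (XUL K X)) = add Ub" "mult (Top (XUL K X)) = mult Ub"
  "smult (Top (XUL K X)) = smult Ub"
  by (simp_all add: XUL_eq)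

abbreviation XT where "XT \<equiv> Top (XUL K X)"

lemma Top_XUL_iff: "b \<in> carrier XT \<longleftrightarrow> b \<in> carrier Ub \<and> Sb b = \<zero>\<^bsub>UP\<^esub>"
  by (simp add: XUL_eq a_kernel_iff)

sublocale XUL: unital_xmod K "XUL K X"
proof (intro unital_xmod.intro unital_xmod_axioms.intro)
  show "unital_algebra K (Base (XUL K X))"
    unfolding XUL_simps(1) by (rule P.U.unital_algebra_axioms)
  show "alg_crossed_module K (XUL K X)"
    unfolding XUL_eq
    by (rule cat1_crossed_module[OF Sb.unital_alg_hom_axioms Tb.unital_alg_hom_axioms
          Ib.unital_alg_hom_axioms Sb_Ib Tb_Ib Ub_ker_mult])
qed (auto simp: XUL_simps Top_XUL_iff Ib.hom_one)

section \<open>Generators of XUL and the relations between them\<close>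

definition bl :: "'q \<Rightarrow> ('k, 'q \<times> 'p) ul set" where
  "bl q = pr (UL_l K G (q, \<zero>\<^bsub>P\<^esub>))"

definition br :: "'q \<Rightarrow> ('k, 'q \<times> 'p) ul set" where
  "br q = pr (UL_r K G (q, \<zero>\<^bsub>P\<^esub>))"

end

text \<open>The last block consists of the enveloping relations for one element \<open>p\<close> of
  the base and one element \<open>q\<close> of the top, in both orders. The relations for two
  elements of the top are consequences: put \<open>p = bdry X q\<close> and use the compatibility
  with boundaries and the Peiffer identity in \<open>Y\<close>.\<close>

definition XUL_data ::
  "'k ring \<Rightarrow> ('k, 'q, 'p) xmod \<Rightarrow> ('k, 'b, 'a) xmod \<Rightarrow> ('p \<Rightarrow> 'a) \<Rightarrow> ('p \<Rightarrow> 'a)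
    \<Rightarrow> ('q \<Rightarrow> 'b) \<Rightarrow> ('q \<Rightarrow> 'b) \<Rightarrow> bool"
where
  "XUL_data K X Y al ar bl br \<longleftrightarrow>
     UL_data K (Base X) (Base Y) al ar \<and>
     linear_map K (Top X) (Top Y) bl \<and> linear_map K (Top X) (Top Y) br \<and>
     (\<forall>q\<in>carrier (Top X).
        bdry Y (bl q) = al (bdry X q) \<and> bdry Y (br q) = ar (bdry X q)) \<and>
     (\<forall>p\<in>carrier (Base X). \<forall>q\<in>carrier (Top X).
        br (lact X p q) = lact Y (ar p) (br q) \<ominus>\<^bsub>Top Y\<^esub> ract Y (br q) (ar p) \<and>
        bl (lact X p q) = lact Y (al p) (br q) \<ominus>\<^bsub>Top Y\<^esub> ract Y (br q) (al p) \<and>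
        br (ract X q p) = ract Y (br q) (ar p) \<ominus>\<^bsub>Top Y\<^esub> lact Y (ar p) (br q) \<and>
        bl (ract X q p) = ract Y (bl q) (ar p) \<ominus>\<^bsub>Top Y\<^esub> lact Y (ar p) (bl q) \<and>
        lact Y (ar p \<oplus>\<^bsub>Base Y\<^esub> al p) (bl q) = \<zero>\<^bsub>Top Y\<^esub> \<and>
        ract Y (br q \<oplus>\<^bsub>Top Y\<^esub> bl q) (al p) = \<zero>\<^bsub>Top Y\<^esub>)"

lemma XUL_dataD:
  assumes "XUL_data K X Y al ar bl br"
  shows "UL_data K (Base X) (Base Y) al ar"
    "linear_map K (Base X) (Base Y) al" "linear_map K (Base X) (Base Y) ar"
    "linear_map K (Top X) (Top Y) bl" "linear_map K (Top X) (Top Y) br"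
    "q \<in> carrier (Top X) \<Longrightarrow> bdry Y (bl q) = al (bdry X q)"
    "q \<in> carrier (Top X) \<Longrightarrow> bdry Y (br q) = ar (bdry X q)"
    "\<lbrakk>p \<in> carrier (Base X); q \<in> carrier (Top X)\<rbrakk> \<Longrightarrow>
        br (lact X p q) = lact Y (ar p) (br q) \<ominus>\<^bsub>Top Y\<^esub> ract Y (br q) (ar p)"
    "\<lbrakk>p \<in> carrier (Base X); q \<in> carrier (Top X)\<rbrakk> \<Longrightarrow>
        bl (lact X p q) = lact Y (al p) (br q) \<ominus>\<^bsub>Top Y\<^esub> ract Y (br q) (al p)"
    "\<lbrakk>p \<in> carrier (Base X); q \<in> carrier (Top X)\<rbrakk> \<Longrightarrow>
        br (ract X q p) = ract Y (br q) (ar p) \<ominus>\<^bsub>Top Y\<^esub> lact Y (ar p) (br q)"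
    "\<lbrakk>p \<in> carrier (Base X); q \<in> carrier (Top X)\<rbrakk> \<Longrightarrow>
        bl (ract X q p) = ract Y (bl q) (ar p) \<ominus>\<^bsub>Top Y\<^esub> lact Y (ar p) (bl q)"
    "\<lbrakk>p \<in> carrier (Base X); q \<in> carrier (Top X)\<rbrakk> \<Longrightarrow>
        lact Y (ar p \<oplus>\<^bsub>Base Y\<^esub> al p) (bl q) = \<zero>\<^bsub>Top Y\<^esub>"
    "\<lbrakk>p \<in> carrier (Base X); q \<in> carrier (Top X)\<rbrakk> \<Longrightarrow>
        ract Y (br q \<oplus>\<^bsub>Top Y\<^esub> bl q) (al p) = \<zero>\<^bsub>Top Y\<^esub>"
  using assms unfolding XUL_data_def UL_data_def by auto

lemma UL_dataD:
  assumes "UL_data K P A l r" "x \<in> carrier P" "y \<in> carrier P"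
  shows "r (x \<otimes>\<^bsub>P\<^esub> y) = r x \<otimes>\<^bsub>A\<^esub> r y \<ominus>\<^bsub>A\<^esub> r y \<otimes>\<^bsub>A\<^esub> r x"
    "l (x \<otimes>\<^bsub>P\<^esub> y) = l x \<otimes>\<^bsub>A\<^esub> r y \<ominus>\<^bsub>A\<^esub> r y \<otimes>\<^bsub>A\<^esub> l x"
    "(r y \<oplus>\<^bsub>A\<^esub> l y) \<otimes>\<^bsub>A\<^esub> l x = \<zero>\<^bsub>A\<^esub>"
  using assms unfolding UL_data_def by auto

context leibniz_xmod
begin

lemma map_simps: "inc p = (\<zero>\<^bsub>Q\<^esub>, p)" "src X (q, p) = p" "tgt X (q, p) = \<eta> q \<oplus>\<^bsub>P\<^esub> p"
  by (simp_all add: inc_def src_def tgt_def)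

lemma emb_closed: "q \<in> carrier Q \<Longrightarrow> (q, \<zero>\<^bsub>P\<^esub>) \<in> carrier G"
  by (simp add: semidirect_simps)

lemma Ib_gens:
  assumes "p \<in> carrier P"
  shows "Ib (UL_l K P p) = pr (UL_l K G (\<zero>\<^bsub>Q\<^esub>, p))" "Ib (UL_r K P p) = pr (UL_r K G (\<zero>\<^bsub>Q\<^esub>, p))"
  using assms by (simp_all add: Ib_eq UL_map_gens map_simps)

lemma emb_linear: "linear_map K Q G (\<lambda>q. (q, \<zero>\<^bsub>P\<^esub>))"
  by (rule linear_mapI) (auto simp: semidirect_simps)

lemma Sb_gens: "q \<in> carrier Q \<Longrightarrow> Sb (bl q) = \<zero>\<^bsub>UP\<^esub>" "q \<in> carrier Q \<Longrightarrow> Sb (br q) = \<zero>\<^bsub>UP\<^esub>"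
  using P.UL_gens_linear[THEN linear_map_zero[OF P.P.abelian_group_axioms P.U.A.abelian_group_axioms]]
  by (simp_all add: bl_def br_def Sb_pr emb_closed G.UL_gens_closed UL_map_gens map_simps)

lemma Tb_gens: "q \<in> carrier Q \<Longrightarrow> Tb (bl q) = UL_l K P (\<eta> q)"
  "q \<in> carrier Q \<Longrightarrow> Tb (br q) = UL_r K P (\<eta> q)"
  by (simp_all add: bl_def br_def Tb_pr emb_closed G.UL_gens_closed UL_map_gens map_simps xmod_closed)

lemma b_closed: "q \<in> carrier Q \<Longrightarrow> bl q \<in> carrier Ub" "q \<in> carrier Q \<Longrightarrow> br q \<in> carrier Ub"
  by (simp_all add: bl_def br_def emb_closed G.UL_gens_closed pr.hom_closed)

lemma Top_zero: "\<zero>\<^bsub>XT\<^esub> = \<zero>\<^bsub>Ub\<^esub>"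
  by (simp add: XUL_eq)

text \<open>Subtraction refers to the carrier through the additive inverse, so shrinking the carrier
  to the kernel does not keep it by definition. It is kept because the inclusion is linear.\<close>

lemma Top_minus:
  assumes "x \<in> carrier XT" "y \<in> carrier XT"
  shows "x \<ominus>\<^bsub>XT\<^esub> y = x \<ominus>\<^bsub>Ub\<^esub> y"
proof -
  have "linear_map K XT Ub (\<lambda>x. x)"
    by (rule linear_mapI) (auto simp: Top_XUL_iff XUL_simps)
  from linear_map_minus[OF XUL.Top.abelian_group_axioms Ub.A.abelian_group_axioms this assms]
  show ?thesis .
qed

lemma XUL_gens_data: "XUL_data K X (XUL K X) (UL_l K P) (UL_r K P) bl br"
proof -
  have lin: "linear_map K Q Ub bl" "linear_map K Q Ub br"
    unfolding bl_def br_def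
    using linear_map_comp[OF linear_map_comp[OF emb_linear G.UL_gens_linear(1)] pr.hom_linear]
      linear_map_comp[OF linear_map_comp[OF emb_linear G.UL_gens_linear(2)] pr.hom_linear] by auto
  have lin': "linear_map K Q XT bl" "linear_map K Q XT br"
    using linear_mapD[OF lin(1)] linear_mapD[OF lin(2)]
    by (auto intro!: linear_mapI simp: Top_XUL_iff Sb_gens XUL_simps)
  note gd = UL_dataD[OF G.UL_gens_data]
  have top: "bl q \<in> carrier XT" "br q \<in> carrier XT"
    if "q \<in> carrier Q" for q
    using that by (auto simp: Top_XUL_iff b_closed Sb_gens)
  \<comment> \<open>The brackets of \<open>(0, p)\<close> and \<open>(q, 0)\<close> in the
    semidirect product are the two actions, so the enveloping relations for these elements are the
    mixed relations of \<open>XUL_data\<close>.\<close>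
  have mult: "(\<zero>\<^bsub>Q\<^esub>, p) \<otimes>\<^bsub>G\<^esub> (q, \<zero>\<^bsub>P\<^esub>) = (lact X p q, \<zero>\<^bsub>P\<^esub>)"
    "(q, \<zero>\<^bsub>P\<^esub>) \<otimes>\<^bsub>G\<^esub> (\<zero>\<^bsub>Q\<^esub>, p) = (ract X q p, \<zero>\<^bsub>P\<^esub>)"
    if "p \<in> carrier P" "q \<in> carrier Q" for p q
    using that by (simp_all add: semidirect_simps xmod_zero xmod_closed)
  show ?thesis
    unfolding XUL_data_def XUL_simps
  proof (intro conjI ballI lin' P.UL_gens_data)
    fix p q assume pq: "p \<in> carrier P" "q \<in> carrier Q"
    have cl: "(\<zero>\<^bsub>Q\<^esub>, p) \<in> carrier G" "(q, \<zero>\<^bsub>P\<^esub>) \<in> carrier G"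
      using pq by (simp_all add: semidirect_simps)
    note gcl = cl[THEN G.UL_gens_closed(1)] cl[THEN G.UL_gens_closed(2)]
    have act: "Ib a \<otimes>\<^bsub>Ub\<^esub> b \<in> carrier XT" "b \<otimes>\<^bsub>Ub\<^esub> Ib a \<in> carrier XT"
      if "a \<in> carrier UP" "b \<in> carrier XT" for a b
      using XUL.top_closed(1)[of a b] XUL.top_closed(2)[of b a] that by (simp_all add: XUL_simps)
    \<comment> \<open>Entries 1 to 3 are the enveloping relations for \<open>x = (0, p)\<close> and
      \<open>y = (q, 0)\<close>, entries 4 to 6 those with the two exchanged.\<close>
    note rels = gd[OF cl] gd[OF cl(2,1)]
    note rw = Top_minus act top pq P.UL_gens_closed Ib_gens Ib.hom_add
    \<comment> \<open>\<open>Top_minus\<close> asks for membership in \<open>XT\<close>, which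
      \<open>act\<close> provides for products with \<open>Ib a\<close>. Hence \<open>Ib\<close> is
      evaluated on generators only in the second simplification.\<close>
    show "br (lact X p q) = Ib (UL_r K P p) \<otimes>\<^bsub>Ub\<^esub> br q \<ominus>\<^bsub>XT\<^esub> br q \<otimes>\<^bsub>Ub\<^esub> Ib (UL_r K P p)"
      using rels(1) gcl
      by (simp add: rw del: Ib_gens) (simp add: rw br_def mult[OF pq] pr.hom_minus pr.hom_mult)
    show "bl (lact X p q) = Ib (UL_l K P p) \<otimes>\<^bsub>Ub\<^esub> br q \<ominus>\<^bsub>XT\<^esub> br q \<otimes>\<^bsub>Ub\<^esub> Ib (UL_l K P p)"
      using rels(2) gcl
      by (simp add: rw del: Ib_gens) (simp add: rw br_def bl_def mult[OF pq] pr.hom_minus pr.hom_mult)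
    show "br (ract X q p) = br q \<otimes>\<^bsub>Ub\<^esub> Ib (UL_r K P p) \<ominus>\<^bsub>XT\<^esub> Ib (UL_r K P p) \<otimes>\<^bsub>Ub\<^esub> br q"
      using rels(4) gcl
      by (simp add: rw del: Ib_gens) (simp add: rw br_def mult[OF pq] pr.hom_minus pr.hom_mult)
    show "bl (ract X q p) = bl q \<otimes>\<^bsub>Ub\<^esub> Ib (UL_r K P p) \<ominus>\<^bsub>XT\<^esub> Ib (UL_r K P p) \<otimes>\<^bsub>Ub\<^esub> bl q"
      using rels(5) gcl
      by (simp add: rw del: Ib_gens) (simp add: rw bl_def mult[OF pq] pr.hom_minus pr.hom_mult)
    show "Ib (UL_r K P p \<oplus>\<^bsub>UP\<^esub> UL_l K P p) \<otimes>\<^bsub>Ub\<^esub> bl q = \<zero>\<^bsub>XT\<^esub>"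
      using arg_cong[OF rels(6), of pr] gcl pr.hom_zero
      by (simp add: rw Top_zero bl_def pr.hom_add pr.hom_mult)
    show "(br q \<oplus>\<^bsub>Ub\<^esub> bl q) \<otimes>\<^bsub>Ub\<^esub> Ib (UL_l K P p) = \<zero>\<^bsub>XT\<^esub>"
      using arg_cong[OF rels(3), of pr] gcl pr.hom_zero
      by (simp add: rw Top_zero bl_def br_def pr.hom_add pr.hom_mult)
  qed (simp_all add: Tb_gens)
qed

text \<open>The UL(p)-subbimodule generated by the \<open>bl q\<close> and \<open>br q\<close>.
  Closing under sums suffices: scalars are absorbed into the left coefficient
  (\<open>span_smult\<close>), and zero arises from the coefficient zero.\<close>

inductive_set span :: "('k, 'q \<times> 'p) ul set set" where
  l: "\<lbrakk>a \<in> carrier UP; a' \<in> carrier UP; q \<in> carrier Q\<rbrakk> \<Longrightarrow> Ib a \<otimes>\<^bsub>Ub\<^esub> bl q \<otimes>\<^bsub>Ub\<^esub> Ib a' \<in> span"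
| r: "\<lbrakk>a \<in> carrier UP; a' \<in> carrier UP; q \<in> carrier Q\<rbrakk> \<Longrightarrow> Ib a \<otimes>\<^bsub>Ub\<^esub> br q \<otimes>\<^bsub>Ub\<^esub> Ib a' \<in> span"
| add: "\<lbrakk>b \<in> span; b' \<in> span\<rbrakk> \<Longrightarrow> b \<oplus>\<^bsub>Ub\<^esub> b' \<in> span"

lemma span_ker: "b \<in> span \<Longrightarrow> b \<in> carrier Ub \<and> Sb b = \<zero>\<^bsub>UP\<^esub>"
  by (induction rule: span.induct)
    (auto simp: Ib.hom_closed b_closed Sb.hom_mult Sb.hom_add Sb_gens Sb_Ib)

lemma span_lmult: "b \<in> span \<Longrightarrow> c \<in> carrier UP \<Longrightarrow> Ib c \<otimes>\<^bsub>Ub\<^esub> b \<in> span"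
proof (induction rule: span.induct)
  case (l a a' q)
  then show ?case
    using span.l[of "c \<otimes>\<^bsub>UP\<^esub> a" a' q]
    by (simp add: Ib.hom_mult Ib.hom_closed b_closed Ub.A.m_assoc)
next
  case (r a a' q)
  then show ?case
    using span.r[of "c \<otimes>\<^bsub>UP\<^esub> a" a' q]
    by (simp add: Ib.hom_mult Ib.hom_closed b_closed Ub.A.m_assoc)
next
  case (add b b')
  then show ?case using span.add span_ker by (simp add: Ub.A.r_distr Ib.hom_closed)
qed

lemma span_rmult: "b \<in> span \<Longrightarrow> c \<in> carrier UP \<Longrightarrow> b \<otimes>\<^bsub>Ub\<^esub> Ib c \<in> span"
proof (induction rule: span.induct)
  case (l a a' q)
  then show ?case
    using span.l[of a "a' \<otimes>\<^bsub>UP\<^esub> c" q]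
    by (simp add: Ib.hom_mult Ib.hom_closed b_closed Ub.A.m_assoc)
next
  case (r a a' q)
  then show ?case
    using span.r[of a "a' \<otimes>\<^bsub>UP\<^esub> c" q]
    by (simp add: Ib.hom_mult Ib.hom_closed b_closed Ub.A.m_assoc)
next
  case (add b b')
  then show ?case using span.add span_ker by (simp add: Ub.A.l_distr Ib.hom_closed)
qed

lemma span_smult:
  assumes b: "b \<in> span" and k: "k \<in> carrier K"
  shows "k \<odot>\<^bsub>Ub\<^esub> b \<in> span"
proof -
  have "k \<odot>\<^bsub>Ub\<^esub> b = Ib (k \<odot>\<^bsub>UP\<^esub> \<one>\<^bsub>UP\<^esub>) \<otimes>\<^bsub>Ub\<^esub> b"
    using span_ker[OF b] k by (simp add: Ib.hom_smult Ib.hom_one Ub.smult_mult_l)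
  then show ?thesis using span_lmult[OF b, of "k \<odot>\<^bsub>UP\<^esub> \<one>\<^bsub>UP\<^esub>"] k by simp
qed

lemma span_zero: "\<zero>\<^bsub>Ub\<^esub> \<in> span"
  using span.l[of "\<zero>\<^bsub>UP\<^esub>" "\<zero>\<^bsub>UP\<^esub>" "\<zero>\<^bsub>Q\<^esub>"] b_closed(1)[of "\<zero>\<^bsub>Q\<^esub>"]
  by (simp add: Ib.hom_zero)

lemma span_gens: "q \<in> carrier Q \<Longrightarrow> bl q \<in> span" "q \<in> carrier Q \<Longrightarrow> br q \<in> span"
  using span.l[of "\<one>\<^bsub>UP\<^esub>" "\<one>\<^bsub>UP\<^esub>" q] span.r[of "\<one>\<^bsub>UP\<^esub>" "\<one>\<^bsub>UP\<^esub>" q]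
  by (simp_all add: Ib.hom_one b_closed)

text \<open>By the Peiffer identity two factors from the kernel reduce to one, so that
  \<open>\<overline>UL\<close> is the sum of the image of \<open>UL(\<pp>)\<close> and the span of the elements
  \<open>a b a'\<close> with one kernel generator \<open>b\<close>.\<close>

lemma Ub_decomp:
  assumes "z \<in> carrier UG"
  shows "\<exists>a\<in>carrier UP. \<exists>b\<in>span. pr z = Ib a \<oplus>\<^bsub>Ub\<^esub> b"
  using assms
proof (induction z rule: G.UL_induct)
  case one
  show ?case
    using span_zero
    by (intro bexI[of _ "\<one>\<^bsub>UP\<^esub>"] bexI[of _ "\<zero>\<^bsub>Ub\<^esub>"]) (simp_all add: pr.hom_one Ib.hom_one)
next
  case (l x)
  then obtain q p where x: "x = (q, p)" "q \<in> carrier Q" "p \<in> carrier P"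
    by (auto simp: semidirect_simps)
  have "UL_l K G x = UL_l K G (\<zero>\<^bsub>Q\<^esub>, p) \<oplus>\<^bsub>UG\<^esub> UL_l K G (q, \<zero>\<^bsub>P\<^esub>)"
    using linear_mapD(2)[OF G.UL_gens_linear(1), of "(\<zero>\<^bsub>Q\<^esub>, p)" "(q, \<zero>\<^bsub>P\<^esub>)"] x
    by (simp add: semidirect_simps)
  then show ?case
    using x span_gens
    by (intro bexI[of _ "UL_l K P p"] bexI[of _ "bl q"])
      (simp_all add: pr.hom_add Ib_gens bl_def P.UL_gens_closed G.UL_gens_closed semidirect_simps)
next
  case (r x)
  then obtain q p where x: "x = (q, p)" "q \<in> carrier Q" "p \<in> carrier P"
    by (auto simp: semidirect_simps)
  have "UL_r K G x = UL_r K G (\<zero>\<^bsub>Q\<^esub>, p) \<oplus>\<^bsub>UG\<^esub> UL_r K G (q, \<zero>\<^bsub>P\<^esub>)"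
    using linear_mapD(2)[OF G.UL_gens_linear(2), of "(\<zero>\<^bsub>Q\<^esub>, p)" "(q, \<zero>\<^bsub>P\<^esub>)"] x
    by (simp add: semidirect_simps)
  then show ?case
    using x span_gens
    by (intro bexI[of _ "UL_r K P p"] bexI[of _ "br q"])
      (simp_all add: pr.hom_add Ib_gens br_def P.UL_gens_closed G.UL_gens_closed semidirect_simps)
next
  case (add y z)
  then obtain a b a' b' where ab: "a \<in> carrier UP" "b \<in> span" "a' \<in> carrier UP" "b' \<in> span"
    "pr y = Ib a \<oplus>\<^bsub>Ub\<^esub> b" "pr z = Ib a' \<oplus>\<^bsub>Ub\<^esub> b'" by blast
  then show ?case
    using add(1,2) span.add[of b b'] span_ker[of b] span_ker[of b']
    by (intro bexI[of _ "a \<oplus>\<^bsub>UP\<^esub> a'"] bexI[of _ "b \<oplus>\<^bsub>Ub\<^esub> b'"])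
      (simp_all add: pr.hom_add Ib.hom_add Ib.hom_closed Ub.A.a_ac)
next
  case (smult k z)
  then obtain a b where ab: "a \<in> carrier UP" "b \<in> span" "pr z = Ib a \<oplus>\<^bsub>Ub\<^esub> b" by blast
  then show ?case
    using smult(1,2) span_smult[of b k] span_ker[of b]
    by (intro bexI[of _ "k \<odot>\<^bsub>UP\<^esub> a"] bexI[of _ "k \<odot>\<^bsub>Ub\<^esub> b"])
      (simp_all add: pr.hom_smult Ib.hom_smult Ib.hom_closed Ub.smult_r_distr)
next
  case (mult y z)
  then obtain a b a' b' where ab: "a \<in> carrier UP" "b \<in> span" "a' \<in> carrier UP" "b' \<in> span"
    "pr y = Ib a \<oplus>\<^bsub>Ub\<^esub> b" "pr z = Ib a' \<oplus>\<^bsub>Ub\<^esub> b'" by blast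
  have bb': "b \<otimes>\<^bsub>Ub\<^esub> b' = b \<otimes>\<^bsub>Ub\<^esub> Ib (Tb b')"
    using XUL.peiffer(2)[of b b'] span_ker ab(2,4) by (simp add: XUL_simps Top_XUL_iff)
  have "Ib a \<otimes>\<^bsub>Ub\<^esub> b' \<oplus>\<^bsub>Ub\<^esub> (b \<otimes>\<^bsub>Ub\<^esub> Ib a' \<oplus>\<^bsub>Ub\<^esub> b \<otimes>\<^bsub>Ub\<^esub> b') \<in> span"
    unfolding bb' using ab span_ker
    by (intro span.add span_lmult span_rmult) (auto simp: Tb.hom_closed)
  then show ?case
    using ab mult(1,2) span_ker[of b] span_ker[of b']
    by (intro bexI[of _ "a \<otimes>\<^bsub>UP\<^esub> a'"]
        bexI[of _ "Ib a \<otimes>\<^bsub>Ub\<^esub> b' \<oplus>\<^bsub>Ub\<^esub> (b \<otimes>\<^bsub>Ub\<^esub> Ib a' \<oplus>\<^bsub>Ub\<^esub> b \<otimes>\<^bsub>Ub\<^esub> b')"])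
      (simp_all add: pr.hom_mult Ib.hom_mult Ib.hom_closed Ub.A.l_distr Ub.A.r_distr
        Ub.A.a_ac)
qed

text \<open>Applying \<open>Sb\<close> to the decomposition \<open>b = Ib a + c\<close> kills
  \<open>c\<close> and returns \<open>a\<close>. So \<open>a\<close> vanishes and \<open>b\<close>
  is the element \<open>c\<close> of the span.\<close>

lemma Top_XUL_span: "b \<in> carrier XT \<Longrightarrow> b \<in> span"
proof -
  assume b: "b \<in> carrier XT"
  then obtain z where z: "z \<in> carrier UG" "b = pr z"
    unfolding Top_XUL_iff carrier_Ub by blast
  obtain a c where ac: "a \<in> carrier UP" "c \<in> span" "b = Ib a \<oplus>\<^bsub>Ub\<^esub> c"
    using Ub_decomp[OF z(1)] z(2) by blast
  have "a = \<zero>\<^bsub>UP\<^esub>"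
    using b ac span_ker[OF ac(2)] by (simp add: Top_XUL_iff Sb.hom_add Ib.hom_closed Sb_Ib)
  then show "b \<in> span" using ac span_ker[OF ac(2)] by (simp add: Ib.hom_zero)
qed

text \<open>Data in \<open>Y\<close> give an algebra map from \<open>UL(\<qq> \<rtimes> \<pp>)\<close> to the semidirect product of \<open>Y\<close>,
  which kills the ideal because \<open>Ker s\<close> and \<open>Ker t\<close> annihilate each other there.\<close>

theorem XUL_universal:
  assumes Y: "unital_xmod K Y" and data: "XUL_data K X Y al ar dl dr"
  obtains \<phi> \<psi> where "alg_xmod_hom K (XUL K X) Y \<phi> \<psi>" "\<psi> \<one>\<^bsub>UP\<^esub> = \<one>\<^bsub>Base Y\<^esub>"
    "\<And>p. p \<in> carrier P \<Longrightarrow> \<psi> (UL_l K P p) = al p" "\<And>p. p \<in> carrier P \<Longrightarrow> \<psi> (UL_r K P p) = ar p"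
    "\<And>q. q \<in> carrier Q \<Longrightarrow> \<phi> (bl q) = dl q" "\<And>q. q \<in> carrier Q \<Longrightarrow> \<phi> (br q) = dr q"
proof -
  interpret Y: unital_xmod K Y by (rule Y)
  note D = XUL_dataD[OF data]
  note cl = D(2)[THEN linear_mapD(1)] D(3)[THEN linear_mapD(1)] D(4)[THEN linear_mapD(1)]
    D(5)[THEN linear_mapD(1)]
  note ad = D(2)[THEN linear_mapD(2)] D(3)[THEN linear_mapD(2)] D(4)[THEN linear_mapD(2)]
    D(5)[THEN linear_mapD(2)]
  note sm = D(2)[THEN linear_mapD(3)] D(3)[THEN linear_mapD(3)] D(4)[THEN linear_mapD(3)]
    D(5)[THEN linear_mapD(3)]
  note ud = UL_dataD[OF D(1)]
  let ?B = "Top Y"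
  obtain \<psi> where \<psi>: "ualg_hom K UP (Base Y) \<psi>"
    "\<And>p. p \<in> carrier P \<Longrightarrow> \<psi> (UL_l K P p) = al p" "\<And>p. p \<in> carrier P \<Longrightarrow> \<psi> (UL_r K P p) = ar p"
    using P.UL_universal[OF Y.Base.unital_algebra_axioms D(1)] by blast
  define L where "L = (\<lambda>(q, p). (dl q, al p))"
  define R where "R = (\<lambda>(q, p). (dr q, ar p))"
  have LR: "L (q, p) = (dl q, al p)" "R (q, p) = (dr q, ar p)" for q p
    by (simp_all add: L_def R_def)
  \<comment> \<open>The relation for \<open>lact X p q'\<close> at \<open>p = \<eta> q\<close>: the
    action of \<open>\<eta> q\<close> is the bracket with \<open>q\<close>, the element
    \<open>ar (\<eta> q)\<close> is the boundary of \<open>dr q\<close>, and by Peiffer boundaries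
    act by multiplication in the top. The next two facts arise in the same way.\<close>
  have dr_mult: "dr (q \<otimes>\<^bsub>Q\<^esub> q') = dr q \<otimes>\<^bsub>?B\<^esub> dr q' \<ominus>\<^bsub>?B\<^esub> dr q' \<otimes>\<^bsub>?B\<^esub> dr q"
    if "q \<in> carrier Q" "q' \<in> carrier Q" for q q'
    using D(8)[of "\<eta> q" q'] that
    by (simp add: xmod_closed lact_eta D(7)[symmetric] Y.peiffer cl)
  have dl_mult: "dl (q \<otimes>\<^bsub>Q\<^esub> q') = dl q \<otimes>\<^bsub>?B\<^esub> dr q' \<ominus>\<^bsub>?B\<^esub> dr q' \<otimes>\<^bsub>?B\<^esub> dl q"
    if "q \<in> carrier Q" "q' \<in> carrier Q" for q q'
    using D(9)[of "\<eta> q" q'] that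
    by (simp add: xmod_closed lact_eta D(6)[symmetric] Y.peiffer cl)
  have dl_kill: "(dr q \<oplus>\<^bsub>?B\<^esub> dl q) \<otimes>\<^bsub>?B\<^esub> dl q' = \<zero>\<^bsub>?B\<^esub>"
    if "q \<in> carrier Q" "q' \<in> carrier Q" for q q'
    using D(12)[of "\<eta> q" q'] that
    by (simp add: xmod_closed D(6,7)[symmetric] Y.top_add(7)[symmetric] Y.peiffer cl)
  have SD_minus: "(b, a) \<ominus>\<^bsub>Y.SD\<^esub> (b', a') = (b \<ominus>\<^bsub>?B\<^esub> b', a \<ominus>\<^bsub>Base Y\<^esub> a')"
    if "b \<in> carrier ?B" "a \<in> carrier (Base Y)" "b' \<in> carrier ?B" "a' \<in> carrier (Base Y)" for b a b' a'
  proof -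
    have "(\<ominus>\<^bsub>?B\<^esub> b', \<ominus>\<^bsub>Base Y\<^esub> a') = \<ominus>\<^bsub>Y.SD\<^esub> (b', a')"
      by (rule Y.SD.A.minus_equality[symmetric])
        (use that in \<open>auto simp: Y.SD_simps Y.Top.M.l_neg Y.Base.A.l_neg\<close>)
    then show ?thesis unfolding a_minus_def by (metis Y.SD_simps(2))
  qed
  note rearrange = a_minus_def Y.Top.M.minus_add Y.Top.M.a_ac
  have "UL_data K G Y.SD L R"
    unfolding UL_data_def
  proof (intro conjI ballI)
    show "linear_map K G Y.SD L" "linear_map K G Y.SD R"
      by (rule linear_mapI; auto simp: LR semidirect_simps Y.SD_simps cl ad sm)+
    fix x y assume xy: "x \<in> carrier G" "y \<in> carrier G"
    then obtain q p q' p' where x: "x = (q, p)" "q \<in> carrier Q" "p \<in> carrier P"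
      and y: "y = (q', p')" "q' \<in> carrier Q" "p' \<in> carrier P"
      by (auto simp: semidirect_simps)
    note xy = x y
    show "R (x \<otimes>\<^bsub>G\<^esub> y) = R x \<otimes>\<^bsub>Y.SD\<^esub> R y \<ominus>\<^bsub>Y.SD\<^esub> R y \<otimes>\<^bsub>Y.SD\<^esub> R x"
      using xy by (simp add: semidirect_simps LR Y.SD_simps SD_minus cl ad xmod_closed ud(1)
          Y.top_closed dr_mult D(8,10)) (simp add: rearrange cl Y.top_closed)
    show "L (x \<otimes>\<^bsub>G\<^esub> y) = L x \<otimes>\<^bsub>Y.SD\<^esub> R y \<ominus>\<^bsub>Y.SD\<^esub> R y \<otimes>\<^bsub>Y.SD\<^esub> L x"
      using xy by (simp add: semidirect_simps LR Y.SD_simps SD_minus cl ad xmod_closed ud(2)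
          Y.top_closed dl_mult D(9,11)) (simp add: rearrange cl Y.top_closed)
    show "(R y \<oplus>\<^bsub>Y.SD\<^esub> L y) \<otimes>\<^bsub>Y.SD\<^esub> L x = \<zero>\<^bsub>Y.SD\<^esub>"
      using xy by (simp add: LR Y.SD_simps cl ud(3) dl_kill D(12,13))
  qed
  then obtain \<Phi> where \<Phi>: "ualg_hom K UG Y.SD \<Phi>"
    "\<And>x. x \<in> carrier G \<Longrightarrow> \<Phi> (UL_l K G x) = L x" "\<And>x. x \<in> carrier G \<Longrightarrow> \<Phi> (UL_r K G x) = R x"
    using G.UL_universal[OF Y.SD_unital_algebra] by blast
  interpret \<Phi>: unital_alg_hom K "UG" Y.SD \<Phi>
    by (intro unital_alg_hom.intro unital_alg_hom_axioms.intro \<Phi>(1) Y.SD_unital_algebra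
        G.U.unital_algebra_axioms)
  \<comment> \<open>Source and target of \<open>\<Phi> z\<close> are the images of
    \<open>S z\<close> and \<open>T z\<close> under \<open>\<psi>\<close>: in each case both sides
    are algebra maps on \<open>UG\<close> that agree on generators. So \<open>\<Phi>\<close>
    respects the two kernels.\<close>
  have \<Phi>S: "snd (\<Phi> z) = \<psi> (S z)" if "z \<in> carrier UG" for z
    by (rule G.UL_hom_eq[OF ualg_hom_comp[OF \<Phi>(1) Y.SD_homs(1)] ualg_hom_comp[OF S.hom \<psi>(1)] _ _ that])
      (auto simp: \<Phi>(2,3) \<psi>(2,3) UL_map_gens LR map_simps semidirect_simps)
  have \<Phi>T: "bdry Y (fst (\<Phi> z)) \<oplus>\<^bsub>Base Y\<^esub> snd (\<Phi> z) = \<psi> (T z)" if "z \<in> carrier UG" for z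
    by (rule G.UL_hom_eq[OF ualg_hom_comp[OF \<Phi>(1) Y.SD_homs(2)] ualg_hom_comp[OF T.hom \<psi>(1)] _ _ that])
      (auto simp: \<Phi>(2,3) \<psi>(2,3) UL_map_gens LR map_simps semidirect_simps D(6,7) ad xmod_closed)
  have zero: "dl \<zero>\<^bsub>Q\<^esub> = \<zero>\<^bsub>?B\<^esub>" "dr \<zero>\<^bsub>Q\<^esub> = \<zero>\<^bsub>?B\<^esub>" "al \<zero>\<^bsub>P\<^esub> = \<zero>\<^bsub>Base Y\<^esub>" "ar \<zero>\<^bsub>P\<^esub> = \<zero>\<^bsub>Base Y\<^esub>"
    using linear_map_zero[OF Q.abelian_group_axioms Y.Top.abelian_group_axioms]
      linear_map_zero[OF P.P.abelian_group_axioms Y.Base.A.abelian_group_axioms] D(2-5) by blast+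
  have \<Phi>I: "\<Phi> (I a) = (\<zero>\<^bsub>?B\<^esub>, \<psi> a)" if "a \<in> carrier UP" for a
    by (rule P.UL_hom_eq[OF ualg_hom_comp[OF I.hom \<Phi>(1)] ualg_hom_comp[OF \<psi>(1) Y.SD_homs(3)] _ _ that])
      (auto simp: \<Phi>(2,3) \<psi>(2,3) UL_map_gens LR inc_simps map_simps semidirect_simps zero)
  have \<psi>0: "\<psi> \<zero>\<^bsub>UP\<^esub> = \<zero>\<^bsub>Base Y\<^esub>"
    by (rule linear_map_zero[OF P.U.A.abelian_group_axioms Y.Base.A.abelian_group_axioms ualg_homD(6)[OF \<psi>(1)]])
  have kills: "\<Phi> z = \<zero>\<^bsub>Y.SD\<^esub>" if "z \<in> XUL_ideal K X" for z
  proof (rule kills_XUL_ideal[OF \<Phi>.unital_alg_hom_axioms _ that])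
    fix x y assume xy: "x \<in> carrier UG" "y \<in> carrier UG"
      "S x = \<zero>\<^bsub>UP\<^esub>" "T y = \<zero>\<^bsub>UP\<^esub>"
    obtain b where b: "\<Phi> x = (b, \<zero>\<^bsub>Base Y\<^esub>)" "b \<in> carrier ?B"
      using \<Phi>S[OF xy(1)] \<Phi>.hom_closed[OF xy(1)] xy(3) \<psi>0 by (cases "\<Phi> x") (auto simp: Y.SD_simps)
    obtain c a where c: "\<Phi> y = (c, a)" "c \<in> carrier ?B" "a \<in> carrier (Base Y)"
      "bdry Y c \<oplus>\<^bsub>Base Y\<^esub> a = \<zero>\<^bsub>Base Y\<^esub>"
      using \<Phi>T[OF xy(2)] \<Phi>.hom_closed[OF xy(2)] xy(4) \<psi>0 by (cases "\<Phi> y") (auto simp: Y.SD_simps)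
    \<comment> \<open>Letting the vanishing element \<open>bdry Y c + a\<close> act on
      \<open>b\<close> from the right gives \<open>b c + b a = 0\<close> by Peiffer, and this is the
      top component of the product. The left action gives the other order.\<close>
    have 1: "b \<otimes>\<^bsub>?B\<^esub> c \<oplus>\<^bsub>?B\<^esub> ract Y b a = \<zero>\<^bsub>?B\<^esub>"
      using Y.top_add(3)[of b "bdry Y c" a] b c by (simp add: Y.top_closed Y.peiffer Y.top_zero)
    have 2: "c \<otimes>\<^bsub>?B\<^esub> b \<oplus>\<^bsub>?B\<^esub> lact Y a b = \<zero>\<^bsub>?B\<^esub>"
      using Y.top_add(2)[of b "bdry Y c" a] b c by (simp add: Y.top_closed Y.peiffer Y.top_zero)
    show "\<Phi> x \<otimes>\<^bsub>Y.SD\<^esub> \<Phi> y = \<zero>\<^bsub>Y.SD\<^esub> \<and> \<Phi> y \<otimes>\<^bsub>Y.SD\<^esub> \<Phi> x = \<zero>\<^bsub>Y.SD\<^esub>"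
      using b c 1 2 by (simp add: Y.SD_simps Y.top_zero Y.top_closed)
  qed
  define \<Theta> where "\<Theta> = induced \<Phi>"
  have \<Theta>_pr: "\<Theta> (pr z) = \<Phi> z" if "z \<in> carrier UG" for z
    unfolding \<Theta>_def by (rule XI.induced_coset[OF \<Phi>.unital_alg_hom_axioms kills that])
  interpret \<Theta>: unital_alg_hom K Ub Y.SD \<Theta>
    by unfold_locales (unfold \<Theta>_def UL_bar_def, rule XI.induced_hom[OF \<Phi>.unital_alg_hom_axioms kills])
  \<comment> \<open>On \<open>Ker Sb\<close> the base component of \<open>\<Theta>\<close> vanishes,
    so the first component carries all the information and inherits linearity and multiplicativity
    from \<open>\<Theta>\<close>.\<close>
  define \<phi> where "\<phi> = (\<lambda>b. fst (\<Theta> b))"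
  have \<Theta>_ker: "\<Theta> b = (\<phi> b, \<zero>\<^bsub>Base Y\<^esub>)" "\<phi> b \<in> carrier ?B" "bdry Y (\<phi> b) = \<psi> (Tb b)"
    if b: "b \<in> carrier XT" for b
  proof -
    obtain z where z: "z \<in> carrier UG" "b = pr z" "S z = \<zero>\<^bsub>UP\<^esub>"
      using b unfolding Top_XUL_iff carrier_Ub by (auto simp: Sb_pr)
    have s: "snd (\<Phi> z) = \<zero>\<^bsub>Base Y\<^esub>" using \<Phi>S[OF z(1)] z(3) \<psi>0 by simp
    have c: "\<Phi> z \<in> carrier Y.SD" by (rule \<Phi>.hom_closed[OF z(1)])
    show "\<Theta> b = (\<phi> b, \<zero>\<^bsub>Base Y\<^esub>)" "\<phi> b \<in> carrier ?B"
      using s c z by (cases "\<Phi> z"; simp add: \<phi>_def \<Theta>_pr Y.SD_simps)+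
    show "bdry Y (\<phi> b) = \<psi> (Tb b)"
      using \<Phi>T[OF z(1)] s c z by (cases "\<Phi> z") (simp add: \<phi>_def \<Theta>_pr Y.SD_simps Tb_pr Y.top_closed)
  qed
  have \<Theta>_Ib: "\<Theta> (Ib a) = (\<zero>\<^bsub>?B\<^esub>, \<psi> a)" if "a \<in> carrier UP" for a
    using that by (simp add: Ib_eq \<Theta>_pr I.hom_closed \<Phi>I)
  have lin: "linear_map K XT ?B \<phi>"
  proof (rule linear_mapI)
    fix x assume x: "x \<in> carrier XT"
    show "\<phi> x \<in> carrier ?B" by (rule \<Theta>_ker(2)[OF x])
    have xU: "x \<in> carrier Ub" using x by (simp add: Top_XUL_iff)
    show "\<phi> (k \<odot>\<^bsub>XT\<^esub> x) = k \<odot>\<^bsub>?B\<^esub> \<phi> x" if k: "k \<in> carrier K" for k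
    proof -
      have "\<Theta> (k \<odot>\<^bsub>Ub\<^esub> x) = (k \<odot>\<^bsub>?B\<^esub> \<phi> x, k \<odot>\<^bsub>Base Y\<^esub> \<zero>\<^bsub>Base Y\<^esub>)"
        using \<Theta>.hom_smult[OF k xU] \<Theta>_ker(1)[OF x] by (simp add: Y.SD_simps(3))
      then show ?thesis by (simp add: XUL_simps \<phi>_def)
    qed
    fix y assume y: "y \<in> carrier XT"
    have yU: "y \<in> carrier Ub" using y by (simp add: Top_XUL_iff)
    show "\<phi> (x \<oplus>\<^bsub>XT\<^esub> y) = \<phi> x \<oplus>\<^bsub>?B\<^esub> \<phi> y"
    proof -
      have "\<Theta> (x \<oplus>\<^bsub>Ub\<^esub> y) = (\<phi> x \<oplus>\<^bsub>?B\<^esub> \<phi> y, \<zero>\<^bsub>Base Y\<^esub> \<oplus>\<^bsub>Base Y\<^esub> \<zero>\<^bsub>Base Y\<^esub>)"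
        using \<Theta>.hom_add[OF xU yU] \<Theta>_ker(1)[OF x] \<Theta>_ker(1)[OF y] by (simp add: Y.SD_simps(2))
      then show ?thesis by (simp add: XUL_simps \<phi>_def)
    qed
  qed
  have mult: "\<phi> (x \<otimes>\<^bsub>XT\<^esub> y) = \<phi> x \<otimes>\<^bsub>?B\<^esub> \<phi> y"
    if x: "x \<in> carrier XT" and y: "y \<in> carrier XT" for x y
  proof -
    have "\<Theta> (x \<otimes>\<^bsub>Ub\<^esub> y) = (\<phi> x \<otimes>\<^bsub>?B\<^esub> \<phi> y, \<zero>\<^bsub>Base Y\<^esub>)"
      using x y \<Theta>_ker by (simp add: \<Theta>.hom_mult Top_XUL_iff Y.SD_simps Y.top_closed Y.top_zero)
    then show ?thesis by (simp add: XUL_simps \<phi>_def)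
  qed
  have act: "\<phi> (b \<otimes>\<^bsub>Ub\<^esub> Ib a) = ract Y (\<phi> b) (\<psi> a)" "\<phi> (Ib a \<otimes>\<^bsub>Ub\<^esub> b) = lact Y (\<psi> a) (\<phi> b)"
    if a: "a \<in> carrier UP" and b: "b \<in> carrier XT" for a b
  proof -
    have cl: "b \<in> carrier Ub" "Ib a \<in> carrier Ub" "\<psi> a \<in> carrier (Base Y)"
      using a b by (auto simp: Top_XUL_iff Ib.hom_closed ualg_homD(1)[OF \<psi>(1)])
    have "\<Theta> (b \<otimes>\<^bsub>Ub\<^esub> Ib a) = (ract Y (\<phi> b) (\<psi> a), \<zero>\<^bsub>Base Y\<^esub>)"
      "\<Theta> (Ib a \<otimes>\<^bsub>Ub\<^esub> b) = (lact Y (\<psi> a) (\<phi> b), \<zero>\<^bsub>Base Y\<^esub>)"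
      using cl \<Theta>_ker(1,2)[OF b] \<Theta>_Ib[OF a]
      by (simp_all add: \<Theta>.hom_mult Y.SD_simps Y.top_closed Y.top_zero)
    then show "\<phi> (b \<otimes>\<^bsub>Ub\<^esub> Ib a) = ract Y (\<phi> b) (\<psi> a)" "\<phi> (Ib a \<otimes>\<^bsub>Ub\<^esub> b) = lact Y (\<psi> a) (\<phi> b)"
      by (simp_all add: \<phi>_def)
  qed
  have hom: "alg_xmod_hom K (XUL K X) Y \<phi> \<psi>"
    unfolding alg_xmod_hom_def
    using XUL.xmod Y.xmod \<psi>(1) lin mult act \<Theta>_ker(3)
    by (simp add: alg_hom_def ualg_hom_def XUL_simps(1-4))
  have "\<phi> (bl q) = dl q" "\<phi> (br q) = dr q" if "q \<in> carrier Q" for q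
    using that by (simp_all add: \<phi>_def bl_def br_def \<Theta>_pr emb_closed G.UL_gens_closed \<Phi>(2,3) LR)
  then show ?thesis using that[OF hom ualg_homD(5)[OF \<psi>(1)] \<psi>(2,3)] by blast
qed

end

section \<open>The endomorphism crossed module\<close>

lemma lin_iff:
  "f \<in> lin K V W \<longleftrightarrow> (\<forall>x. x \<notin> carrier V \<longrightarrow> f x = undefined) \<and> (\<forall>x\<in>carrier V. f x \<in> carrier W) \<and>
     (\<forall>x\<in>carrier V. \<forall>y\<in>carrier V. f (x \<oplus>\<^bsub>V\<^esub> y) = f x \<oplus>\<^bsub>W\<^esub> f y) \<and>
     (\<forall>k\<in>carrier K. \<forall>x\<in>carrier V. f (k \<odot>\<^bsub>V\<^esub> x) = k \<odot>\<^bsub>W\<^esub> f x)"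
  unfolding lin_def linear_map_def extensional_def by auto

locale two_term = V: module K V + W: module K W
  for K :: "'k ring" and V :: "('k, 'v) module" and W :: "('k, 'w) module" +
  fixes \<delta> assumes delta: "\<delta> \<in> lin K V W"
begin

abbreviation E where "E \<equiv> End_alg K V W \<delta>"
abbreviation H where "H \<equiv> Hom_alg K V W \<delta>"
abbreviation EndX where "EndX \<equiv> End_xmod K V W \<delta>"

lemma delta_simps:
  "v \<in> carrier V \<Longrightarrow> \<delta> v \<in> carrier W"
  "\<lbrakk>v \<in> carrier V; v' \<in> carrier V\<rbrakk> \<Longrightarrow> \<delta> (v \<oplus>\<^bsub>V\<^esub> v') = \<delta> v \<oplus>\<^bsub>W\<^esub> \<delta> v'"
  "\<lbrakk>k \<in> carrier K; v \<in> carrier V\<rbrakk> \<Longrightarrow> \<delta> (k \<odot>\<^bsub>V\<^esub> v) = k \<odot>\<^bsub>W\<^esub> \<delta> v"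
  "\<delta> \<zero>\<^bsub>V\<^esub> = \<zero>\<^bsub>W\<^esub>"
  using delta linear_map_zero[OF V.abelian_group_axioms W.abelian_group_axioms, of K \<delta>]
  unfolding lin_def linear_map_def by auto

lemma End_iff:
  "(\<alpha>, \<beta>) \<in> carrier E \<longleftrightarrow>
     \<alpha> \<in> lin K V V \<and> \<beta> \<in> lin K W W \<and> (\<forall>v\<in>carrier V. \<beta> (\<delta> v) = \<delta> (\<alpha> v))"
  by (simp add: End_alg_def)

lemma Hom_iff: "d \<in> carrier H \<longleftrightarrow> d \<in> lin K W V"
  by (simp add: Hom_alg_def)

lemma End_ops:
  "(\<alpha>, \<beta>) \<oplus>\<^bsub>E\<^esub> (\<alpha>', \<beta>')
    = (\<lambda>v\<in>carrier V. \<alpha> v \<oplus>\<^bsub>V\<^esub> \<alpha>' v, \<lambda>w\<in>carrier W. \<beta> w \<oplus>\<^bsub>W\<^esub> \<beta>' w)"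
  "k \<odot>\<^bsub>E\<^esub> (\<alpha>, \<beta>) = (\<lambda>v\<in>carrier V. k \<odot>\<^bsub>V\<^esub> \<alpha> v, \<lambda>w\<in>carrier W. k \<odot>\<^bsub>W\<^esub> \<beta> w)"
  "(\<alpha>, \<beta>) \<otimes>\<^bsub>E\<^esub> (\<alpha>', \<beta>') = (\<lambda>v\<in>carrier V. \<alpha> (\<alpha>' v), \<lambda>w\<in>carrier W. \<beta> (\<beta>' w))"
  "\<zero>\<^bsub>E\<^esub> = (\<lambda>v\<in>carrier V. \<zero>\<^bsub>V\<^esub>, \<lambda>w\<in>carrier W. \<zero>\<^bsub>W\<^esub>)"
  "\<one>\<^bsub>E\<^esub> = (\<lambda>v\<in>carrier V. v, \<lambda>w\<in>carrier W. w)"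
  by (simp_all add: End_alg_def compose_def)

lemma Hom_ops:
  "d \<oplus>\<^bsub>H\<^esub> d' = (\<lambda>w\<in>carrier W. d w \<oplus>\<^bsub>V\<^esub> d' w)"
  "k \<odot>\<^bsub>H\<^esub> d = (\<lambda>w\<in>carrier W. k \<odot>\<^bsub>V\<^esub> d w)"
  "d \<otimes>\<^bsub>H\<^esub> d' = (\<lambda>w\<in>carrier W. d (\<delta> (d' w)))"
  "\<zero>\<^bsub>H\<^esub> = (\<lambda>w\<in>carrier W. \<zero>\<^bsub>V\<^esub>)"
  by (simp_all add: Hom_alg_def)

lemma xmod_ops:
  "Top EndX = H" "Base EndX = E"
  "bdry EndX d = (\<lambda>v\<in>carrier V. d (\<delta> v), \<lambda>w\<in>carrier W. \<delta> (d w))"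
  "lact EndX (\<alpha>, \<beta>) d = (\<lambda>w\<in>carrier W. \<alpha> (d w))"
  "ract EndX d (\<alpha>, \<beta>) = (\<lambda>w\<in>carrier W. d (\<beta> w))"
  by (simp_all add: End_xmod_def compose_def)

lemmas VW_simps = V.smult_l_distr V.smult_r_distr V.smult_assoc1
  W.smult_l_distr W.smult_r_distr W.smult_assoc1
  V.M.a_ac W.M.a_ac V.M.l_neg W.M.l_neg V.m_comm V.smult_l_minus W.smult_l_minus

lemma smult_comm:
  "\<lbrakk>k \<in> carrier K; k' \<in> carrier K; v \<in> carrier V\<rbrakk>
    \<Longrightarrow> k \<odot>\<^bsub>V\<^esub> (k' \<odot>\<^bsub>V\<^esub> v) = k' \<odot>\<^bsub>V\<^esub> (k \<odot>\<^bsub>V\<^esub> v)"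
  "\<lbrakk>k \<in> carrier K; k' \<in> carrier K; w \<in> carrier W\<rbrakk>
    \<Longrightarrow> k \<odot>\<^bsub>W\<^esub> (k' \<odot>\<^bsub>W\<^esub> w) = k' \<odot>\<^bsub>W\<^esub> (k \<odot>\<^bsub>W\<^esub> w)"
  by (metis V.smult_assoc1 V.m_comm, metis W.smult_assoc1 V.m_comm)

lemma End_closed:
  "x \<in> carrier E \<Longrightarrow> y \<in> carrier E \<Longrightarrow> x \<oplus>\<^bsub>E\<^esub> y \<in> carrier E"
  "x \<in> carrier E \<Longrightarrow> y \<in> carrier E \<Longrightarrow> x \<otimes>\<^bsub>E\<^esub> y \<in> carrier E"
  "k \<in> carrier K \<Longrightarrow> x \<in> carrier E \<Longrightarrow> k \<odot>\<^bsub>E\<^esub> x \<in> carrier E"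
  "\<zero>\<^bsub>E\<^esub> \<in> carrier E" "\<one>\<^bsub>E\<^esub> \<in> carrier E"
  by (cases x; cases y;
      auto simp: End_iff End_ops lin_iff delta_simps smult_comm VW_simps)+

lemma Hom_closed:
  "x \<in> carrier H \<Longrightarrow> y \<in> carrier H \<Longrightarrow> x \<oplus>\<^bsub>H\<^esub> y \<in> carrier H"
  "x \<in> carrier H \<Longrightarrow> y \<in> carrier H \<Longrightarrow> x \<otimes>\<^bsub>H\<^esub> y \<in> carrier H"
  "k \<in> carrier K \<Longrightarrow> x \<in> carrier H \<Longrightarrow> k \<odot>\<^bsub>H\<^esub> x \<in> carrier H"
  "\<zero>\<^bsub>H\<^esub> \<in> carrier H"
  by (auto simp: Hom_iff Hom_ops lin_iff delta_simps smult_comm VW_simps)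

text \<open>Exhibits the additive inverse as \<open>(-1) x\<close>, which has an explicit pointwise
  value; this gives the group axiom and later the formula for differences in
  \<open>End_minus\<close>.\<close>

lemma End_neg: "x \<in> carrier E \<Longrightarrow> (\<ominus>\<^bsub>K\<^esub> \<one>\<^bsub>K\<^esub>) \<odot>\<^bsub>E\<^esub> x \<oplus>\<^bsub>E\<^esub> x = \<zero>\<^bsub>E\<^esub>"
  by (cases x) (auto simp: End_iff End_ops lin_iff V.smult_l_minus W.smult_l_minus V.M.l_neg W.M.l_neg)

lemma Hom_neg: "x \<in> carrier H \<Longrightarrow> (\<ominus>\<^bsub>K\<^esub> \<one>\<^bsub>K\<^esub>) \<odot>\<^bsub>H\<^esub> x \<oplus>\<^bsub>H\<^esub> x = \<zero>\<^bsub>H\<^esub>"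
  by (auto simp: Hom_iff Hom_ops lin_iff V.smult_l_minus V.M.l_neg)

lemma End_unital_algebra: "unital_algebra K E"
proof -
  have ab: "abelian_group E"
  proof (rule abelian_groupI)
    show "\<exists>y\<in>carrier E. y \<oplus>\<^bsub>E\<^esub> x = \<zero>\<^bsub>E\<^esub>" if "x \<in> carrier E" for x
      using End_neg[OF that] End_closed(3)[OF _ that, of "\<ominus>\<^bsub>K\<^esub> \<one>\<^bsub>K\<^esub>"] by auto
  qed (auto intro: End_closed, auto simp: End_iff End_ops lin_iff fun_eq_iff restrict_def VW_simps)
  have mon: "Group.monoid E"
    by (rule monoidI, auto intro: End_closed)
      (auto simp: End_iff End_ops lin_iff fun_eq_iff restrict_def)
  have "ring E"
    by (rule ringI[OF ab mon]) (auto simp: End_iff End_ops lin_iff fun_eq_iff restrict_def)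
  with ab show ?thesis
    by (intro unital_algebra.intro moduleI unital_algebra_axioms.intro V.R.cring_axioms)
      (auto intro: End_closed, auto simp: End_iff End_ops lin_iff fun_eq_iff restrict_def VW_simps)
qed

lemma Hom_module: "module K H"
proof -
  have "abelian_group H"
  proof (rule abelian_groupI)
    show "\<exists>y\<in>carrier H. y \<oplus>\<^bsub>H\<^esub> x = \<zero>\<^bsub>H\<^esub>" if "x \<in> carrier H" for x
      using Hom_neg[OF that] Hom_closed(3)[OF _ that, of "\<ominus>\<^bsub>K\<^esub> \<one>\<^bsub>K\<^esub>"] by auto
  qed (auto intro: Hom_closed, auto simp: Hom_iff Hom_ops lin_iff fun_eq_iff restrict_def VW_simps)
  then show ?thesis
    by (intro moduleI V.R.cring_axioms)
      (auto intro: Hom_closed, auto simp: Hom_iff Hom_ops lin_iff fun_eq_iff restrict_def VW_simps)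
qed

lemma End_xmod_crossed: "alg_crossed_module K EndX"
proof -
  have alg: "assoc_algebra K H"
    unfolding assoc_algebra_def bilinear_map_def
    using Hom_module
    by (auto intro!: linear_mapI intro: Hom_closed)
      (auto simp: Hom_iff Hom_ops lin_iff fun_eq_iff restrict_def delta_simps)
  have hom: "alg_hom K H E (bdry EndX)"
    unfolding alg_hom_def
    by (auto intro!: linear_mapI simp: xmod_ops Hom_iff Hom_ops End_ops End_iff lin_iff
        fun_eq_iff restrict_def delta_simps VW_simps smult_comm)
  have act: "alg_action K E H (lact EndX) (ract EndX)"
    unfolding alg_action_def bilinear_map_def
    by (auto intro!: linear_mapI simp: xmod_ops Hom_iff Hom_ops End_ops End_iff lin_iff
        fun_eq_iff restrict_def delta_simps VW_simps smult_comm)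
  show ?thesis
    unfolding alg_crossed_module_def xmod_ops(1,2)
    using alg End_unital_algebra[THEN unital_algebra.assoc_algebra] hom act
    by (auto simp: xmod_ops Hom_iff Hom_ops End_ops End_iff lin_iff
        fun_eq_iff restrict_def delta_simps)
qed

lemma End_unital_xmod: "unital_xmod K EndX"
  by (intro unital_xmod.intro unital_xmod_axioms.intro End_xmod_crossed, unfold xmod_ops(1,2) End_ops(5))
    (auto simp: End_unital_algebra xmod_ops Hom_iff lin_iff fun_eq_iff)

end

section \<open>Actions and modules over the enveloping algebra\<close>

text \<open>This makes the method \<open>algebra\<close> available for abelian groups and modules.\<close>

lemmas (in abelian_group) abelian_group_simprules
  [algebra abelian_group "zero G" "add G" "a_inv G" "a_minus G"] =
  a_closed zero_closed a_inv_closed minus_closed a_assoc l_zero l_neg a_comm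
  r_zero r_neg r_neg2 r_neg1 minus_add minus_minus minus_zero a_lcomm a_minus_def

text \<open>Meant for two identities of a Leibniz action, with \<open>a = [[x, y], v]\<close> and
  \<open>c = [[x, v], y]\<close>. Each expresses one of the two through the other, and comparison
  leaves \<open>[x, [y, v]] = - [x, [v, y]]\<close>.\<close>

lemma (in abelian_group) cycle_cancel:
  assumes "a = b \<oplus> c" "c = d \<oplus> a"
    and mem: "a \<in> carrier G" "c \<in> carrier G" "b \<in> carrier G" "d \<in> carrier G"
  shows "b = \<ominus> d"
proof -
  have "a = (b \<oplus> d) \<oplus> a"
    using assms(1) mem unfolding assms(2) by (simp add: a_assoc)
  then have "b \<oplus> d = \<zero>"
    using mem by (metis add.r_cancel_one' a_closed)
  then show ?thesis using mem by (metis minus_equality)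
qed

lemma linear_map_cong:
  assumes "module K V" "linear_map K V W f" "\<And>x. x \<in> carrier V \<Longrightarrow> g x = f x"
  shows "linear_map K V W g"
proof -
  interpret V: module K V by fact
  show ?thesis using assms(2) by (auto simp: linear_map_def assms(3) Pi_iff)
qed

lemma linear_map_sum:
  assumes "module K W" "linear_map K V W f" "linear_map K V W g"
  shows "linear_map K V W (\<lambda>x. f x \<oplus>\<^bsub>W\<^esub> g x)"
proof -
  interpret W: module K W by fact
  show ?thesis
    by (rule linear_mapI)
      (simp_all add: linear_mapD[OF assms(2)] linear_mapD[OF assms(3)] W.smult_r_distr W.M.a_ac)
qed

lemma linear_map_neg:
  assumes "module K W" "linear_map K V W f"
  shows "linear_map K V W (\<lambda>x. \<ominus>\<^bsub>W\<^esub> f x)"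
proof -
  interpret W: module K W by fact
  show ?thesis
    by (rule linear_mapI)
      (simp_all add: linear_mapD[OF assms(2)] W.smult_r_minus W.M.minus_add W.M.a_ac)
qed

lemma bilinear_mapD:
  assumes "bilinear_map K U V W f"
  shows "u \<in> carrier U \<Longrightarrow> linear_map K V W (f u)" "v \<in> carrier V \<Longrightarrow> linear_map K U W (\<lambda>u. f u v)"
  using assms unfolding bilinear_map_def by auto

lemma bilinear_flip:
  "bilinear_map K U V W f \<Longrightarrow> bilinear_map K V U W (\<lambda>v u. f u v)"
  unfolding bilinear_map_def by auto

lemma bilinear_cong:
  assumes "module K U" "module K V" "bilinear_map K U V W f"
    "\<And>u v. u \<in> carrier U \<Longrightarrow> v \<in> carrier V \<Longrightarrow> g u v = f u v"
  shows "bilinear_map K U V W g"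
  unfolding bilinear_map_def
  using assms(4) linear_map_cong[OF assms(2) bilinear_mapD(1)[OF assms(3)]]
    linear_map_cong[OF assms(1) bilinear_mapD(2)[OF assms(3)]] by simp

lemma bilinear_sum:
  assumes "module K W" "bilinear_map K U V W f" "bilinear_map K U V W g"
  shows "bilinear_map K U V W (\<lambda>u v. f u v \<oplus>\<^bsub>W\<^esub> g u v)"
  using assms unfolding bilinear_map_def by (simp add: linear_map_sum)

lemma bilinear_neg:
  assumes "module K W" "bilinear_map K U V W f"
  shows "bilinear_map K U V W (\<lambda>u v. \<ominus>\<^bsub>W\<^esub> f u v)"
  using assms unfolding bilinear_map_def by (simp add: linear_map_neg)

text \<open>A left UL(P)-module structure on \<open>V\<close>, described by the actions
  \<open>l\<close> and \<open>r\<close> of the generators: the relations of \<open>UL_data\<close>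
  evaluated at vectors.\<close>

definition UL_act ::
  "'k ring \<Rightarrow> ('k, 'p) module \<Rightarrow> ('k, 'v) module \<Rightarrow> ('p \<Rightarrow> 'v \<Rightarrow> 'v) \<Rightarrow> ('p \<Rightarrow> 'v \<Rightarrow> 'v) \<Rightarrow> bool"
where
  "UL_act K P V l r \<longleftrightarrow> bilinear_map K P V V l \<and> bilinear_map K P V V r \<and>
     (\<forall>x\<in>carrier P. \<forall>y\<in>carrier P. \<forall>v\<in>carrier V.
        r (x \<otimes>\<^bsub>P\<^esub> y) v = r x (r y v) \<ominus>\<^bsub>V\<^esub> r y (r x v) \<and>
        l (x \<otimes>\<^bsub>P\<^esub> y) v = l x (r y v) \<ominus>\<^bsub>V\<^esub> r y (l x v) \<and>
        r y (l x v) \<oplus>\<^bsub>V\<^esub> l y (l x v) = \<zero>\<^bsub>V\<^esub>)"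

text \<open>The sum of the two new actions is the old left one, \<open>[p, v]\<close>. Hence
  \<open>(y_r + y_l) x_l = 0\<close> reads \<open>[y, [x, v] + [v, x]] = 0\<close>, which
  \<open>cycle_cancel\<close> extracts from the first two identities of the action.\<close>

lemma UL_act_of_leibniz_action:
  assumes V: "module K V" and P: "bracket_module K P" and act: "leibniz_action K P V lV rV"
  shows "UL_act K P V (\<lambda>p v. lV p v \<oplus>\<^bsub>V\<^esub> rV v p) (\<lambda>p v. \<ominus>\<^bsub>V\<^esub> rV v p)"
proof -
  interpret V: module K V by fact
  interpret P: bracket_module K P by fact
  have bil: "bilinear_map K P V V lV" "bilinear_map K P V V (\<lambda>p v. rV v p)"
    using act bilinear_flip unfolding leibniz_action_def by blast+
  note lin = bilinear_mapD(1)[OF bil(1)] bilinear_mapD(1)[OF bil(2)]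
  note cl = lin[THEN linear_mapD(1)]
  note ad = lin[THEN linear_mapD(2)]
  note um = lin[THEN linear_map_uminus[OF V.abelian_group_axioms V.abelian_group_axioms]]
  show ?thesis
    unfolding UL_act_def
  proof (intro conjI ballI bilinear_sum[OF V bil] bilinear_neg[OF V bil(2)])
    fix x y v assume xyv: "x \<in> carrier P" "y \<in> carrier P" "v \<in> carrier V"
    have e: "lV (x \<otimes>\<^bsub>P\<^esub> y) v = lV x (lV y v) \<oplus>\<^bsub>V\<^esub> rV (lV x v) y"
      "rV (lV x v) y = lV x (rV v y) \<oplus>\<^bsub>V\<^esub> lV (x \<otimes>\<^bsub>P\<^esub> y) v"
      "rV (rV v x) y = rV v (x \<otimes>\<^bsub>P\<^esub> y) \<oplus>\<^bsub>V\<^esub> rV (rV v y) x"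
      "rV (lV y v) x = lV y (rV v x) \<oplus>\<^bsub>V\<^esub> lV (y \<otimes>\<^bsub>P\<^esub> x) v"
      "lV (y \<otimes>\<^bsub>P\<^esub> x) v = lV y (lV x v) \<oplus>\<^bsub>V\<^esub> rV (lV y v) x"
      using act xyv unfolding leibniz_action_def by blast+
    note mem = cl(1)[OF xyv(1)] cl(1)[OF xyv(2)] cl(2)[OF xyv(1)] cl(2)[OF xyv(2)]
      P.bracket_closed[OF xyv(1,2)] P.bracket_closed[OF xyv(2,1)]
    have m: "lV x (lV y v) \<in> carrier V" "lV x (rV v y) \<in> carrier V" "rV (lV x v) y \<in> carrier V"
      "rV (rV v x) y \<in> carrier V" "rV (rV v y) x \<in> carrier V" "rV v (x \<otimes>\<^bsub>P\<^esub> y) \<in> carrier V"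
      "rV (lV y v) x \<in> carrier V" "lV y (lV x v) \<in> carrier V" "lV y (rV v x) \<in> carrier V"
      "lV x v \<in> carrier V" "rV v x \<in> carrier V" "lV y v \<in> carrier V" "rV v y \<in> carrier V"
      using mem xyv cl by auto
    have m': "lV (x \<otimes>\<^bsub>P\<^esub> y) v \<in> carrier V" and m'': "lV (y \<otimes>\<^bsub>P\<^esub> x) v \<in> carrier V"
      using cl xyv P.bracket_closed by auto
    have k: "lV x (lV y v) = \<ominus>\<^bsub>V\<^esub> lV x (rV v y)"
      by (rule V.M.cycle_cancel[OF e(1,2) m' m(3,1,2)])
    have k': "lV y (lV x v) = \<ominus>\<^bsub>V\<^esub> lV y (rV v x)"
      by (rule V.M.cycle_cancel[OF e(5,4) m'' m(7,8,9)])
    note rw = um(1)[OF xyv(1)] um(1)[OF xyv(2)] um(2)[OF xyv(1)] um(2)[OF xyv(2)]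
      ad(1)[OF xyv(1)] ad(1)[OF xyv(2)] ad(2)[OF xyv(1)] ad(2)[OF xyv(2)]
    show "\<ominus>\<^bsub>V\<^esub> rV v (x \<otimes>\<^bsub>P\<^esub> y)
      = \<ominus>\<^bsub>V\<^esub> rV (\<ominus>\<^bsub>V\<^esub> rV v y) x \<ominus>\<^bsub>V\<^esub> (\<ominus>\<^bsub>V\<^esub> rV (\<ominus>\<^bsub>V\<^esub> rV v x) y)"
      using m e(3) by (simp only: rw, algebra)
    show "lV (x \<otimes>\<^bsub>P\<^esub> y) v \<oplus>\<^bsub>V\<^esub> rV v (x \<otimes>\<^bsub>P\<^esub> y)
      = lV x (\<ominus>\<^bsub>V\<^esub> rV v y) \<oplus>\<^bsub>V\<^esub> rV (\<ominus>\<^bsub>V\<^esub> rV v y) x \<ominus>\<^bsub>V\<^esub> \<ominus>\<^bsub>V\<^esub> rV (lV x v \<oplus>\<^bsub>V\<^esub> rV v x) y"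
      using m e(3) by (simp only: rw e(1) k, algebra)
    show "\<ominus>\<^bsub>V\<^esub> rV (lV x v \<oplus>\<^bsub>V\<^esub> rV v x) y
        \<oplus>\<^bsub>V\<^esub> (lV y (lV x v \<oplus>\<^bsub>V\<^esub> rV v x) \<oplus>\<^bsub>V\<^esub> rV (lV x v \<oplus>\<^bsub>V\<^esub> rV v x) y) = \<zero>\<^bsub>V\<^esub>"
      using m by (simp only: rw k', algebra)
  qed
qed

text \<open>The maps \<open>lV\<close> and \<open>rV\<close> are prescribed on the carriers only, to
  admit maps that are \<open>undefined\<close> elsewhere. The identities with one vector undo the
  change of generators; those with two vectors hold since the bracket of \<open>V\<close> is
  zero.\<close>

lemma leibniz_action_of_UL_act:
  assumes V: "module K V" "mult V = (\<lambda>_ _. \<zero>\<^bsub>V\<^esub>)" and P: "bracket_module K P"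
    and act: "UL_act K P V l r"
    and lV: "\<And>p v. p \<in> carrier P \<Longrightarrow> v \<in> carrier V \<Longrightarrow> lV p v = l p v \<oplus>\<^bsub>V\<^esub> r p v"
    and rV: "\<And>p v. p \<in> carrier P \<Longrightarrow> v \<in> carrier V \<Longrightarrow> rV v p = \<ominus>\<^bsub>V\<^esub> r p v"
  shows "leibniz_action K P V lV rV"
proof -
  interpret V: module K V by fact
  interpret P: bracket_module K P by fact
  have bil: "bilinear_map K P V V l" "bilinear_map K P V V r"
    using act unfolding UL_act_def by auto
  have bil': "bilinear_map K P V V lV" "bilinear_map K V P V rV"
    using bilinear_cong[OF P.P.module_axioms V(1) bilinear_sum[OF V(1) bil] lV]
      bilinear_cong[OF V(1) P.P.module_axioms bilinear_flip[OF bilinear_neg[OF V(1) bil(2)]] rV]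
    by auto
  note lin = bilinear_mapD(1)[OF bil(1)] bilinear_mapD(1)[OF bil(2)]
  note cl = lin[THEN linear_mapD(1)]
  note ad = lin[THEN linear_mapD(2)]
  note um = lin[THEN linear_map_uminus[OF V.abelian_group_axioms V.abelian_group_axioms]]
  have zero: "lV p \<zero>\<^bsub>V\<^esub> = \<zero>\<^bsub>V\<^esub>" "rV \<zero>\<^bsub>V\<^esub> p = \<zero>\<^bsub>V\<^esub>" if "p \<in> carrier P" for p
    using linear_map_zero[OF V.abelian_group_axioms V.abelian_group_axioms bilinear_mapD(1)[OF bil'(1) that]]
      linear_map_zero[OF V.abelian_group_axioms V.abelian_group_axioms bilinear_mapD(2)[OF bil'(2) that]]
    by simp_all
  show ?thesis
    unfolding leibniz_action_def
  proof (intro conjI ballI bil')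
    fix x y v assume xyv: "x \<in> carrier P" "y \<in> carrier P" "v \<in> carrier V"
    have xy: "x \<otimes>\<^bsub>P\<^esub> y \<in> carrier P" by (rule P.bracket_closed[OF xyv(1,2)])
    have e: "r (x \<otimes>\<^bsub>P\<^esub> y) v = r x (r y v) \<ominus>\<^bsub>V\<^esub> r y (r x v)"
      "l (x \<otimes>\<^bsub>P\<^esub> y) v = l x (r y v) \<ominus>\<^bsub>V\<^esub> r y (l x v)"
      "r x (l y v) \<oplus>\<^bsub>V\<^esub> l x (l y v) = \<zero>\<^bsub>V\<^esub>"
      using act xyv unfolding UL_act_def by blast+
    have m0: "r x v \<in> carrier V" "r y v \<in> carrier V" "l x v \<in> carrier V" "l y v \<in> carrier V"
      using xyv cl by auto
    have m: "r x (r y v) \<in> carrier V" "r x (l y v) \<in> carrier V" "r y (r x v) \<in> carrier V"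
      "r y (l x v) \<in> carrier V" "l x (r y v) \<in> carrier V" "l x (l y v) \<in> carrier V"
      using xyv m0 cl by auto
    have k: "l x (l y v) = \<ominus>\<^bsub>V\<^esub> r x (l y v)"
      using e(3) m by (simp add: V.M.a_comm V.M.minus_equality)
    note rw = um(1)[OF xyv(1)] um(1)[OF xyv(2)] um(2)[OF xyv(1)] um(2)[OF xyv(2)]
      ad(1)[OF xyv(1)] ad(1)[OF xyv(2)] ad(2)[OF xyv(1)] ad(2)[OF xyv(2)]
      lV[OF xyv(1)] lV[OF xyv(2)] rV[OF xyv(1)] rV[OF xyv(2)] lV[OF xy] rV[OF xy]
      V.M.a_inv_closed V.M.a_closed xyv(3) e(1,2) k
    show "lV (x \<otimes>\<^bsub>P\<^esub> y) v = lV x (lV y v) \<oplus>\<^bsub>V\<^esub> rV (lV x v) y"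
      "rV (lV x v) y = lV x (rV v y) \<oplus>\<^bsub>V\<^esub> lV (x \<otimes>\<^bsub>P\<^esub> y) v"
      "rV (rV v x) y = rV v (x \<otimes>\<^bsub>P\<^esub> y) \<oplus>\<^bsub>V\<^esub> rV (rV v y) x"
      using m m0 by (simp only: rw, algebra)+
  qed (auto simp: V(2) zero)
qed

text \<open>\<open>XUL_data\<close> for the endomorphism crossed module, evaluated at vectors: the
  generators of the base act by \<open>l\<close>, \<open>r\<close> on \<open>V\<close> and by
  \<open>l'\<close>, \<open>r'\<close> on \<open>W\<close>, while \<open>x\<close> and
  \<open>y\<close> are the maps from \<open>W\<close> to \<open>V\<close> given by
  \<open>q_l\<close> and \<open>q_r\<close>.\<close>

definition XUL_act ::
  "'k ring \<Rightarrow> ('k, 'q, 'p) xmod \<Rightarrow> ('k, 'v) module \<Rightarrow> ('k, 'w) module \<Rightarrow> ('v \<Rightarrow> 'w)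
    \<Rightarrow> ('p \<Rightarrow> 'v \<Rightarrow> 'v) \<Rightarrow> ('p \<Rightarrow> 'v \<Rightarrow> 'v) \<Rightarrow> ('p \<Rightarrow> 'w \<Rightarrow> 'w) \<Rightarrow> ('p \<Rightarrow> 'w \<Rightarrow> 'w)
    \<Rightarrow> ('q \<Rightarrow> 'w \<Rightarrow> 'v) \<Rightarrow> ('q \<Rightarrow> 'w \<Rightarrow> 'v) \<Rightarrow> bool"
where
  "XUL_act K X V W \<delta> l r l' r' x y \<longleftrightarrow>
     UL_act K (Base X) V l r \<and> UL_act K (Base X) W l' r' \<and>
     bilinear_map K (Top X) W V x \<and> bilinear_map K (Top X) W V y \<and>
     (\<forall>p\<in>carrier (Base X). \<forall>v\<in>carrier V.
        \<delta> (l p v) = l' p (\<delta> v) \<and> \<delta> (r p v) = r' p (\<delta> v)) \<and>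
     (\<forall>q\<in>carrier (Top X). \<forall>v\<in>carrier V.
        x q (\<delta> v) = l (bdry X q) v \<and> y q (\<delta> v) = r (bdry X q) v) \<and>
     (\<forall>q\<in>carrier (Top X). \<forall>w\<in>carrier W.
        \<delta> (x q w) = l' (bdry X q) w \<and> \<delta> (y q w) = r' (bdry X q) w) \<and>
     (\<forall>p\<in>carrier (Base X). \<forall>q\<in>carrier (Top X). \<forall>w\<in>carrier W.
        y (lact X p q) w = r p (y q w) \<ominus>\<^bsub>V\<^esub> y q (r' p w) \<and>
        x (lact X p q) w = l p (y q w) \<ominus>\<^bsub>V\<^esub> y q (l' p w) \<and>
        y (ract X q p) w = y q (r' p w) \<ominus>\<^bsub>V\<^esub> r p (y q w) \<and>
        x (ract X q p) w = x q (r' p w) \<ominus>\<^bsub>V\<^esub> r p (x q w) \<and>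
        r p (x q w) \<oplus>\<^bsub>V\<^esub> l p (x q w) = \<zero>\<^bsub>V\<^esub> \<and>
        y q (l' p w) \<oplus>\<^bsub>V\<^esub> x q (l' p w) = \<zero>\<^bsub>V\<^esub>)"

context leibniz_xmod
begin

text \<open>The actions of \<open>p_l + p_r\<close> are \<open>rep_lN\<close> and
  \<open>rep_lM\<close>, and \<open>q_l + q_r\<close> acts by \<open>rep_xi1\<close>. So the two
  vanishing relations say that \<open>rep_xi1\<close> kills \<open>[p, m] + [m, p]\<close> and that
  \<open>[p, _]\<close> kills the sum of the two \<xi> maps, which are the last two mixed axioms.
  The remaining mixed relations are linear combinations of the axioms for \<open>[p, q]\<close> and
  \<open>[q, p]\<close>.\<close>

lemma XUL_act_of_rep:
  assumes R: "is_rep K X R"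
  defines "V \<equiv> rep_N R" and "W \<equiv> rep_M R"
  shows "XUL_act K X V W (rep_mu R)
    (\<lambda>p v. rep_lN R p v \<oplus>\<^bsub>V\<^esub> rep_rN R v p) (\<lambda>p v. \<ominus>\<^bsub>V\<^esub> rep_rN R v p)
    (\<lambda>p w. rep_lM R p w \<oplus>\<^bsub>W\<^esub> rep_rM R w p) (\<lambda>p w. \<ominus>\<^bsub>W\<^esub> rep_rM R w p)
    (\<lambda>q w. rep_xi1 R q w \<oplus>\<^bsub>V\<^esub> rep_xi2 R w q) (\<lambda>q w. \<ominus>\<^bsub>V\<^esub> rep_xi2 R w q)"
proof -
  note R = R[unfolded is_rep_def Let_def, folded V_def W_def]
  have VW: "module K V" "module K W" using R unfolding abelian_module_def by blast+
  interpret V: module K V by (rule VW)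
  interpret W: module K W by (rule VW)
  have act: "leibniz_action K P V (rep_lN R) (rep_rN R)" "leibniz_action K P W (rep_lM R) (rep_rM R)"
    using R by blast+
  have xi: "bilinear_map K Q W V (rep_xi1 R)" "bilinear_map K W Q V (rep_xi2 R)"
    using R by blast+
  have bil: "bilinear_map K P V V (rep_lN R)" "bilinear_map K P V V (\<lambda>p v. rep_rN R v p)"
    "bilinear_map K P W W (rep_lM R)" "bilinear_map K P W W (\<lambda>p v. rep_rM R v p)"
    "bilinear_map K Q W V (rep_xi1 R)" "bilinear_map K Q W V (\<lambda>q m. rep_xi2 R m q)"
    using act(1)[unfolded leibniz_action_def, THEN conjunct1]
      act(1)[unfolded leibniz_action_def, THEN conjunct2, THEN conjunct1, THEN bilinear_flip]
      act(2)[unfolded leibniz_action_def, THEN conjunct1]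
      act(2)[unfolded leibniz_action_def, THEN conjunct2, THEN conjunct1, THEN bilinear_flip]
      xi(1) xi(2)[THEN bilinear_flip]
    by this+
  note lin = bilinear_mapD(1)[OF bil(1)] bilinear_mapD(1)[OF bil(2)] bilinear_mapD(1)[OF bil(3)]
    bilinear_mapD(1)[OF bil(4)] bilinear_mapD(1)[OF bil(5)] bilinear_mapD(1)[OF bil(6)]
  note cl = lin[THEN linear_mapD(1)]
  note ad = lin[THEN linear_mapD(2)]
  note umV = lin(1)[THEN linear_map_uminus[OF V.abelian_group_axioms V.abelian_group_axioms]]
    lin(2)[THEN linear_map_uminus[OF V.abelian_group_axioms V.abelian_group_axioms]]
  note umW = lin(5)[THEN linear_map_uminus[OF W.abelian_group_axioms V.abelian_group_axioms]]
    lin(6)[THEN linear_map_uminus[OF W.abelian_group_axioms V.abelian_group_axioms]]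
  have mu: "linear_map K V W (rep_mu R)" using R unfolding lin_def by blast
  note muD = linear_mapD[OF mu] linear_map_uminus[OF V.abelian_group_axioms W.abelian_group_axioms mu]
  show ?thesis
    unfolding XUL_act_def
  proof (intro conjI ballI)
    show "UL_act K P V (\<lambda>p v. rep_lN R p v \<oplus>\<^bsub>V\<^esub> rep_rN R v p) (\<lambda>p v. \<ominus>\<^bsub>V\<^esub> rep_rN R v p)"
      "UL_act K P W (\<lambda>p w. rep_lM R p w \<oplus>\<^bsub>W\<^esub> rep_rM R w p) (\<lambda>p w. \<ominus>\<^bsub>W\<^esub> rep_rM R w p)"
      by (intro UL_act_of_leibniz_action VW P.bracket_module_axioms act)+
    show "bilinear_map K Q W V (\<lambda>q w. rep_xi1 R q w \<oplus>\<^bsub>V\<^esub> rep_xi2 R w q)"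
      "bilinear_map K Q W V (\<lambda>q w. \<ominus>\<^bsub>V\<^esub> rep_xi2 R w q)"
      by (intro bilinear_sum bilinear_neg VW bil)+
  next
    fix p v assume pv: "p \<in> carrier P" "v \<in> carrier V"
    then have "rep_mu R (rep_lN R p v) = rep_lM R p (rep_mu R v)"
      "rep_mu R (rep_rN R v p) = rep_rM R (rep_mu R v) p"
      using R by blast+
    then show "rep_mu R (rep_lN R p v \<oplus>\<^bsub>V\<^esub> rep_rN R v p)
        = rep_lM R p (rep_mu R v) \<oplus>\<^bsub>W\<^esub> rep_rM R (rep_mu R v) p"
      "rep_mu R (\<ominus>\<^bsub>V\<^esub> rep_rN R v p) = \<ominus>\<^bsub>W\<^esub> rep_rM R (rep_mu R v) p"
      using pv cl by (simp_all add: muD)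
  next
    fix q v assume qv: "q \<in> carrier Q" "v \<in> carrier V"
    then have "rep_xi2 R (rep_mu R v) q = rep_rN R v (\<eta> q)"
      "rep_xi1 R q (rep_mu R v) = rep_lN R (\<eta> q) v"
      using R by blast+
    then show "rep_xi1 R q (rep_mu R v) \<oplus>\<^bsub>V\<^esub> rep_xi2 R (rep_mu R v) q
        = rep_lN R (\<eta> q) v \<oplus>\<^bsub>V\<^esub> rep_rN R v (\<eta> q)"
      "\<ominus>\<^bsub>V\<^esub> rep_xi2 R (rep_mu R v) q = \<ominus>\<^bsub>V\<^esub> rep_rN R v (\<eta> q)"
      by simp_all
  next
    fix q w assume qw: "q \<in> carrier Q" "w \<in> carrier W"
    then have "rep_mu R (rep_xi2 R w q) = rep_rM R w (\<eta> q)"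
      "rep_mu R (rep_xi1 R q w) = rep_lM R (\<eta> q) w"
      using R by blast+
    then show "rep_mu R (rep_xi1 R q w \<oplus>\<^bsub>V\<^esub> rep_xi2 R w q)
        = rep_lM R (\<eta> q) w \<oplus>\<^bsub>W\<^esub> rep_rM R w (\<eta> q)"
      "rep_mu R (\<ominus>\<^bsub>V\<^esub> rep_xi2 R w q) = \<ominus>\<^bsub>W\<^esub> rep_rM R w (\<eta> q)"
      using qw cl by (simp_all add: muD)
  next
    fix p q w assume pqw: "p \<in> carrier P" "q \<in> carrier Q" "w \<in> carrier W"
    have e: "rep_xi2 R w (lact X p q) = rep_xi2 R (rep_rM R w p) q \<ominus>\<^bsub>V\<^esub> rep_rN R (rep_xi2 R w q) p"
      "rep_xi1 R (lact X p q) w = rep_xi2 R (rep_lM R p w) q \<ominus>\<^bsub>V\<^esub> rep_lN R p (rep_xi2 R w q)"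
      "rep_xi2 R w (ract X q p) = rep_rN R (rep_xi2 R w q) p \<ominus>\<^bsub>V\<^esub> rep_xi2 R (rep_rM R w p) q"
      "rep_xi1 R (ract X q p) w = rep_rN R (rep_xi1 R q w) p \<ominus>\<^bsub>V\<^esub> rep_xi1 R q (rep_rM R w p)"
      "rep_xi1 R q (rep_lM R p w) = \<ominus>\<^bsub>V\<^esub> rep_xi1 R q (rep_rM R w p)"
      "rep_lN R p (rep_xi1 R q w) = \<ominus>\<^bsub>V\<^esub> rep_lN R p (rep_xi2 R w q)"
      using R pqw by blast+
    have m0: "rep_xi1 R q w \<in> carrier V" "rep_xi2 R w q \<in> carrier V"
      "rep_lM R p w \<in> carrier W" "rep_rM R w p \<in> carrier W"
      using pqw by (simp_all add: cl)
    have m: "rep_rN R (rep_xi1 R q w) p \<in> carrier V" "rep_rN R (rep_xi2 R w q) p \<in> carrier V"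
      "rep_lN R p (rep_xi2 R w q) \<in> carrier V"
      "rep_xi1 R q (rep_rM R w p) \<in> carrier V" "rep_xi2 R (rep_rM R w p) q \<in> carrier V"
      "rep_xi2 R (rep_lM R p w) q \<in> carrier V"
      using pqw m0 by (simp_all add: cl)
    note rw = umV(1)[OF pqw(1)] umV(2)[OF pqw(1)] umW(1)[OF pqw(2)] umW(2)[OF pqw(2)]
      ad(1)[OF pqw(1)] ad(2)[OF pqw(1)] ad(5)[OF pqw(2)] ad(6)[OF pqw(2)] m0
      V.M.a_inv_closed V.M.a_closed W.M.a_inv_closed W.M.a_closed e
    show "\<ominus>\<^bsub>V\<^esub> rep_xi2 R w (lact X p q)
      = \<ominus>\<^bsub>V\<^esub> rep_rN R (\<ominus>\<^bsub>V\<^esub> rep_xi2 R w q) p \<ominus>\<^bsub>V\<^esub> \<ominus>\<^bsub>V\<^esub> rep_xi2 R (\<ominus>\<^bsub>W\<^esub> rep_rM R w p) q"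
      using m m0 by (simp only: rw, algebra)
    show "rep_xi1 R (lact X p q) w \<oplus>\<^bsub>V\<^esub> rep_xi2 R w (lact X p q)
      = rep_lN R p (\<ominus>\<^bsub>V\<^esub> rep_xi2 R w q) \<oplus>\<^bsub>V\<^esub> rep_rN R (\<ominus>\<^bsub>V\<^esub> rep_xi2 R w q) p
        \<ominus>\<^bsub>V\<^esub> \<ominus>\<^bsub>V\<^esub> rep_xi2 R (rep_lM R p w \<oplus>\<^bsub>W\<^esub> rep_rM R w p) q"
      using m m0 by (simp only: rw, algebra)
    show "\<ominus>\<^bsub>V\<^esub> rep_xi2 R w (ract X q p)
      = \<ominus>\<^bsub>V\<^esub> rep_xi2 R (\<ominus>\<^bsub>W\<^esub> rep_rM R w p) q \<ominus>\<^bsub>V\<^esub> \<ominus>\<^bsub>V\<^esub> rep_rN R (\<ominus>\<^bsub>V\<^esub> rep_xi2 R w q) p"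
      using m m0 by (simp only: rw, algebra)
    show "rep_xi1 R (ract X q p) w \<oplus>\<^bsub>V\<^esub> rep_xi2 R w (ract X q p)
      = rep_xi1 R q (\<ominus>\<^bsub>W\<^esub> rep_rM R w p) \<oplus>\<^bsub>V\<^esub> rep_xi2 R (\<ominus>\<^bsub>W\<^esub> rep_rM R w p) q
        \<ominus>\<^bsub>V\<^esub> \<ominus>\<^bsub>V\<^esub> rep_rN R (rep_xi1 R q w \<oplus>\<^bsub>V\<^esub> rep_xi2 R w q) p"
      using m m0 by (simp only: rw, algebra)
    show "\<ominus>\<^bsub>V\<^esub> rep_rN R (rep_xi1 R q w \<oplus>\<^bsub>V\<^esub> rep_xi2 R w q) p
      \<oplus>\<^bsub>V\<^esub> (rep_lN R p (rep_xi1 R q w \<oplus>\<^bsub>V\<^esub> rep_xi2 R w q)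
        \<oplus>\<^bsub>V\<^esub> rep_rN R (rep_xi1 R q w \<oplus>\<^bsub>V\<^esub> rep_xi2 R w q) p) = \<zero>\<^bsub>V\<^esub>"
      using m m0 by (simp only: rw, algebra)
    show "\<ominus>\<^bsub>V\<^esub> rep_xi2 R (rep_lM R p w \<oplus>\<^bsub>W\<^esub> rep_rM R w p) q
      \<oplus>\<^bsub>V\<^esub> (rep_xi1 R q (rep_lM R p w \<oplus>\<^bsub>W\<^esub> rep_rM R w p)
        \<oplus>\<^bsub>V\<^esub> rep_xi2 R (rep_lM R p w \<oplus>\<^bsub>W\<^esub> rep_rM R w p) q) = \<zero>\<^bsub>V\<^esub>"
      using m m0 by (simp only: rw, algebra)
  qed
qed

lemma rep_of_XUL_act:
  assumes V: "abelian_module K V" and W: "abelian_module K W" and \<delta>: "\<delta> \<in> lin K V W"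
    and act: "XUL_act K X V W \<delta> l r l' r' x y"
    and R: "rep_N R = V" "rep_M R = W" "rep_mu R = \<delta>"
    and ext: "ext2 P V (rep_lN R)" "ext2 V P (rep_rN R)" "ext2 P W (rep_lM R)" "ext2 W P (rep_rM R)"
      "ext2 Q W (rep_xi1 R)" "ext2 W Q (rep_xi2 R)"
    and RV: "\<And>p v. p \<in> carrier P \<Longrightarrow> v \<in> carrier V \<Longrightarrow> rep_lN R p v = l p v \<oplus>\<^bsub>V\<^esub> r p v"
      "\<And>p v. p \<in> carrier P \<Longrightarrow> v \<in> carrier V \<Longrightarrow> rep_rN R v p = \<ominus>\<^bsub>V\<^esub> r p v"
    and RW: "\<And>p w. p \<in> carrier P \<Longrightarrow> w \<in> carrier W \<Longrightarrow> rep_lM R p w = l' p w \<oplus>\<^bsub>W\<^esub> r' p w"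
      "\<And>p w. p \<in> carrier P \<Longrightarrow> w \<in> carrier W \<Longrightarrow> rep_rM R w p = \<ominus>\<^bsub>W\<^esub> r' p w"
    and RX: "\<And>q w. q \<in> carrier Q \<Longrightarrow> w \<in> carrier W \<Longrightarrow> rep_xi1 R q w = x q w \<oplus>\<^bsub>V\<^esub> y q w"
      "\<And>q w. q \<in> carrier Q \<Longrightarrow> w \<in> carrier W \<Longrightarrow> rep_xi2 R w q = \<ominus>\<^bsub>V\<^esub> y q w"
  shows "is_rep K X R"
proof -
  have VW: "module K V" "module K W" and VW0: "mult V = (\<lambda>_ _. \<zero>\<^bsub>V\<^esub>)" "mult W = (\<lambda>_ _. \<zero>\<^bsub>W\<^esub>)"
    using V W unfolding abelian_module_def by blast+
  interpret V: module K V by (rule VW)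
  interpret W: module K W by (rule VW)
  have ua: "UL_act K P V l r" "UL_act K P W l' r'" using act unfolding XUL_act_def by blast+
  have bil: "bilinear_map K P V V l" "bilinear_map K P V V r"
    "bilinear_map K P W W l'" "bilinear_map K P W W r'"
    "bilinear_map K Q W V x" "bilinear_map K Q W V y"
    using act unfolding XUL_act_def UL_act_def by blast+
  note lin = bilinear_mapD(1)[OF bil(1)] bilinear_mapD(1)[OF bil(2)] bilinear_mapD(1)[OF bil(3)]
    bilinear_mapD(1)[OF bil(4)] bilinear_mapD(1)[OF bil(5)] bilinear_mapD(1)[OF bil(6)]
  note cl = lin[THEN linear_mapD(1)]
  note ad = lin[THEN linear_mapD(2)]
  note umV = lin(1)[THEN linear_map_uminus[OF V.abelian_group_axioms V.abelian_group_axioms]]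
    lin(2)[THEN linear_map_uminus[OF V.abelian_group_axioms V.abelian_group_axioms]]
  note umW = lin(5)[THEN linear_map_uminus[OF W.abelian_group_axioms V.abelian_group_axioms]]
    lin(6)[THEN linear_map_uminus[OF W.abelian_group_axioms V.abelian_group_axioms]]
  have mu: "linear_map K V W \<delta>" using \<delta> unfolding lin_def by blast
  note muD = linear_mapD[OF mu] linear_map_uminus[OF V.abelian_group_axioms W.abelian_group_axioms mu]
  have equi: "\<delta> (rep_lN R p v) = rep_lM R p (\<delta> v) \<and> \<delta> (rep_rN R v p) = rep_rM R (\<delta> v) p"
    if "p \<in> carrier P" "v \<in> carrier V" for p v
  proof -
    have "\<delta> (l p v) = l' p (\<delta> v)" "\<delta> (r p v) = r' p (\<delta> v)"
      using act that unfolding XUL_act_def by blast+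
    then show ?thesis using that cl by (simp add: RV RW muD)
  qed
  have xi_mu: "rep_xi2 R (\<delta> v) q = rep_rN R v (\<eta> q) \<and> rep_xi1 R q (\<delta> v) = rep_lN R (\<eta> q) v"
    if "q \<in> carrier Q" "v \<in> carrier V" for q v
  proof -
    have "x q (\<delta> v) = l (\<eta> q) v" "y q (\<delta> v) = r (\<eta> q) v"
      using act that unfolding XUL_act_def by blast+
    then show ?thesis using that by (simp add: RV RX muD xmod_closed)
  qed
  have mu_xi: "\<delta> (rep_xi2 R w q) = rep_rM R w (\<eta> q) \<and> \<delta> (rep_xi1 R q w) = rep_lM R (\<eta> q) w"
    if "q \<in> carrier Q" "w \<in> carrier W" for q w
  proof -
    have "\<delta> (x q w) = l' (\<eta> q) w" "\<delta> (y q w) = r' (\<eta> q) w"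
      using act that unfolding XUL_act_def by blast+
    then show ?thesis using that cl by (simp add: RW RX muD xmod_closed)
  qed
  have six:
    "rep_xi2 R w (lact X p q) = rep_xi2 R (rep_rM R w p) q \<ominus>\<^bsub>V\<^esub> rep_rN R (rep_xi2 R w q) p \<and>
     rep_xi1 R (lact X p q) w = rep_xi2 R (rep_lM R p w) q \<ominus>\<^bsub>V\<^esub> rep_lN R p (rep_xi2 R w q) \<and>
     rep_xi2 R w (ract X q p) = rep_rN R (rep_xi2 R w q) p \<ominus>\<^bsub>V\<^esub> rep_xi2 R (rep_rM R w p) q \<and>
     rep_xi1 R (ract X q p) w = rep_rN R (rep_xi1 R q w) p \<ominus>\<^bsub>V\<^esub> rep_xi1 R q (rep_rM R w p) \<and>
     rep_xi1 R q (rep_lM R p w) = \<ominus>\<^bsub>V\<^esub> rep_xi1 R q (rep_rM R w p) \<and>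
     rep_lN R p (rep_xi1 R q w) = \<ominus>\<^bsub>V\<^esub> rep_lN R p (rep_xi2 R w q)"
    if pqw: "p \<in> carrier P" "q \<in> carrier Q" "w \<in> carrier W" for p q w
  proof -
    have e: "y (lact X p q) w = r p (y q w) \<ominus>\<^bsub>V\<^esub> y q (r' p w)"
      "x (lact X p q) w = l p (y q w) \<ominus>\<^bsub>V\<^esub> y q (l' p w)"
      "y (ract X q p) w = y q (r' p w) \<ominus>\<^bsub>V\<^esub> r p (y q w)"
      "x (ract X q p) w = x q (r' p w) \<ominus>\<^bsub>V\<^esub> r p (x q w)"
      "r p (x q w) \<oplus>\<^bsub>V\<^esub> l p (x q w) = \<zero>\<^bsub>V\<^esub>" "y q (l' p w) \<oplus>\<^bsub>V\<^esub> x q (l' p w) = \<zero>\<^bsub>V\<^esub>"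
      using act pqw unfolding XUL_act_def by blast+
    have m0: "x q w \<in> carrier V" "y q w \<in> carrier V" "l' p w \<in> carrier W" "r' p w \<in> carrier W"
      using pqw by (simp_all add: cl)
    have m: "l p (x q w) \<in> carrier V" "r p (x q w) \<in> carrier V"
      "l p (y q w) \<in> carrier V" "r p (y q w) \<in> carrier V"
      "x q (l' p w) \<in> carrier V" "x q (r' p w) \<in> carrier V"
      "y q (l' p w) \<in> carrier V" "y q (r' p w) \<in> carrier V"
      using pqw m0 by (simp_all add: cl)
    have k: "l p (x q w) = \<ominus>\<^bsub>V\<^esub> r p (x q w)" "x q (l' p w) = \<ominus>\<^bsub>V\<^esub> y q (l' p w)"
      using e(5,6) m by (simp_all add: V.M.a_comm V.M.minus_equality)
    note rw = umV(1)[OF pqw(1)] umV(2)[OF pqw(1)] umW(1)[OF pqw(2)] umW(2)[OF pqw(2)]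
      ad(1)[OF pqw(1)] ad(2)[OF pqw(1)] ad(5)[OF pqw(2)] ad(6)[OF pqw(2)] m0 pqw
      V.M.a_inv_closed V.M.a_closed W.M.a_inv_closed W.M.a_closed e(1-4) k RV RW RX xmod_closed
    show ?thesis
      by (intro conjI; use m m0 in \<open>simp only: rw, algebra\<close>)
  qed
  \<comment> \<open>The axioms for \<open>[q, q']\<close> are those for \<open>[p, q']\<close> at
    \<open>p = \<eta> q\<close>: by \<open>mu_xi\<close> the brackets of \<open>w\<close> with
    \<open>\<eta> q\<close> have the form \<open>\<delta> n\<close>, and there \<open>xi_mu\<close>
    evaluates \<open>rep_xi2\<close>.\<close>
  have qq: "rep_xi2 R w (q \<otimes>\<^bsub>Q\<^esub> q')
        = rep_rN R (rep_xi2 R w q) (\<eta> q') \<ominus>\<^bsub>V\<^esub> rep_rN R (rep_xi2 R w q') (\<eta> q) \<and>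
      rep_xi1 R (q \<otimes>\<^bsub>Q\<^esub> q') w
        = rep_rN R (rep_xi1 R q w) (\<eta> q') \<ominus>\<^bsub>V\<^esub> rep_lN R (\<eta> q) (rep_xi2 R w q')"
    if "q \<in> carrier Q" "q' \<in> carrier Q" "w \<in> carrier W" for q q' w
  proof -
    have c: "rep_xi1 R q w \<in> carrier V" "rep_xi2 R w q \<in> carrier V"
      using that cl by (simp_all add: RX)
    have "rep_rM R w (\<eta> q) = \<delta> (rep_xi2 R w q)" "rep_lM R (\<eta> q) w = \<delta> (rep_xi1 R q w)"
      using mu_xi that by auto
    then show ?thesis
      using six[of "\<eta> q" q' w] xi_mu[OF that(2) c(1)] xi_mu[OF that(2) c(2)] that
      by (simp add: xmod_closed lact_eta)
  qed
  have bilR: "bilinear_map K Q W V (rep_xi1 R)" "bilinear_map K W Q V (rep_xi2 R)"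
    using bilinear_cong[OF Q.module_axioms VW(2) bilinear_sum[OF VW(1) bil(5,6)] RX(1)]
      bilinear_cong[OF VW(2) Q.module_axioms bilinear_flip[OF bilinear_neg[OF VW(1) bil(6)]] RX(2)]
    by auto
  show ?thesis
    unfolding is_rep_def Let_def R
    using leibniz_action_of_UL_act[OF VW(1) VW0(1) P.bracket_module_axioms ua(1) RV]
      leibniz_action_of_UL_act[OF VW(2) VW0(2) P.bracket_module_axioms ua(2) RW]
    by (intro conjI ballI V W \<delta> ext bilR six qq equi[THEN conjunct1] equi[THEN conjunct2]
        mu_xi[THEN conjunct1] mu_xi[THEN conjunct2] xi_mu[THEN conjunct1] xi_mu[THEN conjunct2]
        six[THEN conjunct1])
      (use six qq in blast)+
qed

end

section \<open>Data in the endomorphism crossed module, evaluated at vectors\<close>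

lemma restrict_eq_iff: "restrict f A = restrict g A \<longleftrightarrow> (\<forall>x\<in>A. f x = g x)"
  by (metis restrict_apply' restrict_ext)

text \<open>Bilinearity in curried form, deliberately asymmetric: this is the shape into which
  linearity of a map with values in \<open>E\<close> or \<open>H\<close> unfolds.\<close>

lemma bilinear_iff:
  "bilinear_map K U V W f \<longleftrightarrow> (\<forall>u\<in>carrier U. linear_map K V W (f u)) \<and>
    (\<forall>u\<in>carrier U. \<forall>u'\<in>carrier U. \<forall>v\<in>carrier V. f (u \<oplus>\<^bsub>U\<^esub> u') v = f u v \<oplus>\<^bsub>W\<^esub> f u' v) \<and>
    (\<forall>k\<in>carrier K. \<forall>u\<in>carrier U. \<forall>v\<in>carrier V. f (k \<odot>\<^bsub>U\<^esub> u) v = k \<odot>\<^bsub>W\<^esub> f u v)"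
  (is "?l \<longleftrightarrow> ?r")
proof
  assume l: ?l
  show ?r
    by (simp add: bilinear_mapD(1)[OF l] linear_mapD(2)[OF bilinear_mapD(2)[OF l]]
        linear_mapD(3)[OF bilinear_mapD(2)[OF l]])
next
  assume r: ?r
  then have "linear_map K U W (\<lambda>u. f u v)" if "v \<in> carrier V" for v
    using that by (intro linear_mapI) (auto dest: linear_mapD(1))
  with r show ?l unfolding bilinear_map_def by blast
qed

context two_term
begin

sublocale E: unital_algebra K E by (rule End_unital_algebra)
sublocale H: module K H by (rule Hom_module)

lemma End_minus:
  assumes "(\<alpha>, \<beta>) \<in> carrier E" "(\<alpha>', \<beta>') \<in> carrier E"
  shows "(\<alpha>, \<beta>) \<ominus>\<^bsub>E\<^esub> (\<alpha>', \<beta>')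
    = (\<lambda>v\<in>carrier V. \<alpha> v \<ominus>\<^bsub>V\<^esub> \<alpha>' v, \<lambda>w\<in>carrier W. \<beta> w \<ominus>\<^bsub>W\<^esub> \<beta>' w)"
proof -
  have "(\<ominus>\<^bsub>K\<^esub> \<one>\<^bsub>K\<^esub>) \<odot>\<^bsub>E\<^esub> (\<alpha>', \<beta>') = \<ominus>\<^bsub>E\<^esub> (\<alpha>', \<beta>')"
    using E.A.minus_equality[OF End_neg[OF assms(2)]] assms(2) by simp
  then show ?thesis
    using assms unfolding a_minus_def
    by (auto simp: End_ops End_iff lin_iff restrict_eq_iff V.smult_l_minus W.smult_l_minus
        dest: sym)
qed

lemma Hom_minus:
  assumes "d \<in> carrier H" "d' \<in> carrier H"
  shows "d \<ominus>\<^bsub>H\<^esub> d' = (\<lambda>w\<in>carrier W. d w \<ominus>\<^bsub>V\<^esub> d' w)"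
proof -
  have "(\<ominus>\<^bsub>K\<^esub> \<one>\<^bsub>K\<^esub>) \<odot>\<^bsub>H\<^esub> d' = \<ominus>\<^bsub>H\<^esub> d'"
    using H.M.minus_equality[OF Hom_neg[OF assms(2)]] assms(2) by simp
  then show ?thesis
    using assms unfolding a_minus_def
    by (auto simp: Hom_ops Hom_iff lin_iff restrict_eq_iff V.smult_l_minus dest: sym)
qed

lemma End_linear_iff:
  assumes P: "module K P" and a: "\<And>p. p \<in> carrier P \<Longrightarrow> a p = (restrict (l p) (carrier V), restrict (l' p) (carrier W))"
  shows "linear_map K P E a \<longleftrightarrow> bilinear_map K P V V l \<and> bilinear_map K P W W l' \<and>
    (\<forall>p\<in>carrier P. \<forall>v\<in>carrier V. \<delta> (l p v) = l' p (\<delta> v))"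
proof -
  interpret P: module K P by fact
  have "linear_map K P E a \<longleftrightarrow>
    (\<forall>p\<in>carrier P. linear_map K V V (l p) \<and> linear_map K W W (l' p) \<and>
      (\<forall>v\<in>carrier V. \<delta> (l p v) = l' p (\<delta> v))) \<and>
    (\<forall>p\<in>carrier P. \<forall>p'\<in>carrier P. (\<forall>v\<in>carrier V. l (p \<oplus>\<^bsub>P\<^esub> p') v = l p v \<oplus>\<^bsub>V\<^esub> l p' v) \<and>
      (\<forall>w\<in>carrier W. l' (p \<oplus>\<^bsub>P\<^esub> p') w = l' p w \<oplus>\<^bsub>W\<^esub> l' p' w)) \<and>
    (\<forall>k\<in>carrier K. \<forall>p\<in>carrier P. (\<forall>v\<in>carrier V. l (k \<odot>\<^bsub>P\<^esub> p) v = k \<odot>\<^bsub>V\<^esub> l p v) \<and>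
      (\<forall>w\<in>carrier W. l' (k \<odot>\<^bsub>P\<^esub> p) w = k \<odot>\<^bsub>W\<^esub> l' p w))"
  proof -
    have mem: "a p \<in> carrier E \<longleftrightarrow> linear_map K V V (l p) \<and> linear_map K W W (l' p) \<and>
      (\<forall>v\<in>carrier V. \<delta> (l p v) = l' p (\<delta> v))" if "p \<in> carrier P" for p
      using that by (auto simp: a End_iff lin_iff linear_map_def delta_simps Pi_iff)
    show ?thesis
      unfolding linear_map_def[of K P] Pi_iff
      by (simp add: mem cong: conj_cong) (simp add: a End_ops restrict_eq_iff cong: conj_cong)
  qed
  also have "\<dots> \<longleftrightarrow> bilinear_map K P V V l \<and> bilinear_map K P W W l' \<and>
    (\<forall>p\<in>carrier P. \<forall>v\<in>carrier V. \<delta> (l p v) = l' p (\<delta> v))"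
    unfolding bilinear_iff by blast
  finally show ?thesis .
qed

lemma Hom_linear_iff:
  assumes Q: "module K Q" and d: "\<And>q. q \<in> carrier Q \<Longrightarrow> d q = restrict (x q) (carrier W)"
  shows "linear_map K Q H d \<longleftrightarrow> bilinear_map K Q W V x"
proof -
  interpret Q: module K Q by fact
  have mem: "d q \<in> carrier H \<longleftrightarrow> linear_map K W V (x q)" if "q \<in> carrier Q" for q
    using that by (auto simp: d Hom_iff lin_iff linear_map_def Pi_iff)
  have "linear_map K Q H d \<longleftrightarrow> (\<forall>q\<in>carrier Q. linear_map K W V (x q)) \<and>
    (\<forall>q\<in>carrier Q. \<forall>q'\<in>carrier Q. \<forall>w\<in>carrier W. x (q \<oplus>\<^bsub>Q\<^esub> q') w = x q w \<oplus>\<^bsub>V\<^esub> x q' w) \<and>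
    (\<forall>k\<in>carrier K. \<forall>q\<in>carrier Q. \<forall>w\<in>carrier W. x (k \<odot>\<^bsub>Q\<^esub> q) w = k \<odot>\<^bsub>V\<^esub> x q w)"
    unfolding linear_map_def[of K Q] Pi_iff
    by (simp add: mem cong: conj_cong) (simp add: d Hom_ops restrict_eq_iff cong: conj_cong)
  also have "\<dots> \<longleftrightarrow> bilinear_map K Q W V x"
    unfolding bilinear_iff by blast
  finally show ?thesis .
qed

end

locale leibniz_two_term = leibniz_xmod K X + two_term K V W \<delta>
  for K :: "'k ring" and X :: "('k, 'q, 'p) xmod"
    and V :: "('k, 'v) module" and W :: "('k, 'w) module" and \<delta>
begin

text \<open>All values are restricted functions, so every equation in \<open>E\<close> or
  \<open>H\<close> becomes a family of equations at vectors, and the two lists of conditions match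
  entry by entry.\<close>

lemma XUL_data_End_iff:
  assumes al: "\<And>p. p \<in> carrier P \<Longrightarrow> al p = (restrict (l p) (carrier V), restrict (l' p) (carrier W))"
    and ar: "\<And>p. p \<in> carrier P \<Longrightarrow> ar p = (restrict (r p) (carrier V), restrict (r' p) (carrier W))"
    and dl: "\<And>q. q \<in> carrier Q \<Longrightarrow> dl q = restrict (x q) (carrier W)"
    and dr: "\<And>q. q \<in> carrier Q \<Longrightarrow> dr q = restrict (y q) (carrier W)"
  shows "XUL_data K X EndX al ar dl dr \<longleftrightarrow> XUL_act K X V W \<delta> l r l' r' x y"
proof -
  let ?lin = "linear_map K P E al \<and> linear_map K P E ar \<and> linear_map K Q H dl \<and> linear_map K Q H dr"
  have lin_iff':
    "linear_map K P E al \<longleftrightarrow> bilinear_map K P V V l \<and> bilinear_map K P W W l' \<and>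
      (\<forall>p\<in>carrier P. \<forall>v\<in>carrier V. \<delta> (l p v) = l' p (\<delta> v))"
    "linear_map K P E ar \<longleftrightarrow> bilinear_map K P V V r \<and> bilinear_map K P W W r' \<and>
      (\<forall>p\<in>carrier P. \<forall>v\<in>carrier V. \<delta> (r p v) = r' p (\<delta> v))"
    "linear_map K Q H dl \<longleftrightarrow> bilinear_map K Q W V x" "linear_map K Q H dr \<longleftrightarrow> bilinear_map K Q W V y"
    by (intro End_linear_iff Hom_linear_iff P.P.module_axioms Q.module_axioms al ar dl dr; assumption)+
  show ?thesis
  \<comment> \<open>Linearity comes first, as both sides imply it. It provides the closure facts
    with which differences in \<open>E\<close> and \<open>H\<close> and nested restrictions are
    evaluated pointwise.\<close>
  proof (cases ?lin)
    case False
    have "\<not> XUL_data K X EndX al ar dl dr"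
      using False unfolding XUL_data_def UL_data_def xmod_ops(1,2) by blast
    moreover have "\<not> XUL_act K X V W \<delta> l r l' r' x y"
      using False[unfolded lin_iff'] unfolding XUL_act_def UL_act_def by blast
    ultimately show ?thesis by blast
  next
    case True
    note bil = True[unfolded lin_iff']
    have aE: "(restrict (l p) (carrier V), restrict (l' p) (carrier W)) \<in> carrier E"
      "(restrict (r p) (carrier V), restrict (r' p) (carrier W)) \<in> carrier E"
      if "p \<in> carrier P" for p
      using linear_mapD(1)[of K P E al p] linear_mapD(1)[of K P E ar p] True al[OF that] ar[OF that] that
      by simp_all
    have dH: "restrict (x q) (carrier W) \<in> carrier H" "restrict (y q) (carrier W) \<in> carrier H"
      if "q \<in> carrier Q" for q
      using linear_mapD(1)[of K Q H dl q] linear_mapD(1)[of K Q H dr q] True dl[OF that] dr[OF that] that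
      by simp_all
    have bil': "bilinear_map K P V V l" "bilinear_map K P V V r" "bilinear_map K P W W l'"
      "bilinear_map K P W W r'" "bilinear_map K Q W V x" "bilinear_map K Q W V y"
      using bil by blast+
    note lins = bil'[THEN bilinear_mapD(1), THEN linear_mapD(1)]
    have cl: "l p v \<in> carrier V" "r p v \<in> carrier V" if "p \<in> carrier P" "v \<in> carrier V" for p v
      using that by (simp_all add: lins)
    have cl': "l' p w \<in> carrier W" "r' p w \<in> carrier W" if "p \<in> carrier P" "w \<in> carrier W" for p w
      using that by (simp_all add: lins)
    have clx: "x q w \<in> carrier V" "y q w \<in> carrier V" if "q \<in> carrier Q" "w \<in> carrier W" for q w
      using that by (simp_all add: lins)
    \<comment> \<open>The pointwise formulas \<open>End_minus\<close> and \<open>Hom_minus\<close>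
      hold on the carriers. This fact and \<open>HH\<close> put the composites there, for every
      choice of left or right generators.\<close>
    have EE: "(\<lambda>v\<in>carrier V. f p (g p' v), \<lambda>w\<in>carrier W. f' p (g' p' w)) \<in> carrier E"
      if "f = l \<and> f' = l' \<or> f = r \<and> f' = r'" "g = l \<and> g' = l' \<or> g = r \<and> g' = r'"
        "p \<in> carrier P" "p' \<in> carrier P" for f f' g g' p p'
    proof -
      have "(restrict (f p) (carrier V), restrict (f' p) (carrier W)) \<otimes>\<^bsub>E\<^esub>
          (restrict (g p') (carrier V), restrict (g' p') (carrier W)) \<in> carrier E"
        using aE that by (auto intro!: End_closed(2))
      moreover have "(\<lambda>v\<in>carrier V. restrict (f p) (carrier V) (restrict (g p') (carrier V) v))
          = (\<lambda>v\<in>carrier V. f p (g p' v))"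
        "(\<lambda>w\<in>carrier W. restrict (f' p) (carrier W) (restrict (g' p') (carrier W) w))
          = (\<lambda>w\<in>carrier W. f' p (g' p' w))"
        using that cl cl' by (auto simp: restrict_eq_iff)
      ultimately show ?thesis by (simp only: End_ops)
    qed
    have HH: "(\<lambda>w\<in>carrier W. f p (z q w)) \<in> carrier H" "(\<lambda>w\<in>carrier W. z q (f' p w)) \<in> carrier H"
      if f: "f = l \<and> f' = l' \<or> f = r \<and> f' = r'" and z: "z = x \<or> z = y"
        and pq: "p \<in> carrier P" "q \<in> carrier Q" for f f' z p q
    proof -
      interpret Y: unital_xmod K "EndX" by (rule End_unital_xmod)
      let ?a = "(restrict (f p) (carrier V), restrict (f' p) (carrier W))"
        and ?d = "restrict (z q) (carrier W)"
      have "?a \<in> carrier E" "?d \<in> carrier H" using aE dH f z pq by auto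
      then have "lact EndX ?a ?d \<in> carrier H"
        "ract EndX ?d ?a \<in> carrier H"
        using Y.top_closed(1)[of ?a ?d] Y.top_closed(2)[of ?d ?a] by (simp_all add: xmod_ops(1,2))
      moreover have "(\<lambda>w\<in>carrier W. restrict (f p) (carrier V) (?d w)) = (\<lambda>w\<in>carrier W. f p (z q w))"
        "(\<lambda>w\<in>carrier W. ?d (restrict (f' p) (carrier W) w)) = (\<lambda>w\<in>carrier W. z q (f' p w))"
        using f z pq cl' clx by (auto simp: restrict_eq_iff)
      ultimately show "(\<lambda>w\<in>carrier W. f p (z q w)) \<in> carrier H"
        "(\<lambda>w\<in>carrier W. z q (f' p w)) \<in> carrier H"
        by (simp_all only: xmod_ops)
    qed
    have ul: "(ar (p \<otimes>\<^bsub>P\<^esub> p') = ar p \<otimes>\<^bsub>E\<^esub> ar p' \<ominus>\<^bsub>E\<^esub> ar p' \<otimes>\<^bsub>E\<^esub> ar p \<longleftrightarrow>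
        (\<forall>v\<in>carrier V. r (p \<otimes>\<^bsub>P\<^esub> p') v = r p (r p' v) \<ominus>\<^bsub>V\<^esub> r p' (r p v)) \<and>
        (\<forall>w\<in>carrier W. r' (p \<otimes>\<^bsub>P\<^esub> p') w = r' p (r' p' w) \<ominus>\<^bsub>W\<^esub> r' p' (r' p w)))"
      "(al (p \<otimes>\<^bsub>P\<^esub> p') = al p \<otimes>\<^bsub>E\<^esub> ar p' \<ominus>\<^bsub>E\<^esub> ar p' \<otimes>\<^bsub>E\<^esub> al p \<longleftrightarrow>
        (\<forall>v\<in>carrier V. l (p \<otimes>\<^bsub>P\<^esub> p') v = l p (r p' v) \<ominus>\<^bsub>V\<^esub> r p' (l p v)) \<and>
        (\<forall>w\<in>carrier W. l' (p \<otimes>\<^bsub>P\<^esub> p') w = l' p (r' p' w) \<ominus>\<^bsub>W\<^esub> r' p' (l' p w)))"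
      "((ar p' \<oplus>\<^bsub>E\<^esub> al p') \<otimes>\<^bsub>E\<^esub> al p = \<zero>\<^bsub>E\<^esub> \<longleftrightarrow>
        (\<forall>v\<in>carrier V. r p' (l p v) \<oplus>\<^bsub>V\<^esub> l p' (l p v) = \<zero>\<^bsub>V\<^esub>) \<and>
        (\<forall>w\<in>carrier W. r' p' (l' p w) \<oplus>\<^bsub>W\<^esub> l' p' (l' p w) = \<zero>\<^bsub>W\<^esub>))"
      if "p \<in> carrier P" "p' \<in> carrier P" for p p'
      using that cl cl'
      by (simp_all add: al ar P.bracket_closed End_ops End_minus EE restrict_eq_iff cong: restrict_cong)
    note HHs = HH[of l l' x] HH[of l l' y] HH[of r r' x] HH[of r r' y]
    have cross: "(dr (lact X p q) = lact EndX (ar p) (dr q) \<ominus>\<^bsub>H\<^esub> ract EndX (dr q) (ar p)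
        \<longleftrightarrow> (\<forall>w\<in>carrier W. y (lact X p q) w = r p (y q w) \<ominus>\<^bsub>V\<^esub> y q (r' p w)))"
      "(dl (lact X p q) = lact EndX (al p) (dr q) \<ominus>\<^bsub>H\<^esub> ract EndX (dr q) (al p)
        \<longleftrightarrow> (\<forall>w\<in>carrier W. x (lact X p q) w = l p (y q w) \<ominus>\<^bsub>V\<^esub> y q (l' p w)))"
      "(dr (ract X q p) = ract EndX (dr q) (ar p) \<ominus>\<^bsub>H\<^esub> lact EndX (ar p) (dr q)
        \<longleftrightarrow> (\<forall>w\<in>carrier W. y (ract X q p) w = y q (r' p w) \<ominus>\<^bsub>V\<^esub> r p (y q w)))"
      "(dl (ract X q p) = ract EndX (dl q) (ar p) \<ominus>\<^bsub>H\<^esub> lact EndX (ar p) (dl q)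
        \<longleftrightarrow> (\<forall>w\<in>carrier W. x (ract X q p) w = x q (r' p w) \<ominus>\<^bsub>V\<^esub> r p (x q w)))"
      "(lact EndX (ar p \<oplus>\<^bsub>E\<^esub> al p) (dl q) = \<zero>\<^bsub>H\<^esub>
        \<longleftrightarrow> (\<forall>w\<in>carrier W. r p (x q w) \<oplus>\<^bsub>V\<^esub> l p (x q w) = \<zero>\<^bsub>V\<^esub>))"
      "(ract EndX (dr q \<oplus>\<^bsub>H\<^esub> dl q) (al p) = \<zero>\<^bsub>H\<^esub>
        \<longleftrightarrow> (\<forall>w\<in>carrier W. y q (l' p w) \<oplus>\<^bsub>V\<^esub> x q (l' p w) = \<zero>\<^bsub>V\<^esub>))"
      if "p \<in> carrier P" "q \<in> carrier Q" for p q
      using that cl cl' clx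
      by (simp_all add: al ar dl dr xmod_closed End_ops Hom_ops xmod_ops Hom_minus HHs
          restrict_eq_iff cong: restrict_cong)
    have bd: "(bdry EndX (dl q) = al (\<eta> q) \<longleftrightarrow>
        (\<forall>v\<in>carrier V. x q (\<delta> v) = l (\<eta> q) v) \<and> (\<forall>w\<in>carrier W. \<delta> (x q w) = l' (\<eta> q) w))"
      "(bdry EndX (dr q) = ar (\<eta> q) \<longleftrightarrow>
        (\<forall>v\<in>carrier V. y q (\<delta> v) = r (\<eta> q) v) \<and> (\<forall>w\<in>carrier W. \<delta> (y q w) = r' (\<eta> q) w))"
      if "q \<in> carrier Q" for q
      using that by (simp_all add: al ar dl dr xmod_closed xmod_ops restrict_eq_iff delta_simps)
    show ?thesis
      unfolding XUL_data_def UL_data_def XUL_act_def UL_act_def xmod_ops(1,2) using True bil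
      by (simp add: ul cross bd cong: ball_cong) (simp only: ball_conj_distrib conj_ac)
  qed
qed

end

text \<open>Applied to the data of the generators themselves (\<open>XUL_gens_data\<close>), this is
  the converse of \<open>XUL_universal\<close>: a morphism out of \<open>XUL\<close> yields data in
  its target.\<close>

lemma XUL_data_map:
  assumes Z: "unital_xmod K Z" and Y: "unital_xmod K Y" and X: "leibniz_xmod K X"
    and hom: "alg_xmod_hom K Z Y \<phi> \<psi>" and data: "XUL_data K X Z al ar dl dr"
  shows "XUL_data K X Y (\<lambda>p. \<psi> (al p)) (\<lambda>p. \<psi> (ar p)) (\<lambda>q. \<phi> (dl q)) (\<lambda>q. \<phi> (dr q))"
proof -
  interpret Z: unital_xmod K Z by fact
  interpret Y: unital_xmod K Y by fact
  interpret leibniz_xmod K X by fact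
  note D = XUL_dataD[OF data]
  note ud = UL_dataD[OF D(1)]
  have \<phi>: "linear_map K (Top Z) (Top Y) \<phi>" and \<psi>: "linear_map K (Base Z) (Base Y) \<psi>"
    and \<psi>_mult: "\<And>x y. x \<in> carrier (Base Z) \<Longrightarrow> y \<in> carrier (Base Z) \<Longrightarrow>
      \<psi> (x \<otimes>\<^bsub>Base Z\<^esub> y) = \<psi> x \<otimes>\<^bsub>Base Y\<^esub> \<psi> y"
    and bd: "\<And>b. b \<in> carrier (Top Z) \<Longrightarrow> \<psi> (bdry Z b) = bdry Y (\<phi> b)"
    and act: "\<And>a b. a \<in> carrier (Base Z) \<Longrightarrow> b \<in> carrier (Top Z) \<Longrightarrow>
      \<phi> (ract Z b a) = ract Y (\<phi> b) (\<psi> a)"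
      "\<And>a b. a \<in> carrier (Base Z) \<Longrightarrow> b \<in> carrier (Top Z) \<Longrightarrow>
      \<phi> (lact Z a b) = lact Y (\<psi> a) (\<phi> b)"
    using hom unfolding alg_xmod_hom_def alg_hom_def by auto
  note cl = D(2-5)[THEN linear_mapD(1)]
  note \<phi>s = linear_mapD(2)[OF \<phi>] linear_map_zero[OF Z.Top.abelian_group_axioms Y.Top.abelian_group_axioms \<phi>]
    linear_map_minus[OF Z.Top.abelian_group_axioms Y.Top.abelian_group_axioms \<phi>]
  note \<psi>s = linear_mapD(2)[OF \<psi>] linear_map_zero[OF Z.Base.A.abelian_group_axioms Y.Base.A.abelian_group_axioms \<psi>]
    linear_map_minus[OF Z.Base.A.abelian_group_axioms Y.Base.A.abelian_group_axioms \<psi>]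
  have ul: "UL_data K P (Base Y) (\<lambda>p. \<psi> (al p)) (\<lambda>p. \<psi> (ar p))"
    unfolding UL_data_def
  proof (intro conjI ballI linear_map_comp[OF D(2) \<psi>] linear_map_comp[OF D(3) \<psi>])
    fix x y assume xy: "x \<in> carrier P" "y \<in> carrier P"
    show "\<psi> (ar (x \<otimes>\<^bsub>P\<^esub> y))
        = \<psi> (ar x) \<otimes>\<^bsub>Base Y\<^esub> \<psi> (ar y) \<ominus>\<^bsub>Base Y\<^esub> \<psi> (ar y) \<otimes>\<^bsub>Base Y\<^esub> \<psi> (ar x)"
      "\<psi> (al (x \<otimes>\<^bsub>P\<^esub> y))
        = \<psi> (al x) \<otimes>\<^bsub>Base Y\<^esub> \<psi> (ar y) \<ominus>\<^bsub>Base Y\<^esub> \<psi> (ar y) \<otimes>\<^bsub>Base Y\<^esub> \<psi> (al x)"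
      using xy by (simp_all add: ud cl \<psi>s \<psi>_mult)
    show "(\<psi> (ar y) \<oplus>\<^bsub>Base Y\<^esub> \<psi> (al y)) \<otimes>\<^bsub>Base Y\<^esub> \<psi> (al x) = \<zero>\<^bsub>Base Y\<^esub>"
      using arg_cong[OF ud(3)[OF xy], of \<psi>] xy by (simp add: cl \<psi>s \<psi>_mult)
  qed
  show ?thesis
    unfolding XUL_data_def
  proof (intro conjI ballI ul linear_map_comp[OF D(4) \<phi>] linear_map_comp[OF D(5) \<phi>])
    fix p q assume pq: "p \<in> carrier P" "q \<in> carrier Q"
    show "lact Y (\<psi> (ar p) \<oplus>\<^bsub>Base Y\<^esub> \<psi> (al p)) (\<phi> (dl q)) = \<zero>\<^bsub>Top Y\<^esub>"
      using arg_cong[OF D(12)[OF pq], of \<phi>] pq by (simp add: cl act \<phi>s \<psi>s)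
    show "ract Y (\<phi> (dr q) \<oplus>\<^bsub>Top Y\<^esub> \<phi> (dl q)) (\<psi> (al p)) = \<zero>\<^bsub>Top Y\<^esub>"
      using arg_cong[OF D(13)[OF pq], of \<phi>] pq by (simp add: cl act \<phi>s \<psi>s)
  qed (simp_all add: bd[symmetric] cl D(6-11) act \<phi>s Z.top_closed)
qed

text \<open>Left modules consist of extensional maps, whereas \<open>XUL_universal\<close> says
  nothing about values off the carriers. The morphism laws only evaluate the maps on the carriers,
  so they survive the restriction.\<close>

lemma alg_xmod_hom_restrict:
  assumes Z: "unital_xmod K Z" and hom: "alg_xmod_hom K Z Y \<phi> \<psi>"
  shows "alg_xmod_hom K Z Y (restrict \<phi> (carrier (Top Z))) (restrict \<psi> (carrier (Base Z)))"
proof -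
  interpret Z: unital_xmod K Z by fact
  show ?thesis
    using hom unfolding alg_xmod_hom_def alg_hom_def linear_map_def
    by (auto simp: Z.top_closed Pi_iff)
qed

section \<open>Left modules and representations\<close>

locale left_module_xmod = leibniz_xmod K X
  for K :: "'k ring" and X :: "('k, 'q, 'p) xmod" +
  fixes L :: "('k, ('k, 'q \<times> 'p) ul set, ('k, 'p) ul, 'v, 'w) left_module"
  assumes left_module: "is_left_module K (XUL K X) L"
begin

abbreviation V where "V \<equiv> lm_V L"
abbreviation W where "W \<equiv> lm_W L"

lemma abelian: "abelian_module K V" "abelian_module K W"
  using left_module unfolding is_left_module_def Let_def by blast+

sublocale two_term K V W "lm_delta L"
  using left_module unfolding is_left_module_def Let_def abelian_module_def
  by (intro two_term.intro two_term_axioms.intro) blast+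

sublocale leibniz_two_term K X V W "lm_delta L" ..

abbreviation Y where "Y \<equiv> End_xmod K V W (lm_delta L)"

lemma xmod_hom: "alg_xmod_hom K (XUL K X) Y (lm_phi L) (lm_psi L)"
  and psi_one: "lm_psi L \<one>\<^bsub>UP\<^esub> = \<one>\<^bsub>E\<^esub>"
  and ext: "lm_phi L \<in> extensional (carrier XT)" "lm_psi L \<in> extensional (carrier UP)"
  using left_module unfolding is_left_module_def Let_def XUL_simps(1) by blast+

lemma psi_hom: "ualg_hom K UP E (lm_psi L)"
  using xmod_hom psi_one unfolding alg_xmod_hom_def ualg_hom_def XUL_simps(1) xmod_ops(2) by blast

lemma phi_linear: "linear_map K XT H (lm_phi L)"
  using xmod_hom unfolding alg_xmod_hom_def alg_hom_def xmod_ops(1) by blast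

lemmas psiD = ualg_homD[OF psi_hom]

lemma phi_act:
  assumes "a \<in> carrier UP" "b \<in> carrier XT"
  shows "lm_phi L (Ib a \<otimes>\<^bsub>Ub\<^esub> b) = lact Y (lm_psi L a) (lm_phi L b)"
    "lm_phi L (b \<otimes>\<^bsub>Ub\<^esub> Ib a) = ract Y (lm_phi L b) (lm_psi L a)"
  using xmod_hom assms unfolding alg_xmod_hom_def XUL_simps by auto

definition aV where "aV a v = fst (lm_psi L a) v"
definition aW where "aW a w = snd (lm_psi L a) w"

lemma psi_eq: "a \<in> carrier UP \<Longrightarrow>
  lm_psi L a = (restrict (aV a) (carrier V), restrict (aW a) (carrier W))"
  using psiD(1)[of a]
  by (cases "lm_psi L a") (auto simp: End_iff lin_iff aV_def aW_def fun_eq_iff restrict_def)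

lemma phi_eq: "b \<in> carrier XT \<Longrightarrow>
  lm_phi L b = restrict (lm_phi L b) (carrier W)"
  using linear_mapD(1)[OF phi_linear, of b]
  by (auto simp: Hom_iff lin_iff fun_eq_iff restrict_def)

lemma psi_linear:
  assumes "a \<in> carrier UP"
  shows "linear_map K V V (aV a)" "linear_map K W W (aW a)"
  using psiD(1)[OF assms]
  by (cases "lm_psi L a"; simp add: End_iff lin_def aV_def[abs_def] aW_def[abs_def])+

lemma phi_closed:
  assumes "b \<in> carrier XT" "w \<in> carrier W"
  shows "lm_phi L b w \<in> carrier V"
  using linear_mapD(1)[OF phi_linear assms(1)] assms(2) by (simp add: Hom_iff lin_iff)

lemmas a_closed = linear_mapD(1)[OF psi_linear(1)] linear_mapD(1)[OF psi_linear(2)]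

lemma psi_ops:
  "v \<in> carrier V \<Longrightarrow> aV \<one>\<^bsub>UP\<^esub> v = v"
  "w \<in> carrier W \<Longrightarrow> aW \<one>\<^bsub>UP\<^esub> w = w"
  "\<lbrakk>a \<in> carrier UP; b \<in> carrier UP; v \<in> carrier V\<rbrakk>
    \<Longrightarrow> aV (a \<oplus>\<^bsub>UP\<^esub> b) v = aV a v \<oplus>\<^bsub>V\<^esub> aV b v"
  "\<lbrakk>a \<in> carrier UP; b \<in> carrier UP; w \<in> carrier W\<rbrakk>
    \<Longrightarrow> aW (a \<oplus>\<^bsub>UP\<^esub> b) w = aW a w \<oplus>\<^bsub>W\<^esub> aW b w"
  "\<lbrakk>a \<in> carrier UP; b \<in> carrier UP; v \<in> carrier V\<rbrakk>
    \<Longrightarrow> aV (a \<otimes>\<^bsub>UP\<^esub> b) v = aV a (aV b v)"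
  "\<lbrakk>a \<in> carrier UP; b \<in> carrier UP; w \<in> carrier W\<rbrakk>
    \<Longrightarrow> aW (a \<otimes>\<^bsub>UP\<^esub> b) w = aW a (aW b w)"
  "\<lbrakk>k \<in> carrier K; a \<in> carrier UP; v \<in> carrier V\<rbrakk>
    \<Longrightarrow> aV (k \<odot>\<^bsub>UP\<^esub> a) v = k \<odot>\<^bsub>V\<^esub> aV a v"
  "\<lbrakk>k \<in> carrier K; a \<in> carrier UP; w \<in> carrier W\<rbrakk>
    \<Longrightarrow> aW (k \<odot>\<^bsub>UP\<^esub> a) w = k \<odot>\<^bsub>W\<^esub> aW a w"
  using psi_one psiD(2)[of a b] psiD(3)[of k a] psiD(4)[of a b]
  by (simp_all add: psi_eq End_ops restrict_eq_iff a_closed)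

lemma phi_ops:
  "\<lbrakk>b \<in> carrier XT; b' \<in> carrier XT; w \<in> carrier W\<rbrakk>
    \<Longrightarrow> lm_phi L (b \<oplus>\<^bsub>Ub\<^esub> b') w = lm_phi L b w \<oplus>\<^bsub>V\<^esub> lm_phi L b' w"
  "\<lbrakk>a \<in> carrier UP; b \<in> carrier XT; w \<in> carrier W\<rbrakk>
    \<Longrightarrow> lm_phi L (Ib a \<otimes>\<^bsub>Ub\<^esub> b) w = aV a (lm_phi L b w)"
  "\<lbrakk>a \<in> carrier UP; b \<in> carrier XT; w \<in> carrier W\<rbrakk>
    \<Longrightarrow> lm_phi L (b \<otimes>\<^bsub>Ub\<^esub> Ib a) w = lm_phi L b (aW a w)"
  using linear_mapD(2)[OF phi_linear, of b b'] phi_act[of a b]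
  by (simp_all add: XUL_simps Hom_ops xmod_ops psi_eq phi_closed)

lemma gens_act:
  "XUL_act K X V W (lm_delta L) (\<lambda>p. aV (UL_l K P p)) (\<lambda>p. aV (UL_r K P p))
    (\<lambda>p. aW (UL_l K P p)) (\<lambda>p. aW (UL_r K P p)) (\<lambda>q. lm_phi L (bl q)) (\<lambda>q. lm_phi L (br q))"
proof (rule XUL_data_End_iff[THEN iffD1])
  show "XUL_data K X Y (\<lambda>p. lm_psi L (UL_l K P p)) (\<lambda>p. lm_psi L (UL_r K P p))
      (\<lambda>q. lm_phi L (bl q)) (\<lambda>q. lm_phi L (br q))"
    by (rule XUL_data_map[OF XUL.unital_xmod_axioms End_unital_xmod leibniz_xmod_axioms xmod_hom
          XUL_gens_data])
qed (simp_all add: psi_eq P.UL_gens_closed phi_eq[symmetric] Top_XUL_iff b_closed Sb_gens)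

end

section \<open>From left modules to representations, on objects\<close>

context leibniz_xmod
begin

text \<open>The change of generators read backwards: \<open>[p, v] = p_l v + p_r v\<close> and
  \<open>[v, p] = - p_r v\<close>, and in the same way the \<xi> maps from \<open>q_l\<close> and
  \<open>q_r\<close>. The value \<open>undefined\<close> off the carriers meets \<open>ext2\<close>,
  which makes equality of records the right equality of representations.\<close>

definition rep_of ::
  "('k, ('k, 'q \<times> 'p) ul set, ('k, 'p) ul, 'v, 'w) left_module \<Rightarrow> ('k, 'q, 'p, 'v, 'w) rep"
where
  "rep_of L = (let V = lm_V L; W = lm_W L; \<phi> = lm_phi L; \<psi> = lm_psi L;
      l = UL_l K P; r = UL_r K P in
    \<lparr>rep_N = V, rep_M = W, rep_mu = lm_delta L,
     rep_lN = (\<lambda>p v. if p \<in> carrier P \<and> v \<in> carrier V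
       then fst (\<psi> (l p)) v \<oplus>\<^bsub>V\<^esub> fst (\<psi> (r p)) v else undefined),
     rep_rN = (\<lambda>v p. if p \<in> carrier P \<and> v \<in> carrier V
       then \<ominus>\<^bsub>V\<^esub> fst (\<psi> (r p)) v else undefined),
     rep_lM = (\<lambda>p w. if p \<in> carrier P \<and> w \<in> carrier W
       then snd (\<psi> (l p)) w \<oplus>\<^bsub>W\<^esub> snd (\<psi> (r p)) w else undefined),
     rep_rM = (\<lambda>w p. if p \<in> carrier P \<and> w \<in> carrier W
       then \<ominus>\<^bsub>W\<^esub> snd (\<psi> (r p)) w else undefined),
     rep_xi1 = (\<lambda>q w. if q \<in> carrier Q \<and> w \<in> carrier W
       then \<phi> (bl q) w \<oplus>\<^bsub>V\<^esub> \<phi> (br q) w else undefined),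
     rep_xi2 = (\<lambda>w q. if q \<in> carrier Q \<and> w \<in> carrier W
       then \<ominus>\<^bsub>V\<^esub> \<phi> (br q) w else undefined)\<rparr>)"

lemma rep_of_simps:
  "rep_N (rep_of L) = lm_V L" "rep_M (rep_of L) = lm_W L" "rep_mu (rep_of L) = lm_delta L"
  "\<lbrakk>p \<in> carrier P; v \<in> carrier (lm_V L)\<rbrakk> \<Longrightarrow> rep_lN (rep_of L) p v
    = fst (lm_psi L (UL_l K P p)) v \<oplus>\<^bsub>lm_V L\<^esub> fst (lm_psi L (UL_r K P p)) v"
  "\<lbrakk>p \<in> carrier P; v \<in> carrier (lm_V L)\<rbrakk> \<Longrightarrow> rep_rN (rep_of L) v p
    = \<ominus>\<^bsub>lm_V L\<^esub> fst (lm_psi L (UL_r K P p)) v"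
  "\<lbrakk>p \<in> carrier P; w \<in> carrier (lm_W L)\<rbrakk> \<Longrightarrow> rep_lM (rep_of L) p w
    = snd (lm_psi L (UL_l K P p)) w \<oplus>\<^bsub>lm_W L\<^esub> snd (lm_psi L (UL_r K P p)) w"
  "\<lbrakk>p \<in> carrier P; w \<in> carrier (lm_W L)\<rbrakk> \<Longrightarrow> rep_rM (rep_of L) w p
    = \<ominus>\<^bsub>lm_W L\<^esub> snd (lm_psi L (UL_r K P p)) w"
  "\<lbrakk>q \<in> carrier Q; w \<in> carrier (lm_W L)\<rbrakk> \<Longrightarrow> rep_xi1 (rep_of L) q w
    = lm_phi L (bl q) w \<oplus>\<^bsub>lm_V L\<^esub> lm_phi L (br q) w"
  "\<lbrakk>q \<in> carrier Q; w \<in> carrier (lm_W L)\<rbrakk> \<Longrightarrow> rep_xi2 (rep_of L) w q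
    = \<ominus>\<^bsub>lm_V L\<^esub> lm_phi L (br q) w"
  by (simp_all add: rep_of_def Let_def)

lemma rep_of_ext:
  "ext2 P (lm_V L) (rep_lN (rep_of L))" "ext2 (lm_V L) P (rep_rN (rep_of L))"
  "ext2 P (lm_W L) (rep_lM (rep_of L))" "ext2 (lm_W L) P (rep_rM (rep_of L))"
  "ext2 Q (lm_W L) (rep_xi1 (rep_of L))" "ext2 (lm_W L) Q (rep_xi2 (rep_of L))"
  by (auto simp: rep_of_def Let_def ext2_def extensional_def)

lemma rep_of_is_rep:
  assumes "is_left_module K (XUL K X) L"
  shows "is_rep K X (rep_of L)"
proof -
  interpret L: left_module_xmod K X L by unfold_locales (rule assms)
  show ?thesis
    by (rule rep_of_XUL_act[OF L.abelian L.delta L.gens_act])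
      (simp_all add: rep_of_simps rep_of_ext L.aV_def L.aW_def)
qed

lemma ext2_eqI:
  assumes "ext2 U V f" "ext2 U V g" "\<And>u v. u \<in> carrier U \<Longrightarrow> v \<in> carrier V \<Longrightarrow> f u v = g u v"
  shows "f = g"
proof (intro ext)
  fix u v
  show "f u v = g u v"
  proof (cases "u \<in> carrier U \<and> v \<in> carrier V")
    case False
    then have "(u, v) \<notin> carrier U \<times> carrier V" by simp
    then have "(\<lambda>(u, v). f u v) (u, v) = undefined" "(\<lambda>(u, v). g u v) (u, v) = undefined"
      using assms(1,2) unfolding ext2_def by (blast intro: extensional_arb)+
    then show ?thesis by simp
  qed (simp add: assms(3))
qed

text \<open>The change of generators makes data in the endomorphism crossed module out of
  \<open>R\<close>, and \<open>XUL_universal\<close> extends them to a left module. Its values on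
  generators give back \<open>R\<close>, since \<open>(a + b) - b = a\<close>.\<close>

lemma rep_of_surj:
  assumes R: "is_rep K X R"
  obtains L where "is_left_module K (XUL K X) L" "rep_of L = R"
proof -
  define V where "V = rep_N R"
  define W where "W = rep_M R"
  note R' = R[unfolded is_rep_def Let_def, folded V_def W_def]
  have ab: "abelian_module K V" "abelian_module K W" and mu: "rep_mu R \<in> lin K V W"
    using R' by blast+
  then have VW: "module K V" "module K W" unfolding abelian_module_def by blast+
  interpret leibniz_two_term K X V W "rep_mu R"
    by (intro leibniz_two_term.intro leibniz_xmod_axioms two_term.intro two_term_axioms.intro VW mu)
  have act: "leibniz_action K P V (rep_lN R) (rep_rN R)" "leibniz_action K P W (rep_lM R) (rep_rM R)"
    and xi: "bilinear_map K Q W V (rep_xi1 R)" "bilinear_map K W Q V (rep_xi2 R)"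
    and exts: "ext2 P V (rep_lN R)" "ext2 V P (rep_rN R)" "ext2 P W (rep_lM R)" "ext2 W P (rep_rM R)"
      "ext2 Q W (rep_xi1 R)" "ext2 W Q (rep_xi2 R)"
    using R' by blast+
  note bil = act(1)[unfolded leibniz_action_def, THEN conjunct1]
      act(1)[unfolded leibniz_action_def, THEN conjunct2, THEN conjunct1]
      act(2)[unfolded leibniz_action_def, THEN conjunct1]
      act(2)[unfolded leibniz_action_def, THEN conjunct2, THEN conjunct1] xi
  note cl = bil[THEN bilinear_mapD(1), THEN linear_mapD(1)]
  define al where "al p = (\<lambda>v\<in>carrier V. rep_lN R p v \<oplus>\<^bsub>V\<^esub> rep_rN R v p,
    \<lambda>w\<in>carrier W. rep_lM R p w \<oplus>\<^bsub>W\<^esub> rep_rM R w p)" for p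
  define ar where "ar p = (\<lambda>v\<in>carrier V. \<ominus>\<^bsub>V\<^esub> rep_rN R v p,
    \<lambda>w\<in>carrier W. \<ominus>\<^bsub>W\<^esub> rep_rM R w p)" for p
  define dl where "dl q = (\<lambda>w\<in>carrier W. rep_xi1 R q w \<oplus>\<^bsub>V\<^esub> rep_xi2 R w q)" for q
  define dr where "dr q = (\<lambda>w\<in>carrier W. \<ominus>\<^bsub>V\<^esub> rep_xi2 R w q)" for q
  have data: "XUL_data K X (End_xmod K V W (rep_mu R)) al ar dl dr"
    by (rule XUL_data_End_iff[THEN iffD2, OF _ _ _ _ XUL_act_of_rep[OF R, folded V_def W_def]])
      (simp_all add: al_def ar_def dl_def dr_def)
  obtain \<phi> \<psi> where hom: "alg_xmod_hom K (XUL K X) (End_xmod K V W (rep_mu R)) \<phi> \<psi>"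
    and one: "\<psi> \<one>\<^bsub>UP\<^esub> = \<one>\<^bsub>E\<^esub>"
    and gens: "\<And>p. p \<in> carrier P \<Longrightarrow> \<psi> (UL_l K P p) = al p" "\<And>p. p \<in> carrier P \<Longrightarrow> \<psi> (UL_r K P p) = ar p"
      "\<And>q. q \<in> carrier Q \<Longrightarrow> \<phi> (bl q) = dl q" "\<And>q. q \<in> carrier Q \<Longrightarrow> \<phi> (br q) = dr q"
    using XUL_universal[OF End_unital_xmod data] unfolding xmod_ops(2) by metis
  define L where "L = \<lparr>lm_V = V, lm_W = W, lm_delta = rep_mu R,
    lm_phi = restrict \<phi> (carrier XT), lm_psi = restrict \<psi> (carrier UP)\<rparr>"
  have L: "is_left_module K (XUL K X) L"
    using alg_xmod_hom_restrict[OF XUL.unital_xmod_axioms hom] ab mu one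
    by (simp add: is_left_module_def L_def Let_def XUL_simps(1))
  have L_sel: "lm_V L = V" "lm_W L = W" "lm_delta L = rep_mu R"
    by (simp_all add: L_def)
  have L_gens: "p \<in> carrier P \<Longrightarrow> lm_psi L (UL_l K P p) = al p"
    "p \<in> carrier P \<Longrightarrow> lm_psi L (UL_r K P p) = ar p"
    "q \<in> carrier Q \<Longrightarrow> lm_phi L (bl q) = dl q" "q \<in> carrier Q \<Longrightarrow> lm_phi L (br q) = dr q" for p q
    by (simp_all add: L_def gens P.UL_gens_closed Top_XUL_iff b_closed Sb_gens)
  note ex = rep_of_ext[of L, unfolded L_sel]
  note defs = al_def ar_def dl_def dr_def
  have "rep_lN (rep_of L) = rep_lN R" "rep_lM (rep_of L) = rep_lM R" "rep_xi1 (rep_of L) = rep_xi1 R"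
    by (rule ext2_eqI[OF ex(1) exts(1)] ext2_eqI[OF ex(3) exts(3)] ext2_eqI[OF ex(5) exts(5)];
        simp add: rep_of_simps L_sel L_gens defs cl V.M.a_assoc W.M.a_assoc V.M.r_neg W.M.r_neg)+
  moreover have "rep_rN (rep_of L) = rep_rN R" "rep_rM (rep_of L) = rep_rM R"
    "rep_xi2 (rep_of L) = rep_xi2 R"
    by (rule ext2_eqI[OF ex(2) exts(2)] ext2_eqI[OF ex(4) exts(4)] ext2_eqI[OF ex(6) exts(6)];
        simp add: rep_of_simps L_sel L_gens defs cl)+
  ultimately have "rep_of L = R"
    by (intro rep.equality) (simp_all add: rep_of_simps L_sel V_def W_def)
  with L that show ?thesis by blast
qed

end

text \<open>The change of generators, which sends \<open>(a, b)\<close> to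
  \<open>(a + b, - b)\<close>, is an involution.\<close>

lemma (in abelian_group) shear_eq_iff:
  assumes "a \<in> carrier G" "b \<in> carrier G" "a' \<in> carrier G" "b' \<in> carrier G"
  shows "a \<oplus> b = a' \<oplus> b' \<and> \<ominus> b = \<ominus> b' \<longleftrightarrow> a = a' \<and> b = b'"
  using assms by (metis minus_minus add.right_cancel)

section \<open>Morphisms of left modules and of representations\<close>

locale left_module_pair = leibniz_xmod K X +
  L: left_module_xmod K X L + L': left_module_xmod K X L'
  for K :: "'k ring" and X :: "('k, 'q, 'p) xmod"
    and L L' :: "('k, ('k, 'q \<times> 'p) ul set, ('k, 'p) ul, 'v, 'w) left_module"
begin

text \<open>The common ground of the two notions of morphism: compatibility is asked for the
  generators \<open>p_l\<close>, \<open>p_r\<close>, \<open>q_l\<close>, \<open>q_r\<close>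
  only.\<close>

definition gen_hom :: "('v \<Rightarrow> 'v) \<Rightarrow> ('w \<Rightarrow> 'w) \<Rightarrow> bool" where
  "gen_hom f g \<longleftrightarrow> f \<in> lin K L.V L'.V \<and> g \<in> lin K L.W L'.W \<and>
    (\<forall>v\<in>carrier L.V. g (lm_delta L v) = lm_delta L' (f v)) \<and>
    (\<forall>p\<in>carrier P.
      (\<forall>v\<in>carrier L.V. f (L.aV (UL_l K P p) v) = L'.aV (UL_l K P p) (f v) \<and>
        f (L.aV (UL_r K P p) v) = L'.aV (UL_r K P p) (f v)) \<and>
      (\<forall>w\<in>carrier L.W. g (L.aW (UL_l K P p) w) = L'.aW (UL_l K P p) (g w) \<and>
        g (L.aW (UL_r K P p) w) = L'.aW (UL_r K P p) (g w))) \<and>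
    (\<forall>q\<in>carrier Q. \<forall>w\<in>carrier L.W. f (lm_phi L (bl q) w) = lm_phi L' (bl q) (g w) \<and>
        f (lm_phi L (br q) w) = lm_phi L' (br q) (g w))"

lemma gens_Top: "q \<in> carrier Q \<Longrightarrow> bl q \<in> carrier XT"
  "q \<in> carrier Q \<Longrightarrow> br q \<in> carrier XT"
  by (simp_all add: Top_XUL_iff b_closed Sb_gens)

text \<open>Commuting with the generators passes to the whole base by \<open>UL_induct\<close>. On
  the top it passes to sums and to multiples by base elements, hence along \<open>span\<close>,
  which is everything by \<open>Top_XUL_span\<close>.\<close>

lemma left_module_hom_iff: "(f, g) \<in> left_module_hom K (XUL K X) L L' \<longleftrightarrow> gen_hom f g"
proof
  assume "(f, g) \<in> left_module_hom K (XUL K X) L L'"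
  then show "gen_hom f g"
    unfolding left_module_hom_def gen_hom_def L.aV_def L'.aV_def L.aW_def L'.aW_def XUL_simps(1)
    by (simp add: P.UL_gens_closed gens_Top)
next
  assume gh: "gen_hom f g"
  then have f: "linear_map K L.V L'.V f" and g: "linear_map K L.W L'.W g"
    unfolding gen_hom_def lin_def by blast+
  note fD = linear_mapD[OF f] and gD = linear_mapD[OF g]
  have psi: "(\<forall>v\<in>carrier L.V. f (L.aV a v) = L'.aV a (f v)) \<and>
      (\<forall>w\<in>carrier L.W. g (L.aW a w) = L'.aW a (g w))" if "a \<in> carrier UP" for a
    using that
  proof (induction a rule: P.UL_induct)
    case (l x)
    then show ?case using gh unfolding gen_hom_def by blast
  next
    case (r x)
    then show ?case using gh unfolding gen_hom_def by blast
  qed (simp_all add: L.psi_ops L'.psi_ops L.a_closed fD gD)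
  have gen: "f (lm_phi L (bl q) w) = lm_phi L' (bl q) (g w)"
    "f (lm_phi L (br q) w) = lm_phi L' (br q) (g w)" if "q \<in> carrier Q" "w \<in> carrier L.W" for q w
    using gh that unfolding gen_hom_def by blast+
  have top: "Ib a \<otimes>\<^bsub>Ub\<^esub> b \<in> carrier XT" "b \<otimes>\<^bsub>Ub\<^esub> Ib a \<in> carrier XT"
    if "a \<in> carrier UP" "b \<in> carrier XT" for a b
    using XUL.top_closed(1)[of a b] XUL.top_closed(2)[of b a] that by (simp_all add: XUL_simps)
  \<comment> \<open>Membership in \<open>XT\<close> is carried through the induction because
    \<open>phi_ops\<close> computes \<open>lm_phi\<close> on sums and multiples of elements of
    \<open>XT\<close>.\<close>
  have phi: "b \<in> carrier XT \<and>
      (\<forall>w\<in>carrier L.W. f (lm_phi L b w) = lm_phi L' b (g w))" if "b \<in> span" for b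
    using that
  proof (induction b rule: span.induct)
    case (add b b')
    then have "b \<oplus>\<^bsub>Ub\<^esub> b' \<in> carrier XT"
      using XUL.Top.M.a_closed[of b b'] by (simp add: XUL_simps)
    with add show ?case by (simp add: L.phi_ops L'.phi_ops L.phi_closed fD gD)
  qed (simp_all add: top gens_Top L.phi_ops L'.phi_ops L.phi_closed L.a_closed L'.a_closed psi gen gD)
  show "(f, g) \<in> left_module_hom K (XUL K X) L L'"
    using gh psi phi[OF Top_XUL_span]
    unfolding left_module_hom_def gen_hom_def L.aV_def L'.aV_def L.aW_def L'.aW_def XUL_simps(1)
    by simp
qed

text \<open>Linear maps pass through the sums and negatives in \<open>rep_of\<close>, and
  \<open>shear_eq_iff\<close> then trades agreement on a pair of brackets for agreement on the
  corresponding pair of generators.\<close>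

lemma rep_hom_iff: "(f, g) \<in> rep_hom K X (rep_of L) (rep_of L') \<longleftrightarrow> gen_hom f g"
proof (cases "f \<in> lin K L.V L'.V \<and> g \<in> lin K L.W L'.W")
  case True
  then have f: "linear_map K L.V L'.V f" and g: "linear_map K L.W L'.W g"
    unfolding lin_def by blast+
  note fD = linear_mapD[OF f] linear_map_uminus[OF L.V.abelian_group_axioms L'.V.abelian_group_axioms f]
  note gD = linear_mapD[OF g] linear_map_uminus[OF L.W.abelian_group_axioms L'.W.abelian_group_axioms g]
  have cl: "L.aV (UL_l K P p) v \<in> carrier L.V" "L.aV (UL_r K P p) v \<in> carrier L.V"
    "L'.aV (UL_l K P p) (f v) \<in> carrier L'.V" "L'.aV (UL_r K P p) (f v) \<in> carrier L'.V"
    if "p \<in> carrier P" "v \<in> carrier L.V" for p v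
    using that by (simp_all add: L.a_closed L'.a_closed fD P.UL_gens_closed)
  have cl': "L.aW (UL_l K P p) w \<in> carrier L.W" "L.aW (UL_r K P p) w \<in> carrier L.W"
    "L'.aW (UL_l K P p) (g w) \<in> carrier L'.W" "L'.aW (UL_r K P p) (g w) \<in> carrier L'.W"
    if "p \<in> carrier P" "w \<in> carrier L.W" for p w
    using that by (simp_all add: L.a_closed L'.a_closed gD P.UL_gens_closed)
  have clx: "lm_phi L (bl q) w \<in> carrier L.V" "lm_phi L (br q) w \<in> carrier L.V"
    "lm_phi L' (bl q) (g w) \<in> carrier L'.V" "lm_phi L' (br q) (g w) \<in> carrier L'.V"
    if "q \<in> carrier Q" "w \<in> carrier L.W" for q w
    using that by (simp_all add: L.phi_closed L'.phi_closed gD gens_Top)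
  have N: "f (rep_lN (rep_of L) p v) = rep_lN (rep_of L') p (f v) \<and>
        f (rep_rN (rep_of L) v p) = rep_rN (rep_of L') (f v) p \<longleftrightarrow>
      f (L.aV (UL_l K P p) v) = L'.aV (UL_l K P p) (f v) \<and>
        f (L.aV (UL_r K P p) v) = L'.aV (UL_r K P p) (f v)"
    if "p \<in> carrier P" "v \<in> carrier L.V" for p v
    using that cl[OF that] L'.V.M.shear_eq_iff
    by (simp add: rep_of_simps fD L.aV_def[symmetric] L'.aV_def[symmetric])
  have M: "g (rep_lM (rep_of L) p w) = rep_lM (rep_of L') p (g w) \<and>
        g (rep_rM (rep_of L) w p) = rep_rM (rep_of L') (g w) p \<longleftrightarrow>
      g (L.aW (UL_l K P p) w) = L'.aW (UL_l K P p) (g w) \<and>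
        g (L.aW (UL_r K P p) w) = L'.aW (UL_r K P p) (g w)"
    if "p \<in> carrier P" "w \<in> carrier L.W" for p w
    using that cl'[OF that] L'.W.M.shear_eq_iff
    by (simp add: rep_of_simps gD L.aW_def[symmetric] L'.aW_def[symmetric])
  have xi: "f (rep_xi1 (rep_of L) q w) = rep_xi1 (rep_of L') q (g w) \<and>
        f (rep_xi2 (rep_of L) w q) = rep_xi2 (rep_of L') (g w) q \<longleftrightarrow>
      f (lm_phi L (bl q) w) = lm_phi L' (bl q) (g w) \<and>
        f (lm_phi L (br q) w) = lm_phi L' (br q) (g w)"
    if "q \<in> carrier Q" "w \<in> carrier L.W" for q w
    using that clx[OF that] L'.V.M.shear_eq_iff
    by (simp add: rep_of_simps fD gD)
  show ?thesis
    unfolding rep_hom_def gen_hom_def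
    using True by (simp add: rep_of_simps(1-3) N M xi ball_conj_distrib[symmetric] cong: ball_cong)
      (simp only: ball_conj_distrib conj_ac)
next
  case False
  then show ?thesis by (auto simp: rep_hom_def gen_hom_def rep_of_simps)
qed

end

lemma (in leibniz_xmod) hom_rep_of:
  assumes "is_left_module K (XUL K X) L" "is_left_module K (XUL K X) L'"
  shows "rep_hom K X (rep_of L) (rep_of L') = left_module_hom K (XUL K X) L L'"
proof -
  interpret left_module_pair K X L L'
    using assms by (intro left_module_pair.intro left_module_xmod.intro left_module_xmod_axioms.intro
        leibniz_xmod_axioms)
  show ?thesis using rep_hom_iff left_module_hom_iff by auto
qed

lemma (in left_module_xmod) identity_hom:
  "(\<lambda>v\<in>carrier V. v, \<lambda>w\<in>carrier W. w) \<in> left_module_hom K (XUL K X) L L"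
proof -
  have "fst (lm_psi L a) v \<in> carrier V" if "a \<in> carrier UP" "v \<in> carrier V" for a v
    using a_closed(1)[OF that] by (simp add: aV_def)
  moreover have "snd (lm_psi L a) w \<in> carrier W" if "a \<in> carrier UP" "w \<in> carrier W" for a w
    using a_closed(2)[OF that] by (simp add: aW_def)
  ultimately show ?thesis
    by (simp add: left_module_hom_def lin_iff delta_simps XUL_simps(1) phi_closed)
qed

text \<open>The identity maps commute with the generators, hence with the whole of \<open>XUL\<close>.\<close>

lemma (in leibniz_xmod) rep_of_inj:
  assumes L: "is_left_module K (XUL K X) L" and L': "is_left_module K (XUL K X) L'"
    and eq: "rep_of L = rep_of L'"
  shows "L = L'"
proof -
  interpret L: left_module_xmod K X L by unfold_locales (rule L)
  interpret L': left_module_xmod K X L' by unfold_locales (rule L')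
  have sel: "L'.V = L.V" "L'.W = L.W" "lm_delta L' = lm_delta L"
    using eq rep_of_simps(1-3) by metis+
  \<comment> \<open>By \<open>hom_rep_of\<close> the morphisms from \<open>L\<close> to
    \<open>L\<close> and from \<open>L\<close> to \<open>L'\<close> are both the morphisms between
    the same two representations, so the identity of \<open>L\<close> is also a morphism to
    \<open>L'\<close>.\<close>
  have id: "(\<lambda>v\<in>carrier L.V. v, \<lambda>w\<in>carrier L.W. w) \<in> left_module_hom K (XUL K X) L L'"
    using L.identity_hom hom_rep_of[OF L L] hom_rep_of[OF L L'] eq by simp
  have psi: "lm_psi L a = lm_psi L' a" if a: "a \<in> carrier UP" for a
  proof -
    have "fst (lm_psi L a) v = fst (lm_psi L' a) v" if "v \<in> carrier L.V" for v
    proof -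
      have "(\<lambda>v\<in>carrier L.V. v) (fst (lm_psi L a) v) = fst (lm_psi L' a) ((\<lambda>v\<in>carrier L.V. v) v)"
        using id a that unfolding left_module_hom_def XUL_simps(1) by blast
      then show ?thesis using that L.a_closed(1)[OF a that] by (simp add: L.aV_def)
    qed
    moreover have "snd (lm_psi L a) w = snd (lm_psi L' a) w" if "w \<in> carrier L.W" for w
    proof -
      have "(\<lambda>w\<in>carrier L.W. w) (snd (lm_psi L a) w) = snd (lm_psi L' a) ((\<lambda>w\<in>carrier L.W. w) w)"
        using id a that unfolding left_module_hom_def XUL_simps(1) by blast
      then show ?thesis using that L.a_closed(2)[OF a that] by (simp add: L.aW_def)
    qed
    ultimately have "restrict (L.aV a) (carrier L.V) = restrict (L'.aV a) (carrier L.V)"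
      "restrict (L.aW a) (carrier L.W) = restrict (L'.aW a) (carrier L.W)"
      by (simp_all add: restrict_eq_iff L.aV_def L.aW_def L'.aV_def L'.aW_def)
    then show ?thesis
      unfolding L.psi_eq[OF a] L'.psi_eq[OF a] sel by simp
  qed
  have phi: "lm_phi L b = lm_phi L' b" if b: "b \<in> carrier XT" for b
  proof -
    have "lm_phi L b w = lm_phi L' b w" if "w \<in> carrier L.W" for w
    proof -
      have "(\<lambda>v\<in>carrier L.V. v) (lm_phi L b w) = lm_phi L' b ((\<lambda>w\<in>carrier L.W. w) w)"
        using id b that unfolding left_module_hom_def by blast
      then show ?thesis using that L.phi_closed[OF b that] by simp
    qed
    then have "restrict (lm_phi L b) (carrier L.W) = restrict (lm_phi L' b) (carrier L.W)"
      by (simp add: restrict_eq_iff)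
    then show ?thesis
      using L.phi_eq[OF b] L'.phi_eq[OF b] sel by simp
  qed
  have "lm_psi L = lm_psi L'"
    by (rule extensionalityI[OF L.ext(2) L'.ext(2) psi])
  moreover have "lm_phi L = lm_phi L'"
    by (rule extensionalityI[OF L.ext(1) L'.ext(1) phi])
  ultimately show ?thesis using sel by (intro left_module.equality) simp_all
qed

section \<open>The two categories and their isomorphism\<close>

lemma lin_compose: "f \<in> lin K U V \<Longrightarrow> g \<in> lin K V W \<Longrightarrow> compose (carrier U) g f \<in> lin K U W"
  if "module K U"
proof -
  interpret U: module K U by (rule that)
  assume "f \<in> lin K U V" "g \<in> lin K V W"
  then show ?thesis by (auto simp: lin_iff compose_def)
qed

text \<open>The category laws are verified on this side; \<open>isomorphic_categories_bij\<close>
  carries them over to representations.\<close>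

lemma (in leibniz_xmod) left_module_is_category: "is_category (left_module_category K (XUL K X))"
proof -
  let ?C = "left_module_category K (XUL K X)"
  let ?hom = "left_module_hom K (XUL K X)"
  have comp: "(compose (carrier (lm_V L)) f' f, compose (carrier (lm_W L)) g' g) \<in> ?hom L L''"
    if L: "is_left_module K (XUL K X) L"
      and h: "(f, g) \<in> ?hom L L'" and h': "(f', g') \<in> ?hom L' L''"
    for L L' L'' f g f' g'
  proof -
    interpret L: left_module_xmod K X L by unfold_locales (rule L)
    have psi: "v \<in> carrier L.V \<Longrightarrow> fst (lm_psi L a) v \<in> carrier L.V"
      "w \<in> carrier L.W \<Longrightarrow> snd (lm_psi L a) w \<in> carrier L.W"
      if "a \<in> carrier UP" for a v w
      using L.a_closed[OF that] unfolding L.aV_def L.aW_def by blast+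
    have fg: "f \<in> lin K L.V (lm_V L')" "g \<in> lin K L.W (lm_W L')"
      "f' \<in> lin K (lm_V L') (lm_V L'')" "g' \<in> lin K (lm_W L') (lm_W L'')"
      using h h' unfolding left_module_hom_def by blast+
    have cl: "v \<in> carrier L.V \<Longrightarrow> f v \<in> carrier (lm_V L')" "w \<in> carrier L.W \<Longrightarrow> g w \<in> carrier (lm_W L')"
      for v w
      using fg(1,2) unfolding lin_iff by blast+
    have hD: "v \<in> carrier L.V \<Longrightarrow> g (lm_delta L v) = lm_delta L' (f v)"
      "a \<in> carrier UP \<Longrightarrow> v \<in> carrier L.V \<Longrightarrow> f (fst (lm_psi L a) v) = fst (lm_psi L' a) (f v)"
      "a \<in> carrier UP \<Longrightarrow> w \<in> carrier L.W \<Longrightarrow> g (snd (lm_psi L a) w) = snd (lm_psi L' a) (g w)"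
      "b \<in> carrier XT \<Longrightarrow> w \<in> carrier L.W \<Longrightarrow> f (lm_phi L b w) = lm_phi L' b (g w)"
      for a b v w
      using h unfolding left_module_hom_def XUL_simps(1) by blast+
    have h'D: "v \<in> carrier (lm_V L') \<Longrightarrow> g' (lm_delta L' v) = lm_delta L'' (f' v)"
      "a \<in> carrier UP \<Longrightarrow> v \<in> carrier (lm_V L') \<Longrightarrow> f' (fst (lm_psi L' a) v) = fst (lm_psi L'' a) (f' v)"
      "a \<in> carrier UP \<Longrightarrow> w \<in> carrier (lm_W L') \<Longrightarrow> g' (snd (lm_psi L' a) w) = snd (lm_psi L'' a) (g' w)"
      "b \<in> carrier XT \<Longrightarrow> w \<in> carrier (lm_W L') \<Longrightarrow> f' (lm_phi L' b w) = lm_phi L'' b (g' w)"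
      for a b v w
      using h' unfolding left_module_hom_def XUL_simps(1) by blast+
    show ?thesis
      unfolding left_module_hom_def XUL_simps(1)
      by (simp add: lin_compose[OF L.V.module_axioms fg(1,3)] lin_compose[OF L.W.module_axioms fg(2,4)]
          compose_eq psi cl L.phi_closed L.delta_simps hD h'D)
  qed
  have ident: "compose (carrier (lm_V L)) f (\<lambda>v\<in>carrier (lm_V L). v) = f"
      "compose (carrier (lm_W L)) g (\<lambda>v\<in>carrier (lm_W L). v) = g"
      "compose (carrier (lm_V L)) (\<lambda>v\<in>carrier (lm_V L'). v) f = f"
      "compose (carrier (lm_W L)) (\<lambda>v\<in>carrier (lm_W L'). v) g = g"
    if h: "(f, g) \<in> ?hom L L'" for L L' f g
    using h by (auto simp: left_module_hom_def lin_iff compose_def restrict_def fun_eq_iff)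
  have assoc: "compose A (compose B h g) f = compose A h (compose A g f)"
    if "\<And>x. x \<in> A \<Longrightarrow> f x \<in> B" for A B h g f
    using that by (auto simp: compose_def fun_eq_iff restrict_def)
  show ?thesis
    unfolding is_category_def
  proof (intro conjI ballI)
    fix L L' L'' h h'
    assume "L \<in> Obj ?C" "L' \<in> Obj ?C" "L'' \<in> Obj ?C" "h \<in> Hom ?C L L'" "h' \<in> Hom ?C L' L''"
    then show "Comp ?C L L' L'' h' h \<in> Hom ?C L L''"
      using comp by (cases h; cases h') (simp add: left_module_category_def)
  next
    fix L assume "L \<in> Obj ?C"
    then interpret L: left_module_xmod K X L
      by unfold_locales (simp add: left_module_category_def)
    show "Id ?C L \<in> Hom ?C L L"
      using L.identity_hom by (simp add: left_module_category_def)
  next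
    fix L L' h assume h: "h \<in> Hom ?C L L'"
    obtain f g where fg: "h = (f, g)" by (cases h)
    have "(f, g) \<in> ?hom L L'" using h by (simp add: fg left_module_category_def)
    from ident[OF this] show "Comp ?C L L L' h (Id ?C L) = h" "Comp ?C L L' L' (Id ?C L') h = h"
      by (simp_all add: fg left_module_category_def)
  next
    fix L1 L2 L3 L4 a b c
    assume "a \<in> Hom ?C L1 L2"
    then have "\<And>x. x \<in> carrier (lm_V L1) \<Longrightarrow> fst a x \<in> carrier (lm_V L2)"
      "\<And>x. x \<in> carrier (lm_W L1) \<Longrightarrow> snd a x \<in> carrier (lm_W L2)"
      by (auto simp: left_module_category_def left_module_hom_def lin_iff)
    then show "Comp ?C L1 L2 L4 (Comp ?C L2 L3 L4 c b) a = Comp ?C L1 L3 L4 c (Comp ?C L1 L2 L3 b a)"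
      by (cases a; cases b; cases c) (simp add: left_module_category_def assoc)
  qed
qed

text \<open>Arrows of both categories have the same type, so a functor can be the identity on them.
  Given a bijection on objects, its inverse together with the identity on arrows is then the inverse
  functor, and the laws of \<open>D\<close> become those of \<open>C\<close>.\<close>

lemma isomorphic_categories_bij:
  assumes D: "is_category D" and G: "bij_betw G (Obj D) (Obj C)"
    and hom: "\<And>X Y. X \<in> Obj D \<Longrightarrow> Y \<in> Obj D \<Longrightarrow> Hom C (G X) (G Y) = Hom D X Y"
    and id: "\<And>X. X \<in> Obj D \<Longrightarrow> Id C (G X) = Id D X"
    and comp: "\<And>X Y Z g f. X \<in> Obj D \<Longrightarrow> Comp C (G X) (G Y) (G Z) g f = Comp D X Y Z g f"
  shows "isomorphic_categories C D"
proof -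
  define F where "F = the_inv_into (Obj D) G"
  have inj: "inj_on G (Obj D)" and img: "Obj C = G ` Obj D"
    using G by (auto simp: bij_betw_def)
  have FG: "F (G X) = X" if "X \<in> Obj D" for X
    unfolding F_def by (rule the_inv_into_f_f[OF inj that])
  have "is_category C"
    using D unfolding is_category_def img by (simp add: hom id comp)
  moreover have "is_functor D C G (\<lambda>_ _ f. f)" "is_functor C D F (\<lambda>_ _ f. f)"
    unfolding is_functor_def img by (simp_all add: FG hom id comp)
  moreover have "\<forall>X\<in>Obj C. G (F X) = X" "\<forall>X\<in>Obj D. F (G X) = X"
    unfolding img by (simp_all add: FG)
  ultimately show ?thesis
    unfolding isomorphic_categories_def using D by blast
qed

theorem theorem5p1:
  fixes K :: "'k ring" and X :: "('k, 'q, 'p) xmod"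
  assumes "cring K" and "leibniz_crossed_module K X"
  shows "isomorphic_categories
    (rep_category K X :: (('k, 'q, 'p, 'n, 'm) rep, ('n \<Rightarrow> 'n) \<times> ('m \<Rightarrow> 'm)) category)
    (left_module_category K (XUL K X) ::
      (('k, ('k, 'q \<times> 'p) ul set, ('k, 'p) ul, 'n, 'm) left_module,
       ('n \<Rightarrow> 'n) \<times> ('m \<Rightarrow> 'm)) category)"
proof -
  interpret leibniz_xmod K X by (rule leibniz_xmod.intro[OF assms])
  show ?thesis
  proof (rule isomorphic_categories_bij[where G = rep_of])
    show "is_category (left_module_category K (XUL K X) ::
      (('k, ('k, 'q \<times> 'p) ul set, ('k, 'p) ul, 'n, 'm) left_module,
       ('n \<Rightarrow> 'n) \<times> ('m \<Rightarrow> 'm)) category)"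
      by (rule left_module_is_category)
    show "bij_betw rep_of (Obj (left_module_category K (XUL K X))) (Obj (rep_category K X))"
    proof (rule bij_betw_imageI)
      show "inj_on rep_of (Obj (left_module_category K (XUL K X)))"
        by (rule inj_onI) (auto simp: left_module_category_def intro: rep_of_inj)
      have "R \<in> rep_of ` {L. is_left_module K (XUL K X) L}" if "is_rep K X R" for R
        using rep_of_surj[OF that] by blast
      then show "rep_of ` Obj (left_module_category K (XUL K X)) = Obj (rep_category K X)"
        using rep_of_is_rep by (auto simp: left_module_category_def rep_category_def)
    qed
  qed (auto simp: rep_category_def left_module_category_def hom_rep_of rep_of_simps)
qed

end
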